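(* Let $T\in\mathcal{O}_C'(\mathbb{R})$. Then the following properties are equivalent: (1) $C_T$ is power bounded on $\mathcal{S}(\mathbb{R})$. (1)' $\mathcal{C}_T$ is power bounded on $\mathcal{S}'(\mathbb{R})$. (2) $C_T$ is power bounded on $\mathcal{O}_C(\mathbb{R})$. (2)' $\mathcal{C}_T$ is power bounded on $\mathcal{O}_C'(\mathbb{R})$. (3) The sequence $\{(\star T)^n\}_{n\in\mathbb{N}}$ is bounded in $\mathcal{O}_C'(\mathbb{R})$.
   Context: All functions are complex-valued. $\mathcal{S}(\mathbb{R})$ is the Schwartz space of $f\in C^\infty(\mathbb{R})$ with $\|f\|_n:=\sup_{x\in\mathbb{R}}\sup_{0\le i\le n}(1+x^2)^n|f^{(i)}(x)|<\infty$ for all $n\in\mathbb{N}_0$, a Fréchet space with these norms; $\mathcal{S}'(\mathbb{R})$ is its strong dual. For $m,n\in\mathbb{N}$ and $f\in C^\infty(\mathbb{R})$ let $|f|_{m,n}:=\sup_{x\in\mathbb{R}}\sup_{0\le i\le m}(1+x^2)^{-n}|f^{(i)}(x)|$. $\mathcal{O}_C(\mathbb{R})$ is the space of $f\in C^\infty(\mathbb{R})$ such that there is $n$ with $|f|_{m,n}<\infty$ for all $m$, with the locally convex inductive limit topology (over $n$) of the Fréchet spaces $\{f\in C^\infty(\mathbb{R})\colon|f|_{m,n}<\infty\ \forall m\}$ normed by $|\cdot|_{m,n}$, $m\in\mathbb{N}$. $\mathcal{O}_C'(\mathbb{R})$ is the strong dual of $\mathcal{O}_C(\mathbb{R})$;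 it is regarded as a subspace of $\mathcal{S}'(\mathbb{R})$ and is the space of convolutors of $\mathcal{S}(\mathbb{R})$. For $T\in\mathcal{O}_C'(\mathbb{R})$ and $f\in\mathcal{S}(\mathbb{R})$ or $f\in\mathcal{O}_C(\mathbb{R})$, $(T\star f)(x)=\langle T_y,f(x-y)\rangle$, $x\in\mathbb{R}$; the map $C_T\colon f\mapsto T\star f$ is continuous from $\mathcal{S}(\mathbb{R})$ into itself and from $\mathcal{O}_C(\mathbb{R})$ into itself. For $S\in\mathcal{S}'(\mathbb{R})$, $T\star S\in\mathcal{S}'(\mathbb{R})$ is defined by $(T\star S)(f)=\langle S,\check T\star f\rangle$, $f\in\mathcal{S}(\mathbb{R})$, where $\langle\check T,\varphi\rangle=\langle T,\check\varphi\rangle$ and $\check\varphi(y)=\varphi(-y)$; if $S\in\mathcal{O}_C'(\mathbb{R})$ then $T\star S\in\mathcal{O}_C'(\mathbb{R})$. The map $\mathcal{C}_T\colon S\mapsto T\star S$ is continuous from $\mathcal{S}'(\mathbb{R})$ into itself and from $\mathcal{O}_C'(\mathbb{R})$ into itself. Set $(\star T)^1=T$ and $(\star T)^n=T\star(\star T)^{n-1}\in\mathcal{O}_C'(\mathbb{R})$ for $n\ge2$. A continuous linear operator $A$ on a locally convex Hausdorff space $E$ is power bounded if $\{A^n\}_{n\in\mathbb{N}}$ is an equicontinuous subset of $\mathcal{L}(E)$, the space of continuous linear operators on $E$. *)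

theory Defs
  imports "HOL-Analysis.Analysis"
begin

section \<open>Locally convex spaces of complex-valued functions\<close>

text \<open>
  Every vector space below is a set of functions \<open>'x \<Rightarrow> complex\<close> with pointwise operations.
  For function spaces \<open>'x\<close> is \<^typ>\<open>real\<close>, for dual spaces \<open>'x\<close> is itself a type of
  functions. A locally convex space is given by its topology, with the vector space as
  \<^const>\<open>topspace\<close>.
\<close>

definition lc_topology ::
  "('x \<Rightarrow> complex) set \<Rightarrow> (('x \<Rightarrow> complex) \<Rightarrow> real) set \<Rightarrow> ('x \<Rightarrow> complex) topology" where
  "lc_topology E P = topology (\<lambda>U. U \<subseteq> E \<and>
     (\<forall>f\<in>U. \<exists>F e. finite F \<and> F \<subseteq> P \<and> 0 < e \<and> {g\<in>E. \<forall>p\<in>F. p (\<lambda>x. g x - f x) < e} \<subseteq> U))"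

lemma openin_lc_topology:
  "openin (lc_topology E P) U \<longleftrightarrow> U \<subseteq> E \<and>
     (\<forall>f\<in>U. \<exists>F e. finite F \<and> F \<subseteq> P \<and> 0 < e \<and> {g\<in>E. \<forall>p\<in>F. p (\<lambda>x. g x - f x) < e} \<subseteq> U)"
proof -
  define nb where "nb F e f = {g\<in>E. \<forall>p\<in>F. p (\<lambda>x. g x - f x) < (e::real)}" for F e f
  define N where "N U f \<longleftrightarrow> (\<exists>F e. finite F \<and> F \<subseteq> P \<and> 0 < e \<and> nb F e f \<subseteq> U)" for U f
  have N_Int: "N (S \<inter> T) f" if S: "N S f" and T: "N T f" for S T f
  proof -
    obtain F e where F: "finite F" "F \<subseteq> P" "0 < e" "nb F e f \<subseteq> S"
      using S unfolding N_def by blast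
    obtain G d where G: "finite G" "G \<subseteq> P" "0 < d" "nb G d f \<subseteq> T"
      using T unfolding N_def by blast
    have "nb (F \<union> G) (min e d) f \<subseteq> nb F e f \<inter> nb G d f"
      unfolding nb_def by auto
    then have "nb (F \<union> G) (min e d) f \<subseteq> S \<inter> T"
      using F(4) G(4) by blast
    moreover have "finite (F \<union> G)" "F \<union> G \<subseteq> P" "0 < min e d"
      using F G by auto
    ultimately show ?thesis
      unfolding N_def by blast
  qed
  have N_mono: "N T f" if "N S f" "S \<subseteq> T" for S T f
    using that unfolding N_def by (meson subset_trans)
  have "istopology (\<lambda>U. U \<subseteq> E \<and> (\<forall>f\<in>U. N U f))"
    unfolding istopology_def
  proof (rule conjI)
    show "\<forall>S T. S \<subseteq> E \<and> (\<forall>f\<in>S. N S f) \<longrightarrow> T \<subseteq> E \<and> (\<forall>f\<in>T. N T f) \<longrightarrow>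
            S \<inter> T \<subseteq> E \<and> (\<forall>f\<in>S \<inter> T. N (S \<inter> T) f)"
      by (blast intro: N_Int)
    show "\<forall>K. (\<forall>S\<in>K. S \<subseteq> E \<and> (\<forall>f\<in>S. N S f)) \<longrightarrow> \<Union>K \<subseteq> E \<and> (\<forall>f\<in>\<Union>K. N (\<Union>K) f)"
      by (blast intro: N_mono)
  qed
  then have "openin (topology (\<lambda>U. U \<subseteq> E \<and> (\<forall>f\<in>U. N U f))) U \<longleftrightarrow> U \<subseteq> E \<and> (\<forall>f\<in>U. N U f)"
    by (simp only: topology_inverse')
  then show ?thesis
    unfolding lc_topology_def N_def nb_def .
qed

lemma topspace_lc_topology [simp]: "topspace (lc_topology E P) = E"
proof
  show "topspace (lc_topology E P) \<subseteq> E"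
    using openin_lc_topology openin_topspace by blast
  have "openin (lc_topology E P) E"
    unfolding openin_lc_topology
    by (intro conjI ballI exI[of _ "{}"] exI[of _ "1::real"]) auto
  then show "E \<subseteq> topspace (lc_topology E P)"
    by (rule openin_subset)
qed

definition seminorm_on :: "('x \<Rightarrow> complex) set \<Rightarrow> (('x \<Rightarrow> complex) \<Rightarrow> real) \<Rightarrow> bool" where
  "seminorm_on E p \<longleftrightarrow>
     (\<forall>f\<in>E. 0 \<le> p f) \<and>
     (\<forall>f\<in>E. \<forall>g\<in>E. p (\<lambda>x. f x + g x) \<le> p f + p g) \<and>
     (\<forall>c. \<forall>f\<in>E. p (\<lambda>x. c * f x) = norm c * p f)"

text \<open>Boundedness in the sense of von Neumann: absorbed by every neighbourhood of zero.\<close>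

definition lc_bounded :: "('x \<Rightarrow> complex) topology \<Rightarrow> ('x \<Rightarrow> complex) set \<Rightarrow> bool" where
  "lc_bounded X B \<longleftrightarrow> B \<subseteq> topspace X \<and>
     (\<forall>U. openin X U \<and> (\<lambda>_. 0) \<in> U \<longrightarrow> (\<exists>r>0. \<forall>f\<in>B. (\<lambda>x. f x / of_real r) \<in> U))"

definition continuous_operator ::
  "('x \<Rightarrow> complex) topology \<Rightarrow> (('x \<Rightarrow> complex) \<Rightarrow> ('x \<Rightarrow> complex)) \<Rightarrow> bool" where
  "continuous_operator X A \<longleftrightarrow>
     continuous_map X X A \<and>
     (\<forall>f\<in>topspace X. \<forall>g\<in>topspace X. A (\<lambda>x. f x + g x) = (\<lambda>x. A f x + A g x)) \<and>
     (\<forall>c. \<forall>f\<in>topspace X. A (\<lambda>x. c * f x) = (\<lambda>x. c * A f x))"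

definition equicontinuous ::
  "('x \<Rightarrow> complex) topology \<Rightarrow> (('x \<Rightarrow> complex) \<Rightarrow> ('x \<Rightarrow> complex)) set \<Rightarrow> bool" where
  "equicontinuous X \<A> \<longleftrightarrow>
     (\<forall>A\<in>\<A>. continuous_operator X A) \<and>
     (\<forall>V. openin X V \<and> (\<lambda>_. 0) \<in> V \<longrightarrow>
        (\<exists>U. openin X U \<and> (\<lambda>_. 0) \<in> U \<and> (\<forall>A\<in>\<A>. A ` U \<subseteq> V)))"

definition power_bounded ::
  "('x \<Rightarrow> complex) topology \<Rightarrow> (('x \<Rightarrow> complex) \<Rightarrow> ('x \<Rightarrow> complex)) \<Rightarrow> bool" where
  "power_bounded X A \<longleftrightarrow>
     continuous_operator X A \<and> equicontinuous X {A ^^ n | n. 1 \<le> n}"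

text \<open>
  Functionals are extended by zero outside the space, so that distinct elements of the dual are
  distinct functions and the dual is closed under the pointwise operations.
\<close>

definition dual_space ::
  "('x \<Rightarrow> complex) topology \<Rightarrow> (('x \<Rightarrow> complex) \<Rightarrow> complex) set" where
  "dual_space X = {T. continuous_map X euclidean T \<and>
     (\<forall>f\<in>topspace X. \<forall>g\<in>topspace X. T (\<lambda>x. f x + g x) = T f + T g) \<and>
     (\<forall>c. \<forall>f\<in>topspace X. T (\<lambda>x. c * f x) = c * T f) \<and>
     (\<forall>f. f \<notin> topspace X \<longrightarrow> T f = 0)}"

text \<open>The empty set is excluded because the supremum of \<open>{}\<close> is unspecified in \<^typ>\<open>real\<close>.\<close>

definition strong_dual ::
  "('x \<Rightarrow> complex) topology \<Rightarrow> (('x \<Rightarrow> complex) \<Rightarrow> complex) topology" where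
  "strong_dual X = lc_topology (dual_space X)
     {(\<lambda>T. SUP f\<in>B. norm (T f)) | B. lc_bounded X B \<and> B \<noteq> {}}"


section \<open>The spaces S and \<open>O_C\<close>\<close>

definition nth_deriv :: "nat \<Rightarrow> (real \<Rightarrow> complex) \<Rightarrow> real \<Rightarrow> complex" where
  "nth_deriv i f = ((\<lambda>g x. vector_derivative g (at x)) ^^ i) f"

definition smooth :: "(real \<Rightarrow> complex) \<Rightarrow> bool" where
  "smooth f \<longleftrightarrow> (\<forall>i x. nth_deriv i f differentiable at x)"

text \<open>
  Real suprema of unbounded sets are unspecified; finiteness of a norm is therefore expressed by
  \<^const>\<open>bdd_above\<close>.
\<close>

definition schwartz_values :: "nat \<Rightarrow> (real \<Rightarrow> complex) \<Rightarrow> real set" where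
  "schwartz_values n f = {(1 + x\<^sup>2) ^ n * norm (nth_deriv i f x) | x i. i \<le> n}"

definition schwartz_norm :: "nat \<Rightarrow> (real \<Rightarrow> complex) \<Rightarrow> real" where
  "schwartz_norm n f = Sup (schwartz_values n f)"

definition Schwartz :: "(real \<Rightarrow> complex) set" where
  "Schwartz = {f. smooth f \<and> (\<forall>n. bdd_above (schwartz_values n f))}"

definition Schwartz_top :: "(real \<Rightarrow> complex) topology" where
  "Schwartz_top = lc_topology Schwartz (range schwartz_norm)"

definition OC_values :: "nat \<Rightarrow> nat \<Rightarrow> (real \<Rightarrow> complex) \<Rightarrow> real set" where
  "OC_values m n f = {norm (nth_deriv i f x) / (1 + x\<^sup>2) ^ n | x i. i \<le> m}"

definition OC_norm :: "nat \<Rightarrow> nat \<Rightarrow> (real \<Rightarrow> complex) \<Rightarrow> real" where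
  "OC_norm m n f = Sup (OC_values m n f)"

definition OC_step :: "nat \<Rightarrow> (real \<Rightarrow> complex) set" where
  "OC_step n = {f. smooth f \<and> (\<forall>m\<ge>1. bdd_above (OC_values m n f))}"

definition OC_step_top :: "nat \<Rightarrow> (real \<Rightarrow> complex) topology" where
  "OC_step_top n = lc_topology (OC_step n) {OC_norm m n | m. 1 \<le> m}"

definition OC :: "(real \<Rightarrow> complex) set" where
  "OC = (\<Union>n\<in>{1..}. OC_step n)"

text \<open>
  The locally convex inductive limit topology is the finest locally convex topology for which
  the inclusions of all steps are continuous, i.e. the one generated by all
  seminorms whose restriction to each step is continuous.
\<close>

definition OC_top :: "(real \<Rightarrow> complex) topology" where
  "OC_top = lc_topology OC
     {p. seminorm_on OC p \<and> (\<forall>n\<ge>1. continuous_map (OC_step_top n) euclideanreal p)}"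


section \<open>Duals and convolution\<close>

abbreviation Schwartz_dual_top :: "((real \<Rightarrow> complex) \<Rightarrow> complex) topology" where
  "Schwartz_dual_top \<equiv> strong_dual Schwartz_top"

abbreviation OC_dual_top :: "((real \<Rightarrow> complex) \<Rightarrow> complex) topology" where
  "OC_dual_top \<equiv> strong_dual OC_top"

text \<open>The embedding of the dual of \<open>O_C\<close> into the tempered distributions.\<close>

definition to_tempered ::
  "((real \<Rightarrow> complex) \<Rightarrow> complex) \<Rightarrow> (real \<Rightarrow> complex) \<Rightarrow> complex" where
  "to_tempered T = (\<lambda>f. if f \<in> Schwartz then T f else 0)"

definition reflect :: "((real \<Rightarrow> complex) \<Rightarrow> complex) \<Rightarrow> (real \<Rightarrow> complex) \<Rightarrow> complex" where
  "reflect T = (\<lambda>\<phi>. T (\<lambda>y. \<phi> (- y)))"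

definition conv_fun ::
  "((real \<Rightarrow> complex) \<Rightarrow> complex) \<Rightarrow> (real \<Rightarrow> complex) \<Rightarrow> real \<Rightarrow> complex" where
  "conv_fun T f = (\<lambda>x. T (\<lambda>y. f (x - y)))"

definition conv_tempered ::
  "((real \<Rightarrow> complex) \<Rightarrow> complex) \<Rightarrow> ((real \<Rightarrow> complex) \<Rightarrow> complex) \<Rightarrow> (real \<Rightarrow> complex) \<Rightarrow> complex" where
  "conv_tempered T S = (\<lambda>f. if f \<in> Schwartz then S (conv_fun (reflect T) f) else 0)"

text \<open>
  For \<open>S\<close> in the dual of \<open>O_C\<close>, the tempered distribution \<open>T \<star> S\<close> again belongs to the (embedded)
  dual of \<open>O_C\<close>. As elements of that dual are represented by functionals on all of \<open>O_C\<close>,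
  \<open>T \<star> S\<close> is the one that restricts to it; it is unique because the Schwartz space is
  dense in \<open>O_C\<close>.
\<close>

definition conv_OC_dual ::
  "((real \<Rightarrow> complex) \<Rightarrow> complex) \<Rightarrow> ((real \<Rightarrow> complex) \<Rightarrow> complex) \<Rightarrow> (real \<Rightarrow> complex) \<Rightarrow> complex" where
  "conv_OC_dual T S =
     (THE R. R \<in> dual_space OC_top \<and> to_tempered R = conv_tempered T (to_tempered S))"

text \<open>The convolution power, meant for \<open>n \<ge> 1\<close>.\<close>

definition conv_power ::
  "((real \<Rightarrow> complex) \<Rightarrow> complex) \<Rightarrow> nat \<Rightarrow> (real \<Rightarrow> complex) \<Rightarrow> complex" where
  "conv_power T n = (conv_OC_dual T ^^ (n - 1)) T"

end

theory Submission
  imports Defs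
begin

text \<open>
  Write \<open>T\<^sup>k\<close> for the convolution powers. Since \<open>C_T\<close> commutes with translations, \<open>C_T\<^sup>k\<close> is
  convolution with the functional \<open>f \<mapsto> (C_T\<^sup>k f(-\<cdot>))(0)\<close>, which is \<open>T\<^sup>k\<close>. All five properties are
  equivalent to equicontinuity of \<open>{T\<^sup>k}\<close> on every step of \<open>O_C\<close>.

  Equicontinuity gives power boundedness on \<open>S\<close> and \<open>O_C\<close> through Peetre's inequality
  \<open>1 + (x + y)\<^sup>2 \<le> 2 (1 + x\<^sup>2) (1 + y\<^sup>2)\<close>, and power boundedness on the duals by transposing the
  convolution with the reflection of \<open>T\<close>. It follows from boundedness of \<open>{T\<^sup>k}\<close> in the strong dual
  because the steps are metrizable, and from power boundedness on \<open>O_C\<close> by evaluation at \<open>0\<close>.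
  For \<open>S\<close>, decompose \<open>f\<close> in a step of \<open>O_C\<close> by a partition of unity made of integer translates of a
  Schwartz function: the piece near \<open>j\<close>, translated to the origin, has Schwartz norms of size
  \<open>(1 + j\<^sup>2)\<^sup>n\<close>, while its image under \<open>C_T\<^sup>k\<close> decays at distance \<open>j\<close> faster than any power,
  uniformly in \<open>k\<close>, so that the sum over the pieces converges uniformly in \<open>k\<close>.
\<close>

section \<open>Seminorms and linear maps\<close>

text \<open>The topologies involved are given in very different ways: by explicit norms on
  \<open>Schwartz\<close>, by an abstract family of seminorms on \<open>OC\<close>, by suprema over
  arbitrary bounded sets on the duals. All are brought under one relation, \<open>dominated\<close>,
  a uniform estimate of a family by finitely many seminorms. On \<open>OC\<close> it becomes a
  concrete estimate on each step, because the pointwise supremum of a family that is uniformly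
  bounded on the steps is again one of the generating seminorms (\<open>dominated_OC_iff\<close>).

  The passage from \<open>Schwartz\<close> back to the steps is the hard one: power boundedness
  there controls the iterates only on rapidly decreasing functions, while a step contains functions
  growing like \<open>(1 + x^2)^n\<close>. Asking for decay of order \<open>n + 1\<close> leaves the
  factor \<open>1 / (1 + a^2)\<close> for the piece at the integer \<open>a\<close>, and this is
  summable. The same cutoffs converge in the next step, which makes \<open>Schwartz\<close> dense in
  \<open>OC\<close> and so settles the uniqueness behind \<open>conv_OC_dual\<close>.\<close>

definition fun_subspace :: "('x \<Rightarrow> complex) set \<Rightarrow> bool" where
  "fun_subspace E \<longleftrightarrow> (\<lambda>_. 0) \<in> E \<and> (\<forall>f\<in>E. \<forall>g\<in>E. (\<lambda>x. f x + g x) \<in> E) \<and>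
     (\<forall>c. \<forall>f\<in>E. (\<lambda>x. c * f x) \<in> E)"

definition linear_form_on :: "('x \<Rightarrow> complex) set \<Rightarrow> (('x \<Rightarrow> complex) \<Rightarrow> complex) \<Rightarrow> bool" where
  "linear_form_on E T \<longleftrightarrow> (\<forall>f\<in>E. \<forall>g\<in>E. T (\<lambda>x. f x + g x) = T f + T g) \<and>
     (\<forall>c. \<forall>f\<in>E. T (\<lambda>x. c * f x) = c * T f)"

definition linear_endo :: "('x \<Rightarrow> complex) set \<Rightarrow> (('x \<Rightarrow> complex) \<Rightarrow> ('x \<Rightarrow> complex)) \<Rightarrow> bool" where
  "linear_endo E A \<longleftrightarrow> (\<forall>f\<in>E. A f \<in> E) \<and>
     (\<forall>f\<in>E. \<forall>g\<in>E. A (\<lambda>x. f x + g x) = (\<lambda>x. A f x + A g x)) \<and>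
     (\<forall>c. \<forall>f\<in>E. A (\<lambda>x. c * f x) = (\<lambda>x. c * A f x))"

text \<open>One finite set of seminorms and one constant serve the whole family \<open>R\<close>:
  the seminorm form of equicontinuity at zero. A singleton \<open>R\<close> expresses
  continuity.\<close>

definition dominated ::
  "('x \<Rightarrow> complex) set \<Rightarrow> (('x \<Rightarrow> complex) \<Rightarrow> real) set \<Rightarrow> (('x \<Rightarrow> complex) \<Rightarrow> real) set \<Rightarrow> bool" where
  "dominated E P R \<longleftrightarrow>
     (\<exists>F C. finite F \<and> F \<subseteq> P \<and> 0 \<le> C \<and> (\<forall>r\<in>R. \<forall>f\<in>E. r f \<le> C * (\<Sum>q\<in>F. q f)))"

lemma seminorm_onD:
  assumes "seminorm_on E p"
  shows "f \<in> E \<Longrightarrow> 0 \<le> p f"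
    and "f \<in> E \<Longrightarrow> g \<in> E \<Longrightarrow> p (\<lambda>x. f x + g x) \<le> p f + p g"
    and "f \<in> E \<Longrightarrow> p (\<lambda>x. c * f x) = norm c * p f"
  using assms unfolding seminorm_on_def by auto

lemma linear_endo_funpow:
  assumes "linear_endo E A" shows "linear_endo E (A ^^ n)"
  using assms unfolding linear_endo_def by (induction n) auto

lemma linear_endoD:
  assumes "linear_endo E A"
  shows "f \<in> E \<Longrightarrow> A f \<in> E"
    and "f \<in> E \<Longrightarrow> g \<in> E \<Longrightarrow> A (\<lambda>x. f x + g x) = (\<lambda>x. A f x + A g x)"
    and "f \<in> E \<Longrightarrow> A (\<lambda>x. c * f x) = (\<lambda>x. c * A f x)"
  using assms unfolding linear_endo_def by auto

lemma linear_form_onD: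
  assumes "linear_form_on E T"
  shows "f \<in> E \<Longrightarrow> g \<in> E \<Longrightarrow> T (\<lambda>x. f x + g x) = T f + T g"
    and "f \<in> E \<Longrightarrow> T (\<lambda>x. c * f x) = c * T f"
  using assms unfolding linear_form_on_def by auto

lemma fun_subspaceD:
  assumes "fun_subspace E"
  shows "(\<lambda>_. 0) \<in> E"
    and "f \<in> E \<Longrightarrow> g \<in> E \<Longrightarrow> (\<lambda>x. f x + g x) \<in> E"
    and "f \<in> E \<Longrightarrow> (\<lambda>x. c * f x) \<in> E"
    and "f \<in> E \<Longrightarrow> g \<in> E \<Longrightarrow> (\<lambda>x. f x - g x) \<in> E"
proof -
  show *: "(\<lambda>_. 0) \<in> E" "f \<in> E \<Longrightarrow> g \<in> E \<Longrightarrow> (\<lambda>x. f x + g x) \<in> E"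
    "f \<in> E \<Longrightarrow> (\<lambda>x. c * f x) \<in> E" for f g c
    using assms unfolding fun_subspace_def by auto
  show "(\<lambda>x. f x - g x) \<in> E" if "f \<in> E" "g \<in> E"
    using *(2)[OF that(1) *(3)[OF that(2), of "-1"]] by simp
qed

lemma linear_endo_diff:
  assumes "fun_subspace E" "linear_endo E A" "f \<in> E" "g \<in> E"
  shows "A (\<lambda>x. f x - g x) = (\<lambda>x. A f x - A g x)"
  using linear_endoD(2)[OF assms(2,3) fun_subspaceD(3)[OF assms(1,4), of "-1"]]
    linear_endoD(3)[OF assms(2,4), of "-1"] by simp

lemma linear_form_on_diff:
  assumes "fun_subspace E" "linear_form_on E T" "f \<in> E" "g \<in> E"
  shows "T (\<lambda>x. f x - g x) = T f - T g"
  using linear_form_onD(1)[OF assms(2,3) fun_subspaceD(3)[OF assms(1,4), of "-1"]]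
    linear_form_onD(2)[OF assms(2,4), of "-1"] by simp

lemma linear_form_on_zero:
  assumes "fun_subspace E" "linear_form_on E T"
  shows "T (\<lambda>_. 0) = 0"
  using linear_form_onD(2)[OF assms(2) fun_subspaceD(1)[OF assms(1)], of 0] by simp

lemma linear_form_on_sum:
  assumes "fun_subspace E" "linear_form_on E T" "finite I" "\<And>i. i \<in> I \<Longrightarrow> f i \<in> E"
  shows "(\<lambda>x. \<Sum>i\<in>I. f i x) \<in> E" "T (\<lambda>x. \<Sum>i\<in>I. f i x) = (\<Sum>i\<in>I. T (f i))"
proof -
  have "(\<lambda>x. \<Sum>i\<in>I. f i x) \<in> E \<and> T (\<lambda>x. \<Sum>i\<in>I. f i x) = (\<Sum>i\<in>I. T (f i))"
    using assms(3,4)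
  proof (induction I)
    case empty
    then show ?case
      using linear_form_on_zero[OF assms(1,2)] fun_subspaceD(1)[OF assms(1)] by simp
  next
    case (insert a I)
    then show ?case
      using fun_subspaceD(2)[OF assms(1), of "f a" "\<lambda>x. \<Sum>i\<in>I. f i x"]
        linear_form_onD(1)[OF assms(2), of "f a" "\<lambda>x. \<Sum>i\<in>I. f i x"] by simp
  qed
  then show "(\<lambda>x. \<Sum>i\<in>I. f i x) \<in> E" "T (\<lambda>x. \<Sum>i\<in>I. f i x) = (\<Sum>i\<in>I. T (f i))" by auto
qed

lemma seminorm_on_subset:
  assumes "seminorm_on E p" "D \<subseteq> E"
  shows "seminorm_on D p"
  using assms unfolding seminorm_on_def by blast

lemma seminorm_on_norm:
  assumes "linear_form_on E T" shows "seminorm_on E (\<lambda>f. norm (T f))"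
  using linear_form_onD[OF assms] unfolding seminorm_on_def
  by (simp add: norm_mult norm_triangle_ineq)

text \<open>Applied three times: to point evaluations for the concrete norms, to evaluations on a
  bounded set for the strong dual, and to a whole family of seminorms on \<open>OC\<close>.\<close>

lemma seminorm_on_SUP:
  assumes "I \<noteq> {}" and r: "\<And>i. i \<in> I \<Longrightarrow> seminorm_on E (r i)"
    and bdd: "\<And>f. f \<in> E \<Longrightarrow> bdd_above ((\<lambda>i. r i f) ` I)"
  shows "seminorm_on E (\<lambda>f. SUP i\<in>I. r i f)"
  unfolding seminorm_on_def
proof (intro conjI ballI allI)
  fix f assume f: "f \<in> E"
  obtain i where i: "i \<in> I" using assms(1) by auto
  show "0 \<le> (SUP i\<in>I. r i f)"
    using cSUP_upper2[OF bdd[OF f] i] seminorm_onD(1)[OF r[OF i] f] .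
next
  fix f g assume fg: "f \<in> E" "g \<in> E"
  show "(SUP i\<in>I. r i (\<lambda>x. f x + g x)) \<le> (SUP i\<in>I. r i f) + (SUP i\<in>I. r i g)"
  proof (rule cSUP_least[OF assms(1)])
    fix i assume i: "i \<in> I"
    have "r i (\<lambda>x. f x + g x) \<le> r i f + r i g"
      by (rule seminorm_onD(2)[OF r[OF i] fg])
    also have "\<dots> \<le> (SUP i\<in>I. r i f) + (SUP i\<in>I. r i g)"
      by (intro add_mono cSUP_upper i bdd fg)
    finally show "r i (\<lambda>x. f x + g x) \<le> \<dots>" .
  qed
next
  fix c :: complex and f assume f: "f \<in> E"
  have "(SUP i\<in>I. r i (\<lambda>x. c * f x)) = (SUP i\<in>I. norm c * r i f)"
    by (intro SUP_cong refl seminorm_onD(3)[OF r f])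
  also have "\<dots> = norm c * (SUP i\<in>I. r i f)"
  proof -
    \<comment> \<open>Multiplication by \<open>norm c\<close> is monotone and continuous, so it
      commutes with the supremum of a nonempty bounded set; \<open>c = 0\<close> is
      included.\<close>
    have "norm c * Sup ((\<lambda>i. r i f) ` I) = Sup ((*) (norm c) ` ((\<lambda>i. r i f) ` I))"
      by (rule continuous_at_Sup_mono)
         (use bdd[OF f] assms(1) in \<open>auto intro!: monoI mult_left_mono continuous_intros\<close>)
    then show ?thesis by (simp add: image_image)
  qed
  finally show "(SUP i\<in>I. r i (\<lambda>x. c * f x)) = norm c * (SUP i\<in>I. r i f)" .
qed

section \<open>Domination of families of seminorms\<close>

lemma dominatedI:
  assumes "q \<in> P" "0 \<le> C" "\<And>r f. r \<in> R \<Longrightarrow> f \<in> E \<Longrightarrow> r f \<le> C * q f"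
  shows "dominated E P R"
  unfolding dominated_def using assms by (intro exI[of _ "{q}"] exI[of _ C]) auto

lemma dominated_mono:
  assumes "dominated E P R" "\<And>r'. r' \<in> R' \<Longrightarrow> \<exists>r\<in>R. \<forall>f\<in>E. r' f \<le> r f"
  shows "dominated E P R'"
  using assms unfolding dominated_def by (meson order_trans)

text \<open>For increasing seminorms a finite sum is at most the number of its terms times the
  member of largest index, so a single norm can replace \<open>F\<close>.\<close>

lemma dominated_chain:
  assumes "dominated E (range q) R"
    and mono: "\<And>m m' f. m \<le> m' \<Longrightarrow> f \<in> E \<Longrightarrow> q m f \<le> (q m' f :: real)"
    and nonneg: "\<And>m f. f \<in> E \<Longrightarrow> 0 \<le> q (m::nat) f"
  shows "\<exists>m C. 0 \<le> C \<and> (\<forall>r\<in>R. \<forall>f\<in>E. r f \<le> C * q m f)"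
proof -
  obtain F C where F: "finite F" "F \<subseteq> range q" "0 \<le> C"
    and le: "\<And>r f. r \<in> R \<Longrightarrow> f \<in> E \<Longrightarrow> r f \<le> C * (\<Sum>p\<in>F. p f)"
    using assms(1) unfolding dominated_def by metis
  obtain I where I: "finite I" "F = q ` I" using F(1,2) by (meson finite_subset_image)
  define m where "m = (if I = {} then 0 else Max I)"
  have "r f \<le> (C * real (card F)) * q m f" if "r \<in> R" "f \<in> E" for r f
  proof -
    have "(\<Sum>p\<in>F. p f) \<le> (\<Sum>p\<in>F. q m f)"
    proof (rule sum_mono)
      fix p assume "p \<in> F"
      then obtain i where i: "i \<in> I" "p = q i" using I by auto
      then have "i \<le> m" using I(1) unfolding m_def by auto
      then show "p f \<le> q m f" using mono that(2) i(2) by blast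
    qed
    then have "C * (\<Sum>p\<in>F. p f) \<le> C * (real (card F) * q m f)"
      using F(3) by (simp add: mult_left_mono)
    then show ?thesis using le[OF that] by (simp add: mult.assoc)
  qed
  moreover have "0 \<le> C * real (card F)" using F(3) by simp
  ultimately show ?thesis by blast
qed

text \<open>Replaces the uniform boundedness principle: a family that is bounded on bounded sequences of
  a metrizable space is equicontinuous, and no completeness is needed.\<close>

lemma uniform_bound_of_bounded_on_sequences:
  fixes q :: "nat \<Rightarrow> ('x \<Rightarrow> complex) \<Rightarrow> real"
  assumes E: "fun_subspace E"
    and q: "\<And>m. seminorm_on E (q m)"
    and R: "\<And>r c f. r \<in> R \<Longrightarrow> f \<in> E \<Longrightarrow> r (\<lambda>x. c * f x) = norm c * r f"
    and seq: "\<And>g. (\<And>m. g m \<in> E \<and> q m (g m) \<le> 1) \<Longrightarrow> \<exists>C. \<forall>r\<in>R. \<forall>m. r (g m) \<le> (C::real)"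
  shows "\<exists>m C. 0 \<le> C \<and> (\<forall>r\<in>R. \<forall>f\<in>E. r f \<le> C * q m f)"
proof (rule ccontr)
  assume neg: "\<not> ?thesis"
  have "\<exists>g. g \<in> E \<and> q m g \<le> 1 \<and> (\<exists>r\<in>R. real m < r g)" for m
  proof -
    obtain r f where rf: "r \<in> R" "f \<in> E" "\<not> r f \<le> (real m + 1) * q m f"
      using neg by (metis add_nonneg_nonneg of_nat_0_le_iff zero_le_one)
    have q0: "0 \<le> q m f" using seminorm_onD(1)[OF q rf(2)] .
    have pos: "0 < r f" using rf(3) q0 
      by (smt (verit) mult_nonneg_nonneg of_nat_0_le_iff)
    \<comment> \<open>This scaling makes \<open>r g\<close> equal to \<open>m + 1\<close>, and the
      failed estimate turns into \<open>q m g \<le> 1\<close>. The divisor is \<open>r f\<close>,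
      which is positive, and not \<open>q m f\<close>, which may vanish.\<close>
    define t where "t = (real m + 1) / r f"
    have t: "0 < t" using pos by (simp add: t_def)
    define g where "g = (\<lambda>x. of_real t * f x)"
    have "q m g = t * q m f" using seminorm_onD(3)[OF q rf(2), of m "of_real t"] t
      by (simp add: g_def)
    also have "\<dots> \<le> 1" using rf(3) pos by (simp add: t_def field_simps)
    finally have "q m g \<le> 1" .
    moreover have "r g = t * r f" using R[OF rf(1,2), of "of_real t"] t by (simp add: g_def)
    then have "r g > m" using pos by (simp add: t_def)
    moreover have "g \<in> E" using fun_subspaceD(3)[OF E rf(2)] unfolding g_def .
    ultimately show ?thesis using rf(1) by blast
  qed
  then obtain g where g: "\<And>m. g m \<in> E \<and> q m (g m) \<le> 1" "\<And>m. \<exists>r\<in>R. real m < r (g m)"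
    by metis
  obtain C where C: "\<forall>r\<in>R. \<forall>m. r (g m) \<le> C" using seq[OF g(1)] by blast
  obtain m :: nat where "C < m" using reals_Archimedean2 by blast
  then show False using g(2)[of m] C by (meson less_trans not_less)
qed

section \<open>Locally convex spaces and their strong duals\<close>

abbreviation dual_seminorms ::
  "('x \<Rightarrow> complex) topology \<Rightarrow> ((('x \<Rightarrow> complex) \<Rightarrow> complex) \<Rightarrow> real) set" where
  "dual_seminorms Y \<equiv> {(\<lambda>T. SUP f\<in>B. norm (T f)) | B. lc_bounded Y B \<and> B \<noteq> {}}"

text \<open>Instances are \<open>Schwartz\<close>, every step, \<open>OC\<close> and, by
  \<open>lc_space_dual\<close>, the strong dual of an instance, so one criterion for power
  boundedness applies to all four spaces of the theorem.\<close>

locale lc_space =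
  fixes E :: "('x \<Rightarrow> complex) set" and P :: "(('x \<Rightarrow> complex) \<Rightarrow> real) set"
  assumes subspace: "fun_subspace E"
    and seminorms: "p \<in> P \<Longrightarrow> seminorm_on E p"
begin

abbreviation X :: "('x \<Rightarrow> complex) topology" where "X \<equiv> lc_topology E P"

section \<open>Domination and neighbourhoods of zero\<close>

lemma sum_nonneg_seminorms: "F \<subseteq> P \<Longrightarrow> f \<in> E \<Longrightarrow> 0 \<le> (\<Sum>q\<in>F. q f)"
  using seminorms by (intro sum_nonneg) (auto dest: seminorm_onD(1))

lemma dominated_ball:
  assumes "dominated E P R" "0 < e"
  obtains G d where "finite G" "G \<subseteq> P" "0 < d"
    "\<And>f r. f \<in> E \<Longrightarrow> (\<And>q. q \<in> G \<Longrightarrow> q f < d) \<Longrightarrow> r \<in> R \<Longrightarrow> r f < e"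
proof -
  obtain F C where F: "finite F" "F \<subseteq> P" "0 \<le> C"
    and le: "\<And>r f. r \<in> R \<Longrightarrow> f \<in> E \<Longrightarrow> r f \<le> C * (\<Sum>p\<in>F. p f)"
    using assms(1) unfolding dominated_def by metis
  \<comment> \<open>The summand 1 keeps the denominator positive when \<open>C\<close> or
    \<open>card F\<close> is zero, and makes the final inequality strict.\<close>
  define d where "d = e / (C * real (card F) + 1)"
  have pos: "0 < C * real (card F) + 1" using F(3) by (simp add: add_nonneg_pos)
  have d: "0 < d" using assms(2) pos by (simp add: d_def)
  have "r f < e" if "f \<in> E" "\<And>q. q \<in> F \<Longrightarrow> q f < d" "r \<in> R" for f r
  proof -
    have "(\<Sum>p\<in>F. p f) \<le> real (card F) * d"
      using sum_bounded_above[of F "\<lambda>p. p f" d] that(2) by (simp add: less_imp_le)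
    then have "r f \<le> C * (real (card F) * d)"
      using le[OF that(3,1)] F(3) by (meson mult_left_mono order_trans)
    also have "\<dots> < (C * real (card F) + 1) * d" using d by (simp add: algebra_simps)
    also have "\<dots> = e" using pos by (simp add: d_def)
    finally show ?thesis .
  qed
  then show ?thesis using that F d by blast
qed

lemma dominated_of_ball:
  assumes F: "finite F" "F \<subseteq> P" "0 < e"
    and le: "\<And>f r. f \<in> E \<Longrightarrow> (\<And>q. q \<in> F \<Longrightarrow> q f < e) \<Longrightarrow> r \<in> R \<Longrightarrow> r f \<le> 1"
    and R: "\<And>r c f. r \<in> R \<Longrightarrow> f \<in> E \<Longrightarrow> r (\<lambda>x. c * f x) = norm c * r f"
  shows "dominated E P R"
proof -
  have "r f \<le> (1 / e) * (\<Sum>q\<in>F. q f)" if rf: "r \<in> R" "f \<in> E" for r f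
  proof -
    define s where "s = (\<Sum>q\<in>F. q f)"
    have s: "0 \<le> s" using sum_nonneg_seminorms[OF F(2) rf(2)] by (simp add: s_def)
    \<comment> \<open>Scaling \<open>f\<close> into the ball uses some \<open>t\<close> above
      \<open>s\<close>, since \<open>s\<close> itself may be zero; letting \<open>t\<close> decrease
      to \<open>s\<close> gives the estimate.\<close>
    have "r f * e \<le> t" if t: "s < t" for t
    proof -
      have t0: "0 < t" using s t by simp
      define g where "g = (\<lambda>x. of_real (e / t) * f x)"
      have g: "g \<in> E" using fun_subspaceD(3)[OF subspace rf(2)] unfolding g_def .
      have "q g < e" if q: "q \<in> F" for q
      proof -
        have "q f \<le> s" unfolding s_def
          using member_le_sum[OF q, of "\<lambda>q. q f"] F seminorms rf(2) seminorm_onD(1) by blast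
        then have "q f < t" using t by simp
        moreover have "q g = (e / t) * q f"
          using seminorm_onD(3)[OF seminorms rf(2), of q "of_real (e/t)"] q F(2,3) t0
          unfolding g_def by (auto simp: norm_divide)
        moreover have "(e / t) * q f < (e / t) * t" using \<open>q f < t\<close> t0 F(3)
          by (intro mult_strict_left_mono) auto
        ultimately show ?thesis using t0 by simp
      qed
      then have "r g \<le> 1" using le g rf(1) by blast
      moreover have "r g = (e / t) * r f"
        using R[OF rf, of "of_real (e/t)"] F(3) t0 unfolding g_def by (simp add: norm_divide)
      ultimately show ?thesis using t0 by (simp add: field_simps)
    qed
    then have "r f * e \<le> s" by (rule dense_ge)
    then show ?thesis using F(3) by (simp add: s_def field_simps)
  qed
  then show ?thesis unfolding dominated_def using F
    by (intro exI[of _ F] exI[of _ "1 / e"]) auto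
qed

text \<open>A basic neighbourhood constrains finitely many seminorms, each dominated with its own
  data. Merging these data lets one ball handle them together.\<close>

lemma dominated_UN:
  assumes "finite I" "\<And>i. i \<in> I \<Longrightarrow> dominated E P (R i)"
  shows "dominated E P (\<Union>i\<in>I. R i)"
  using assms
proof (induction I)
  case empty
  then show ?case unfolding dominated_def by (intro exI[of _ "{}"] exI[of _ 0]) auto
next
  case (insert a I)
  obtain F C where F: "finite F" "F \<subseteq> P" "0 \<le> C"
    and le: "\<And>r f. r \<in> R a \<Longrightarrow> f \<in> E \<Longrightarrow> r f \<le> C * (\<Sum>p\<in>F. p f)"
    using insert.prems[of a] unfolding dominated_def by auto
  obtain G D where G: "finite G" "G \<subseteq> P" "0 \<le> D"
    and le': "\<And>r f. r \<in> (\<Union>i\<in>I. R i) \<Longrightarrow> f \<in> E \<Longrightarrow> r f \<le> D * (\<Sum>p\<in>G. p f)"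
    using insert unfolding dominated_def by (metis insertCI)
  have "r f \<le> (C + D) * (\<Sum>p\<in>F\<union>G. p f)"
    if r: "r \<in> (\<Union>i\<in>insert a I. R i)" and f: "f \<in> E" for r f
  proof -
    have 1: "(\<Sum>p\<in>F. p f) \<le> (\<Sum>p\<in>F\<union>G. p f)" "(\<Sum>p\<in>G. p f) \<le> (\<Sum>p\<in>F\<union>G. p f)"
      using F G f seminorm_onD(1)[OF seminorms] by (auto intro!: sum_mono2)
    have 0: "0 \<le> (\<Sum>p\<in>F\<union>G. p f)" using sum_nonneg_seminorms[OF _ f] F G by simp
    consider "r \<in> R a" | "r \<in> (\<Union>i\<in>I. R i)" using r by auto
    then show ?thesis
    proof cases
      case 1
      have "r f \<le> C * (\<Sum>p\<in>F\<union>G. p f)"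
        using le[OF 1 f] mult_left_mono[OF \<open>(\<Sum>p\<in>F. p f) \<le> _\<close> F(3)] by linarith
      also have "\<dots> \<le> (C + D) * (\<Sum>p\<in>F\<union>G. p f)" using 0 G(3) by (intro mult_right_mono) auto
      finally show ?thesis .
    next
      case 2
      have "r f \<le> D * (\<Sum>p\<in>F\<union>G. p f)"
        using le'[OF 2 f] mult_left_mono[OF \<open>(\<Sum>p\<in>G. p f) \<le> _\<close> G(3)] by linarith
      also have "\<dots> \<le> (C + D) * (\<Sum>p\<in>F\<union>G. p f)" using 0 F(3) by (intro mult_right_mono) auto
      finally show ?thesis .
    qed
  qed
  then show ?case unfolding dominated_def using F G
    by (intro exI[of _ "F \<union> G"] exI[of _ "C + D"]) auto
qed

lemma dominated_bounded_set:
  assumes "B \<subseteq> E" "\<forall>p\<in>P. \<exists>C. \<forall>f\<in>B. p f \<le> C" "dominated E P R"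
  obtains C where "\<forall>r\<in>R. \<forall>f\<in>B. r f \<le> C"
proof -
  obtain F C where F: "finite F" "F \<subseteq> P" "0 \<le> C"
    and le: "\<And>r f. r \<in> R \<Longrightarrow> f \<in> E \<Longrightarrow> r f \<le> C * (\<Sum>p\<in>F. p f)"
    using assms(3) unfolding dominated_def by metis
  obtain K where K: "\<And>p f. p \<in> P \<Longrightarrow> f \<in> B \<Longrightarrow> p f \<le> K p" using assms(2) by metis
  have "r f \<le> C * (\<Sum>p\<in>F. K p)" if "r \<in> R" "f \<in> B" for r f
  proof -
    have "(\<Sum>p\<in>F. p f) \<le> (\<Sum>p\<in>F. K p)" using K that F by (intro sum_mono) auto
    then show ?thesis using le[OF that(1)] that(2) assms(1) F(3)
      by (meson mult_left_mono order_trans subsetD)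
  qed
  then show ?thesis using that by blast
qed

lemma zero_nbhd:
  assumes "openin X U" "(\<lambda>_. 0) \<in> U"
  obtains F e where "finite F" "F \<subseteq> P" "0 < e"
    "\<And>f. f \<in> E \<Longrightarrow> (\<And>q. q \<in> F \<Longrightarrow> q f < e) \<Longrightarrow> f \<in> U"
proof -
  have "\<exists>F e. finite F \<and> F \<subseteq> P \<and> 0 < e \<and> {g\<in>E. \<forall>p\<in>F. p (\<lambda>x. g x - 0) < e} \<subseteq> U"
    using assms unfolding openin_lc_topology by fast
  then show ?thesis using that by fastforce
qed

lemma open_ball:
  assumes "finite F" "F \<subseteq> P" "0 < e"
  shows "openin X {f\<in>E. \<forall>q\<in>F. q f < e}"
  unfolding openin_lc_topology
proof (intro conjI ballI)
  fix f assume f: "f \<in> {f\<in>E. \<forall>q\<in>F. q f < e}"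
  \<comment> \<open>Inserting \<open>e\<close> keeps the minimum meaningful when \<open>F\<close> is
    empty.\<close>
  define d where "d = Min (insert e ((\<lambda>q. e - q f) ` F))"
  have d: "0 < d" unfolding d_def using assms f by simp
  have "q g < e" if g: "g \<in> E" and lt: "\<forall>p\<in>F. p (\<lambda>x. g x - f x) < d" and q: "q \<in> F" for g q
  proof -
    have "q (\<lambda>x. (g x - f x) + f x) \<le> q (\<lambda>x. g x - f x) + q f"
      using f q assms(2) g
      by (intro seminorm_onD(2)[OF seminorms] fun_subspaceD(4)[OF subspace]) auto
    moreover have "q (\<lambda>x. g x - f x) < e - q f"
      using lt q assms(1) unfolding d_def by auto
    ultimately show ?thesis by simp
  qed
  then show "\<exists>G d. finite G \<and> G \<subseteq> P \<and> 0 < d \<and>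
     {g\<in>E. \<forall>p\<in>G. p (\<lambda>x. g x - f x) < d} \<subseteq> {f\<in>E. \<forall>q\<in>F. q f < e}"
    using assms d by (intro exI[of _ F] exI[of _ d]) auto
qed auto

section \<open>Equicontinuity, boundedness and continuity as seminorm estimates\<close>

lemma seminorm_zero: "p \<in> P \<Longrightarrow> p (\<lambda>_. 0) = 0"
  using seminorm_onD(3)[OF seminorms fun_subspaceD(1)[OF subspace], of p 0] by simp

text \<open>The definition asks every operator to be continuous at every point, while domination
  speaks about zero; linearity transfers the estimate to differences \<open>g - f\<close>.\<close>

lemma equicontinuousI:
  assumes lin: "\<And>A. A \<in> \<A> \<Longrightarrow> linear_endo E A"
    and dom: "\<And>p. p \<in> P \<Longrightarrow> dominated E P ((\<lambda>A f. p (A f)) ` \<A>)"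
  shows "equicontinuous X \<A>"
proof -
  have cont: "continuous_operator X A" if A: "A \<in> \<A>" for A
  proof -
    have "openin X {f \<in> E. A f \<in> V}" if V: "openin X V" for V
      unfolding openin_lc_topology
    proof (intro conjI ballI)
      fix f assume f: "f \<in> {f \<in> E. A f \<in> V}"
      then obtain F e where F: "finite F" "F \<subseteq> P" "0 < e"
        and sub: "{g\<in>E. \<forall>p\<in>F. p (\<lambda>x. g x - A f x) < e} \<subseteq> V"
        using V unfolding openin_lc_topology by fastforce
      have "dominated E P (\<Union>p\<in>F. (\<lambda>A f. p (A f)) ` \<A>)"
        by (rule dominated_UN[OF F(1)], rule dom) (use F(2) in blast)
      from dominated_ball[OF this F(3)] obtain G d where G: "finite G" "G \<subseteq> P" "0 < d"
        "\<And>f r. f \<in> E \<Longrightarrow> (\<And>q. q \<in> G \<Longrightarrow> q f < d) \<Longrightarrow> r \<in> (\<Union>p\<in>F. (\<lambda>A f. p (A f)) ` \<A>) \<Longrightarrow> r f < e"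
        by blast
      have "A g \<in> V" if g: "g \<in> E" "\<forall>q\<in>G. q (\<lambda>x. g x - f x) < d" for g
      proof -
        have "p (A (\<lambda>x. g x - f x)) < e" if "p \<in> F" for p
          using G(4)[of "\<lambda>x. g x - f x" "\<lambda>f. p (A f)"] g f that A
            fun_subspaceD(4)[OF subspace, of g f] by auto
        then have "p (\<lambda>x. A g x - A f x) < e" if "p \<in> F" for p
          using linear_endo_diff[OF subspace lin[OF A], of g f] g f that by simp
        then show ?thesis using sub linear_endoD(1)[OF lin[OF A] g(1)] by blast
      qed
      then show "\<exists>F e. finite F \<and> F \<subseteq> P \<and> 0 < e \<and>
          {g \<in> E. \<forall>p\<in>F. p (\<lambda>x. g x - f x) < e} \<subseteq> {f \<in> E. A f \<in> V}"
        using G(1-3) by (intro exI[of _ G] exI[of _ d]) auto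
    qed auto
    then have "continuous_map X X A"
      using lin[OF A] unfolding continuous_map linear_endo_def by auto
    then show ?thesis
      using lin[OF A] unfolding continuous_operator_def linear_endo_def by simp
  qed
  moreover have "\<exists>U. openin X U \<and> (\<lambda>_. 0) \<in> U \<and> (\<forall>A\<in>\<A>. A ` U \<subseteq> V)"
    if V: "openin X V" "(\<lambda>_. 0) \<in> V" for V
  proof -
    obtain F e where F: "finite F" "F \<subseteq> P" "0 < e"
      and sub: "\<And>f. f \<in> E \<Longrightarrow> (\<And>q. q \<in> F \<Longrightarrow> q f < e) \<Longrightarrow> f \<in> V"
      using zero_nbhd[OF V] by blast
    have "dominated E P (\<Union>p\<in>F. (\<lambda>A f. p (A f)) ` \<A>)"
      by (rule dominated_UN[OF F(1)], rule dom) (use F(2) in blast)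
    from dominated_ball[OF this F(3)] obtain G d where G: "finite G" "G \<subseteq> P" "0 < d"
      "\<And>f r. f \<in> E \<Longrightarrow> (\<And>q. q \<in> G \<Longrightarrow> q f < d) \<Longrightarrow> r \<in> (\<Union>p\<in>F. (\<lambda>A f. p (A f)) ` \<A>) \<Longrightarrow> r f < e"
      by blast
    let ?U = "{f\<in>E. \<forall>q\<in>G. q f < d}"
    have "A f \<in> V" if "A \<in> \<A>" "f \<in> ?U" for A f
    proof (rule sub)
      show "A f \<in> E" using that linear_endoD(1)[OF lin] by blast
      show "q (A f) < e" if "q \<in> F" for q
        using G(4)[of f "\<lambda>f. q (A f)"] that \<open>A \<in> \<A>\<close> \<open>f \<in> ?U\<close> by auto
    qed
    moreover have "(\<lambda>_. 0) \<in> ?U"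
      using fun_subspaceD(1)[OF subspace] G(2,3) seminorm_zero by force
    ultimately show ?thesis using open_ball[OF G(1-3)] by (intro exI[of _ ?U]) auto
  qed
  ultimately show ?thesis unfolding equicontinuous_def by blast
qed

lemma equicontinuousD:
  assumes "equicontinuous X \<A>"
  shows "A \<in> \<A> \<Longrightarrow> linear_endo E A"
    and "p \<in> P \<Longrightarrow> dominated E P ((\<lambda>A f. p (A f)) ` \<A>)"
proof -
  have co: "continuous_operator X A" if "A \<in> \<A>" for A
    using assms that unfolding equicontinuous_def by blast
  have lin: "linear_endo E A" if "A \<in> \<A>" for A
    using co[OF that] continuous_map_image_subset_topspace[of X X A]
    unfolding continuous_operator_def linear_endo_def by auto
  then show "A \<in> \<A> \<Longrightarrow> linear_endo E A" .
  assume p: "p \<in> P"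
  let ?V = "{f\<in>E. \<forall>q\<in>{p}. q f < 1}"
  have "openin X ?V" "(\<lambda>_. 0) \<in> ?V"
    using open_ball[of "{p}" 1] p fun_subspaceD(1)[OF subspace] seminorm_zero[OF p] by auto
  then obtain U where U: "openin X U" "(\<lambda>_. 0) \<in> U" "\<forall>A\<in>\<A>. A ` U \<subseteq> ?V"
    using assms unfolding equicontinuous_def by meson
  from zero_nbhd[OF U(1,2)] obtain F e where F: "finite F" "F \<subseteq> P" "0 < e"
    and sub: "\<And>f. f \<in> E \<Longrightarrow> (\<And>q. q \<in> F \<Longrightarrow> q f < e) \<Longrightarrow> f \<in> U"
    by blast
  show "dominated E P ((\<lambda>A f. p (A f)) ` \<A>)"
  proof (rule dominated_of_ball[OF F])
    fix f r assume f: "f \<in> E" "\<And>q. q \<in> F \<Longrightarrow> q f < e" and r: "r \<in> (\<lambda>A f. p (A f)) ` \<A>"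
    have "f \<in> U" using f by (rule sub)
    then show "r f \<le> 1" using U(3) r by force
  next
    fix r c f assume "r \<in> (\<lambda>A f. p (A f)) ` \<A>" and f: "f \<in> E"
    then obtain A where A: "A \<in> \<A>" "r = (\<lambda>f. p (A f))" by blast
    show "r (\<lambda>x. c * f x) = norm c * r f"
      unfolding A(2) linear_endoD(3)[OF lin[OF A(1)] f]
      by (rule seminorm_onD(3)[OF seminorms[OF p] linear_endoD(1)[OF lin[OF A(1)] f]])
  qed
qed

text \<open>Continuity of \<open>A\<close> itself is contained in the estimate as the case
  \<open>k = 1\<close>.\<close>

lemma power_bounded_iff:
  "power_bounded X A \<longleftrightarrow> linear_endo E A \<and>
     (\<forall>p\<in>P. dominated E P {\<lambda>f. p ((A ^^ k) f) | k. 1 \<le> k})"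
proof -
  have eq: "(\<lambda>A f. p (A f)) ` {A ^^ n | n. 1 \<le> n} = {\<lambda>f. p ((A ^^ k) f) | k. 1 \<le> k}" for p
    by auto
  show ?thesis
  proof
    assume "power_bounded X A"
    then have *: "equicontinuous X {A ^^ n | n. 1 \<le> n}" by (simp add: power_bounded_def)
    have "A ^^ 1 \<in> {A ^^ n | n. 1 \<le> n}" by blast
    then have "linear_endo E (A ^^ 1)" by (rule equicontinuousD(1)[OF *])
    then show "linear_endo E A \<and> (\<forall>p\<in>P. dominated E P {\<lambda>f. p ((A ^^ k) f) | k. 1 \<le> k})"
      using equicontinuousD(2)[OF *] unfolding eq by simp
  next
    assume *: "linear_endo E A \<and> (\<forall>p\<in>P. dominated E P {\<lambda>f. p ((A ^^ k) f) | k. 1 \<le> k})"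
    have eqc: "equicontinuous X {A ^^ n | n. 1 \<le> n}"
    proof (rule equicontinuousI)
      show "linear_endo E B" if "B \<in> {A ^^ n | n. 1 \<le> n}" for B
        using that linear_endo_funpow[of E A] * by auto
      show "dominated E P ((\<lambda>A f. p (A f)) ` {A ^^ n | n. 1 \<le> n})" if "p \<in> P" for p
        unfolding eq by (rule bspec[OF conjunct2[OF *] that])
    qed
    have "A ^^ 1 \<in> {A ^^ n | n. 1 \<le> n}" by blast
    then have "continuous_operator X (A ^^ 1)" using eqc unfolding equicontinuous_def by blast
    then show "power_bounded X A" using eqc by (simp add: power_bounded_def)
  qed
qed

lemma lc_bounded_iff:
  "lc_bounded X B \<longleftrightarrow> B \<subseteq> E \<and> (\<forall>p\<in>P. \<exists>C. \<forall>f\<in>B. p f \<le> C)"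
proof
  assume B: "lc_bounded X B"
  then have BE: "B \<subseteq> E" by (simp add: lc_bounded_def)
  have "\<exists>C. \<forall>f\<in>B. p f \<le> C" if p: "p \<in> P" for p
  proof -
    let ?V = "{f\<in>E. \<forall>q\<in>{p}. q f < 1}"
    have "openin X ?V" "(\<lambda>_. 0) \<in> ?V"
      using open_ball[of "{p}" 1] p fun_subspaceD(1)[OF subspace] seminorm_zero[OF p] by auto
    then have "\<exists>r>0. \<forall>f\<in>B. (\<lambda>x. f x / of_real r) \<in> ?V"
      using B[unfolded lc_bounded_def, THEN conjunct2, THEN spec, of ?V] by (rule mp[rotated, OF conjI])
    then obtain r where r: "0 < r" "\<forall>f\<in>B. (\<lambda>x. f x / of_real r) \<in> ?V" by (elim exE conjE)
    have "p f \<le> r" if f: "f \<in> B" for f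
    proof -
      have "p (\<lambda>x. of_real (1 / r) * f x) \<le> 1" using bspec[OF r(2) f] by simp
      moreover have "p (\<lambda>x. of_real (1 / r) * f x) = (1 / r) * p f"
        using seminorm_onD(3)[OF seminorms[OF p], of f "of_real (1 / r)"] f BE r(1)
        by (auto simp: norm_divide)
      ultimately have "(1 / r) * p f \<le> 1" by simp
      then show ?thesis using r(1) by (simp add: field_simps)
    qed
    then show ?thesis by blast
  qed
  with BE show "B \<subseteq> E \<and> (\<forall>p\<in>P. \<exists>C. \<forall>f\<in>B. p f \<le> C)" by blast
next
  assume *: "B \<subseteq> E \<and> (\<forall>p\<in>P. \<exists>C. \<forall>f\<in>B. p f \<le> C)"
  show "lc_bounded X B"
    unfolding lc_bounded_def
  proof (intro conjI allI impI)
    fix U assume "openin X U \<and> (\<lambda>_. 0) \<in> U"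
    then obtain F e where F: "finite F" "F \<subseteq> P" "0 < e"
      and sub: "\<And>f. f \<in> E \<Longrightarrow> (\<And>q. q \<in> F \<Longrightarrow> q f < e) \<Longrightarrow> f \<in> U"
      using zero_nbhd by blast
    have "dominated E P F"
    proof -
      have "dominated E P (\<Union>p\<in>F. {p})"
      proof (rule dominated_UN[OF F(1)])
        fix p assume "p \<in> F"
        then show "dominated E P {p}" unfolding dominated_def using F(2)
          by (intro exI[of _ "{p}"] exI[of _ 1]) auto
      qed
      then show ?thesis by simp
    qed
    then obtain C where C: "\<forall>r\<in>F. \<forall>f\<in>B. r f \<le> C"
      by (rule dominated_bounded_set[OF conjunct1[OF *] conjunct2[OF *]])
    \<comment> \<open>The numerator is positive and exceeds \<open>C\<close> even if
      \<open>C\<close> is negative, which can happen when \<open>B\<close> or \<open>F\<close> is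
      empty.\<close>
    define r where "r = (\<bar>C\<bar> + 1) / e"
    have r: "0 < r" using F(3) by (simp add: r_def)
    have "(\<lambda>x. f x / of_real r) \<in> U" if f: "f \<in> B" for f
    proof -
      have fE: "f \<in> E" using f * by blast
      have "(\<lambda>x. of_real (1 / r) * f x) \<in> U"
      proof (rule sub)
        show "(\<lambda>x. of_real (1 / r) * f x) \<in> E" by (rule fun_subspaceD(3)[OF subspace fE])
        fix q assume q: "q \<in> F"
        have "q (\<lambda>x. of_real (1 / r) * f x) = q f / r"
          using seminorm_onD(3)[OF seminorms fE, of q "of_real (1 / r)"] q F(2) r
          by (auto simp: norm_divide)
        also have "\<dots> < e"
        proof -
          have "q f \<le> C" using C q f by simp
          then have "q f < \<bar>C\<bar> + 1" by linarith
          then have "e * q f < e * (\<bar>C\<bar> + 1)" using F(3) by (rule mult_strict_left_mono)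
          then show ?thesis using F(3) by (simp add: r_def divide_simps mult.commute)
        qed
        finally show "q (\<lambda>x. of_real (1 / r) * f x) < e" .
      qed
      then show ?thesis by simp
    qed
    with r show "\<exists>r>0. \<forall>f\<in>B. (\<lambda>x. f x / of_real r) \<in> U" by blast
  qed (use * in auto)
qed

lemma lc_bounded_dominated:
  assumes "lc_bounded X B" "dominated E P R"
  obtains C where "\<forall>r\<in>R. \<forall>f\<in>B. r f \<le> C"
  using dominated_bounded_set[of B R] assms lc_bounded_iff by metis

lemma dual_space_iff:
  "T \<in> dual_space X \<longleftrightarrow> linear_form_on E T \<and> (\<forall>f. f \<notin> E \<longrightarrow> T f = 0) \<and>
     dominated E P {\<lambda>f. norm (T f)}"
proof
  assume T: "T \<in> dual_space X"
  then have lin: "linear_form_on E T" and cont: "continuous_map X euclidean T"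
    by (auto simp: dual_space_def linear_form_on_def)
  have "openin X {f \<in> E. T f \<in> ball 0 1}"
    using openin_continuous_map_preimage[OF cont, of "ball 0 1"] by simp
  moreover have "(\<lambda>_. 0) \<in> {f \<in> E. T f \<in> ball 0 1}"
    using fun_subspaceD(1)[OF subspace] linear_form_on_zero[OF subspace lin] by simp
  ultimately obtain F e where F: "finite F" "F \<subseteq> P" "0 < e"
    and sub: "\<And>f. f \<in> E \<Longrightarrow> (\<And>q. q \<in> F \<Longrightarrow> q f < e) \<Longrightarrow> f \<in> {f \<in> E. T f \<in> ball 0 1}"
    using zero_nbhd by (metis (lifting))
  have "dominated E P {\<lambda>f. norm (T f)}"
  proof (rule dominated_of_ball[OF F])
    fix f r assume "f \<in> E" "\<And>q. q \<in> F \<Longrightarrow> q f < e" "r \<in> {\<lambda>f. norm (T f)}"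
    then show "r f \<le> 1" using sub by fastforce
  qed (auto simp: linear_form_onD(2)[OF lin] norm_mult)
  then show "linear_form_on E T \<and> (\<forall>f. f \<notin> E \<longrightarrow> T f = 0) \<and> dominated E P {\<lambda>f. norm (T f)}"
    using lin T by (auto simp: dual_space_def)
next
  assume T: "linear_form_on E T \<and> (\<forall>f. f \<notin> E \<longrightarrow> T f = 0) \<and> dominated E P {\<lambda>f. norm (T f)}"
  have "openin X {f \<in> E. T f \<in> V}" if V: "open V" for V
    unfolding openin_lc_topology
  proof (intro conjI ballI)
    fix f assume f: "f \<in> {f \<in> E. T f \<in> V}"
    then obtain e where e: "0 < e" "\<And>z. dist z (T f) < e \<Longrightarrow> z \<in> V"
      using V by (auto simp: open_dist)
    obtain G d where G: "finite G" "G \<subseteq> P" "0 < d"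
      "\<And>f r. f \<in> E \<Longrightarrow> (\<And>q. q \<in> G \<Longrightarrow> q f < d) \<Longrightarrow> r \<in> {\<lambda>f. norm (T f)} \<Longrightarrow> r f < e"
      using dominated_ball[OF conjunct2[OF conjunct2[OF T]] e(1)] by blast
    have "T g \<in> V" if g: "g \<in> E" "\<forall>q\<in>G. q (\<lambda>x. g x - f x) < d" for g
    proof -
      have "norm (T (\<lambda>x. g x - f x)) < e"
        using G(4)[of "\<lambda>x. g x - f x" "\<lambda>f. norm (T f)"] g f
          fun_subspaceD(4)[OF subspace, of g f] by auto
      then show ?thesis using e(2) linear_form_on_diff[OF subspace, of T g f] T g f
        by (auto simp: dist_norm)
    qed
    then show "\<exists>F e. finite F \<and> F \<subseteq> P \<and> 0 < e \<and>
        {g \<in> E. \<forall>p\<in>F. p (\<lambda>x. g x - f x) < e} \<subseteq> {f \<in> E. T f \<in> V}"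
      using G(1-3) by (intro exI[of _ G] exI[of _ d]) auto
  qed auto
  then have "continuous_map X euclidean T" unfolding continuous_map by auto
  then show "T \<in> dual_space X"
    using T by (auto simp: dual_space_def linear_form_on_def)
qed

text \<open>Turns the topological clause in the definition of \<open>OC_top\<close>, continuity of a
  seminorm on a step, into an inequality.\<close>

lemma continuous_seminorm_iff:
  assumes p: "seminorm_on E p"
  shows "continuous_map X euclideanreal p \<longleftrightarrow> dominated E P {p}"
proof
  assume cont: "continuous_map X euclideanreal p"
  have "openin X {f \<in> E. p f \<in> {..<1}}"
    using openin_continuous_map_preimage[OF cont, of "{..<1}"] by simp
  moreover have "(\<lambda>_. 0) \<in> {f \<in> E. p f \<in> {..<1}}"
    using fun_subspaceD(1)[OF subspace] seminorm_onD(3)[OF p fun_subspaceD(1)[OF subspace], of 0]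
    by simp
  ultimately obtain F e where F: "finite F" "F \<subseteq> P" "0 < e"
    and sub: "\<And>f. f \<in> E \<Longrightarrow> (\<And>q. q \<in> F \<Longrightarrow> q f < e) \<Longrightarrow> f \<in> {f \<in> E. p f \<in> {..<1}}"
    using zero_nbhd by (metis (lifting))
  show "dominated E P {p}"
  proof (rule dominated_of_ball[OF F])
    fix f r assume "f \<in> E" "\<And>q. q \<in> F \<Longrightarrow> q f < e" "r \<in> {p}"
    then show "r f \<le> 1" using sub by fastforce
  qed (auto simp: seminorm_onD(3)[OF p])
next
  assume dom: "dominated E P {p}"
  have "openin X {f \<in> E. p f \<in> V}" if V: "open V" for V
    unfolding openin_lc_topology
  proof (intro conjI ballI)
    fix f assume f: "f \<in> {f \<in> E. p f \<in> V}"
    then obtain e where e: "0 < e" "\<And>z. dist z (p f) < e \<Longrightarrow> z \<in> V"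
      using V by (auto simp: open_dist)
    from dominated_ball[OF dom e(1)] obtain G d where G: "finite G" "G \<subseteq> P" "0 < d"
      "\<And>f r. f \<in> E \<Longrightarrow> (\<And>q. q \<in> G \<Longrightarrow> q f < d) \<Longrightarrow> r \<in> {p} \<Longrightarrow> r f < e"
      by blast
    have "p g \<in> V" if g: "g \<in> E" "\<forall>q\<in>G. q (\<lambda>x. g x - f x) < d" for g
    proof -
      have fE: "f \<in> E" using f by simp
      have diff: "(\<lambda>x. g x - f x) \<in> E" using fun_subspaceD(4)[OF subspace g(1) fE] .
      have lt: "p (\<lambda>x. g x - f x) < e" using G(4)[of "\<lambda>x. g x - f x" p] g diff by auto
      \<comment> \<open>Subadditivity in both directions gives the reverse triangle inequality:
        \<open>p g\<close> and \<open>p f\<close> differ by at most \<open>p\<close> of the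
        difference.\<close>
      have "p (\<lambda>x. f x + (g x - f x)) \<le> p f + p (\<lambda>x. g x - f x)"
        by (rule seminorm_onD(2)[OF p fE diff])
      moreover have "p (\<lambda>x. g x + (-1) * (g x - f x)) \<le> p g + p (\<lambda>x. (-1) * (g x - f x))"
        by (rule seminorm_onD(2)[OF p g(1) fun_subspaceD(3)[OF subspace diff]])
      moreover have "p (\<lambda>x. (-1) * (g x - f x)) = p (\<lambda>x. g x - f x)"
        using seminorm_onD(3)[OF p diff, of "-1"] by simp
      ultimately have "dist (p g) (p f) < e" using lt by (simp add: dist_real_def)
      then show ?thesis by (rule e(2))
    qed
    then show "\<exists>F e. finite F \<and> F \<subseteq> P \<and> 0 < e \<and>
        {g \<in> E. \<forall>p\<in>F. p (\<lambda>x. g x - f x) < e} \<subseteq> {f \<in> E. p f \<in> V}"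
      using G(1-3) by (intro exI[of _ G] exI[of _ d]) auto
  qed auto
  then show "continuous_map X euclideanreal p" unfolding continuous_map by auto
qed

text \<open>Gives meaning to the seminorms of the strong dual: a real \<open>SUP\<close> carries
  information only over a bounded set.\<close>

lemma dual_space_bounded_on:
  assumes "T \<in> dual_space X" "lc_bounded X B"
  shows "bdd_above ((\<lambda>f. norm (T f)) ` B)"
proof -
  have "dominated E P {\<lambda>f. norm (T f)}" using assms(1) dual_space_iff by blast
  then obtain C where "\<forall>r\<in>{\<lambda>f. norm (T f)}. \<forall>f\<in>B. r f \<le> C"
    by (rule lc_bounded_dominated[OF assms(2)])
  then show ?thesis by (intro bdd_aboveI2) auto
qed

section \<open>Strong duals and transposed operators\<close>

lemma fun_subspace_dual: "fun_subspace (dual_space X)"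
  unfolding fun_subspace_def
proof (intro conjI ballI allI)
  show "(\<lambda>_. 0) \<in> dual_space X"
    by (simp add: dual_space_def)
next
  fix S T assume "S \<in> dual_space X" "T \<in> dual_space X"
  then show "(\<lambda>f. S f + T f) \<in> dual_space X"
    by (auto simp: dual_space_def algebra_simps intro!: continuous_map_add)
next
  fix c and T assume "T \<in> dual_space X"
  then have "continuous_map X euclidean T" by (simp add: dual_space_def)
  then have "continuous_map X euclidean ((*) c \<circ> T)"
    by (rule continuous_map_compose)
       (auto simp: continuous_map_iff_continuous2 intro!: continuous_intros)
  then show "(\<lambda>f. c * T f) \<in> dual_space X"
    using \<open>T \<in> dual_space X\<close> by (auto simp: dual_space_def algebra_simps o_def)
qed

lemma lc_space_dual: "lc_space (dual_space X) (dual_seminorms X)"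
proof
  show "fun_subspace (dual_space X)" by (rule fun_subspace_dual)
next
  fix p assume "p \<in> dual_seminorms X"
  then obtain B where B: "lc_bounded X B" "B \<noteq> {}" "p = (\<lambda>T. SUP f\<in>B. norm (T f))" by auto
  show "seminorm_on (dual_space X) p"
    unfolding B(3)
  proof (rule seminorm_on_SUP[OF B(2)])
    show "seminorm_on (dual_space X) (\<lambda>T. norm (T f))" for f
      by (rule seminorm_on_norm) (simp add: linear_form_on_def)
    show "bdd_above ((\<lambda>f. norm (T f)) ` B)" if "T \<in> dual_space X" for T
      using dual_space_bounded_on[OF that B(1)] .
  qed
qed

text \<open>Meant for \<open>A = conv_OC_dual T\<close> and \<open>f = T\<close>, where the orbit
  from \<open>k = 0\<close> on consists of the convolution powers. The term \<open>k = 0\<close>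
  lies outside the equicontinuous family and is covered by \<open>p f\<close>.\<close>

lemma lc_bounded_orbit:
  assumes A: "power_bounded X A" and f: "f \<in> E"
  shows "lc_bounded X {(A ^^ k) f | k. True}"
  unfolding lc_bounded_iff
proof (intro conjI ballI)
  have lin: "linear_endo E A" using A power_bounded_iff by blast
  show "{(A ^^ k) f | k. True} \<subseteq> E" using linear_endoD(1)[OF linear_endo_funpow[OF lin] f] by auto
  fix p assume p: "p \<in> P"
  then have "dominated E P {\<lambda>f. p ((A ^^ k) f) | k. 1 \<le> k}" using A power_bounded_iff by blast
  then obtain C where
    C: "\<forall>r\<in>{\<lambda>f. p ((A ^^ k) f) | k. 1 \<le> k}. \<forall>g\<in>{f}. r g \<le> C"
    by (rule lc_bounded_dominated[of "{f}", rotated]) (use f in \<open>auto simp: lc_bounded_iff\<close>)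
  have "p ((A ^^ k) f) \<le> max C (p f)" for k
  proof (cases "k = 0")
    case False
    then have "(\<lambda>f. p ((A ^^ k) f)) \<in> {\<lambda>f. p ((A ^^ k) f) | k. 1 \<le> k}"
      by (intro CollectI exI[of _ k]) auto
    from bspec[OF C this] show ?thesis by simp
  qed simp
  then show "\<exists>C. \<forall>g\<in>{(A ^^ k) f | k. True}. p g \<le> C" by blast
qed

lemma adjoint_mem_dual_space:
  assumes "T \<in> dual_space X" "linear_endo E B" "\<And>p. p \<in> P \<Longrightarrow> dominated E P {\<lambda>f. p (B f)}"
  shows "(\<lambda>f. if f \<in> E then T (B f) else 0) \<in> dual_space X"
  unfolding dual_space_iff
proof (intro conjI allI impI)
  have T: "linear_form_on E T" "dominated E P {\<lambda>f. norm (T f)}"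
    using assms(1) dual_space_iff by auto
  show "linear_form_on E (\<lambda>f. if f \<in> E then T (B f) else 0)"
    using T(1) assms(2) fun_subspaceD[OF subspace]
    unfolding linear_form_on_def linear_endo_def by simp
  obtain F C where F: "finite F" "F \<subseteq> P" "0 \<le> C"
    and le: "\<And>f. f \<in> E \<Longrightarrow> norm (T f) \<le> C * (\<Sum>p\<in>F. p f)"
    using T(2) unfolding dominated_def by auto
  have "dominated E P (\<Union>p\<in>F. {\<lambda>f. p (B f)})"
    by (rule dominated_UN[OF F(1)], rule assms(3)) (use F(2) in blast)
  then obtain G D where G: "finite G" "G \<subseteq> P" "0 \<le> D"
    and le': "\<And>p f. p \<in> F \<Longrightarrow> f \<in> E \<Longrightarrow> p (B f) \<le> D * (\<Sum>p\<in>G. p f)"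
    unfolding dominated_def by auto
  have "norm (T (B f)) \<le> (C * (real (card F) * D)) * (\<Sum>p\<in>G. p f)" if f: "f \<in> E" for f
  proof -
    have "(\<Sum>p\<in>F. p (B f)) \<le> real (card F) * (D * (\<Sum>p\<in>G. p f))"
      using sum_bounded_above[of F "\<lambda>p. p (B f)"] le' f by blast
    then have "C * (\<Sum>p\<in>F. p (B f)) \<le> C * (real (card F) * (D * (\<Sum>p\<in>G. p f)))"
      using F(3) by (rule mult_left_mono)
    then show ?thesis using le[OF linear_endoD(1)[OF assms(2) f]] by (simp add: mult_ac)
  qed
  then show "dominated E P {\<lambda>f. norm (if f \<in> E then T (B f) else 0)}"
    unfolding dominated_def using G F(3)
    by (intro exI[of _ G] exI[of _ "C * (real (card F) * D)"]) auto
qed auto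

text \<open>\<open>A\<close> is known to be a transpose only on the dual space, so membership of the
  iterates has to be carried through the induction.\<close>

lemma funpow_adjoint:
  assumes "linear_endo E B"
    and A: "\<And>T. T \<in> dual_space X \<Longrightarrow> A T = (\<lambda>f. if f \<in> E then T (B f) else 0)"
    and mem: "\<And>T. T \<in> dual_space X \<Longrightarrow> A T \<in> dual_space X"
    and T: "T \<in> dual_space X"
  shows "(A ^^ k) T = (\<lambda>f. if f \<in> E then T ((B ^^ k) f) else 0)" "(A ^^ k) T \<in> dual_space X"
proof -
  have "(A ^^ k) T = (\<lambda>f. if f \<in> E then T ((B ^^ k) f) else 0) \<and> (A ^^ k) T \<in> dual_space X"
  proof (induction k)
    case 0
    then show ?case using T dual_space_iff by auto
  next
    case (Suc k)
    have "(A ^^ Suc k) T = A ((A ^^ k) T)" by simp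
    also have "\<dots> = (\<lambda>f. if f \<in> E then (A ^^ k) T (B f) else 0)" using A Suc by blast
    also have "\<dots> = (\<lambda>f. if f \<in> E then T ((B ^^ Suc k) f) else 0)"
      using Suc linear_endoD(1)[OF assms(1)] by (auto simp: funpow_swap1)
    finally have "(A ^^ Suc k) T = \<dots>" .
    moreover have "A ((A ^^ k) T) \<in> dual_space X" using mem Suc by blast
    then have "(A ^^ Suc k) T \<in> dual_space X" by simp
    ultimately show ?case by blast
  qed
  then show "(A ^^ k) T = (\<lambda>f. if f \<in> E then T ((B ^^ k) f) else 0)" "(A ^^ k) T \<in> dual_space X"
    by auto
qed

text \<open>The seminorm of \<open>(A ^^ k) T\<close> over a bounded set \<open>G\<close> is a
  supremum of \<open>T\<close> over \<open>(B ^^ k)\<close> applied to \<open>G\<close>.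
  Equicontinuity of the powers of \<open>B\<close> keeps the union \<open>H\<close> of these images
  bounded, so one dual seminorm dominates for all \<open>k\<close>.\<close>

lemma power_bounded_adjoint:
  assumes B: "power_bounded X B"
    and A: "\<And>T. T \<in> dual_space X \<Longrightarrow> A T = (\<lambda>f. if f \<in> E then T (B f) else 0)"
  shows "power_bounded (strong_dual X) A"
proof -
  interpret dual: lc_space "dual_space X" "dual_seminorms X" by (rule lc_space_dual)
  have lin: "linear_endo E B" and dom: "\<And>p. p \<in> P \<Longrightarrow> dominated E P {\<lambda>f. p ((B ^^ k) f) | k. 1 \<le> k}"
    using B power_bounded_iff by auto
  have dom1: "dominated E P {\<lambda>f. p (B f)}" if "p \<in> P" for p
    by (rule dominated_mono[OF dom[OF that]]) (force intro: exI[of _ "Suc 0"])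
  have mem: "A T \<in> dual_space X" if "T \<in> dual_space X" for T
    using adjoint_mem_dual_space[OF that lin dom1] A[OF that] by simp
  have pow: "(A ^^ k) T = (\<lambda>f. if f \<in> E then T ((B ^^ k) f) else 0)" if "T \<in> dual_space X" for T k
    by (rule funpow_adjoint(1)[OF lin]) (fact A mem that)+
  have "linear_endo (dual_space X) A"
    unfolding linear_endo_def
  proof (intro conjI ballI allI)
    show "A T \<in> dual_space X" if "T \<in> dual_space X" for T using mem that .
    show "A (\<lambda>x. S x + T x) = (\<lambda>x. A S x + A T x)" if "S \<in> dual_space X" "T \<in> dual_space X" for S T
      using A[OF fun_subspaceD(2)[OF fun_subspace_dual that]] A[OF that(1)] A[OF that(2)] by auto
    show "A (\<lambda>x. c * T x) = (\<lambda>x. c * A T x)" if "T \<in> dual_space X" for T c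
      using A[OF fun_subspaceD(3)[OF fun_subspace_dual that]] A[OF that(1)] by auto
  qed
  moreover have "dominated (dual_space X) (dual_seminorms X) {\<lambda>T. p ((A ^^ k) T) | k. 1 \<le> k}"
    if p: "p \<in> dual_seminorms X" for p
  proof -
    obtain G where G: "lc_bounded X G" "G \<noteq> {}" "p = (\<lambda>T. SUP f\<in>G. norm (T f))" using p by auto
    have GE: "G \<subseteq> E" using G(1) lc_bounded_iff by blast
    define H where "H = {(B ^^ k) f | k f. f \<in> G \<and> 1 \<le> k}"
    have H: "lc_bounded X H"
      unfolding lc_bounded_iff
    proof (intro conjI ballI)
      show "H \<subseteq> E" unfolding H_def using linear_endoD(1)[OF linear_endo_funpow[OF lin]] GE by auto
      fix p assume p: "p \<in> P"
      obtain C where C: "\<forall>r\<in>{\<lambda>f. p ((B ^^ k) f) | k. 1 \<le> k}. \<forall>g\<in>G. r g \<le> C"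
        by (rule lc_bounded_dominated[OF G(1) dom[OF p]])
      have "p f \<le> C" if f: "f \<in> H" for f
      proof -
        obtain k g where k: "f = (B ^^ k) g" "g \<in> G" "1 \<le> k" using \<open>f \<in> H\<close> unfolding H_def by blast
        have "(\<lambda>f. p ((B ^^ k) f)) \<in> {\<lambda>f. p ((B ^^ k) f) | k. 1 \<le> k}" using k(3) by blast
        from bspec[OF bspec[OF C this] k(2)] show ?thesis by (simp add: k(1))
      qed
      then show "\<exists>C. \<forall>f\<in>H. p f \<le> C" by blast
    qed
    obtain g where g: "g \<in> G" using G(2) by blast
    then have "(B ^^ 1) g \<in> H" unfolding H_def by blast
    then have Hne: "H \<noteq> {}" by blast
    define q where "q = (\<lambda>T :: ('x \<Rightarrow> complex) \<Rightarrow> complex. SUP f\<in>H. norm (T f))"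
    have q: "q \<in> dual_seminorms X" unfolding q_def using H Hne by (intro CollectI exI[of _ H]) simp
    have "p ((A ^^ k) T) \<le> q T" if T: "T \<in> dual_space X" and k: "1 \<le> k" for T k
      unfolding G(3) q_def
    proof (rule cSUP_least[OF G(2)])
      fix f assume f: "f \<in> G"
      then have "(A ^^ k) T f = T ((B ^^ k) f)" using pow[OF T] GE by auto
      moreover have "(B ^^ k) f \<in> H" using f k unfolding H_def by blast
      ultimately show "norm ((A ^^ k) T f) \<le> (SUP f\<in>H. norm (T f))"
        using cSUP_upper[OF _ dual_space_bounded_on[OF T H]] by simp
    qed
    then show ?thesis
      unfolding dominated_def using q by (intro exI[of _ "{q}"] exI[of _ 1]) auto
  qed
  ultimately show ?thesis unfolding strong_dual_def dual.power_bounded_iff by blast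
qed

end

section \<open>Smooth functions, S and \<open>O_C\<close>\<close>

lemma nth_deriv_0 [simp]: "nth_deriv 0 f = f"
  by (simp add: nth_deriv_def)

lemma nth_deriv_Suc: "nth_deriv (Suc i) f x = vector_derivative (nth_deriv i f) (at x)"
  by (simp add: nth_deriv_def)

lemma nth_deriv_nth_deriv: "nth_deriv i (nth_deriv j f) = nth_deriv (i + j) f"
  by (simp add: nth_deriv_def funpow_add)

text \<open>The working tool for derivative formulas: propose the whole sequence of derivatives and
  check a single differentiation; smoothness comes with it.\<close>

lemma nth_deriv_unique:
  assumes "\<And>i x. (F i has_vector_derivative F (Suc i) x) (at x)"
  shows "nth_deriv i (F 0) = F i" "smooth (F 0)"
proof -
  have eq: "nth_deriv i (F 0) = F i" for i
  proof (induction i)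
    case (Suc i)
    show ?case
      by (rule ext) (simp add: nth_deriv_Suc Suc vector_derivative_at[OF assms])
  qed simp
  then show "nth_deriv i (F 0) = F i" .
  show "smooth (F 0)"
    unfolding smooth_def eq using assms differentiableI_vector by blast
qed

lemma smooth_has_derivative:
  assumes "smooth f"
  shows "(nth_deriv i f has_vector_derivative nth_deriv (Suc i) f x) (at x)"
  using assms unfolding smooth_def nth_deriv_Suc vector_derivative_works by blast

lemma smooth_nth_deriv: "smooth f \<Longrightarrow> smooth (nth_deriv i f)"
  unfolding smooth_def nth_deriv_nth_deriv by blast

text \<open>For functions without a convenient formula for all derivatives: a class in which every
  member has a derivative in the class contains all iterated derivatives.\<close>

lemma smooth_coinduct:
  assumes "f \<in> K" and K: "\<And>g. g \<in> K \<Longrightarrow> \<exists>g'\<in>K. \<forall>x. (g has_vector_derivative g' x) (at x)"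
  shows "smooth f"
proof -
  have mem: "nth_deriv i f \<in> K" for i
  proof (induction i)
    case (Suc i)
    then obtain g' where g': "g' \<in> K" "\<And>x. (nth_deriv i f has_vector_derivative g' x) (at x)"
      using K by blast
    have "nth_deriv (Suc i) f = g'"
      by (rule ext) (simp add: nth_deriv_Suc vector_derivative_at[OF g'(2)])
    then show ?case using g'(1) by simp
  qed (use assms(1) in simp)
  show ?thesis
    unfolding smooth_def using K[OF mem] differentiableI_vector by blast
qed

lemma smooth_const: "smooth (\<lambda>_. c)" and nth_deriv_const: "nth_deriv (Suc i) (\<lambda>_. c) = (\<lambda>_. 0)"
proof -
  let ?F = "\<lambda>i (x::real). if i = 0 then c else 0"
  have d: "(?F i has_vector_derivative ?F (Suc i) x) (at x)" for i x by (cases i) simp_all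
  show "smooth (\<lambda>_. c)" using nth_deriv_unique(2)[of ?F, OF d] by simp
  show "nth_deriv (Suc i) (\<lambda>_. c) = (\<lambda>_. 0)" using nth_deriv_unique(1)[of ?F "Suc i", OF d] by simp
qed

lemma
  assumes "smooth f" "smooth g"
  shows nth_deriv_add: "nth_deriv i (\<lambda>x. f x + g x) = (\<lambda>x. nth_deriv i f x + nth_deriv i g x)"
    and smooth_add: "smooth (\<lambda>x. f x + g x)"
proof -
  let ?F = "\<lambda>i x. nth_deriv i f x + nth_deriv i g x"
  have d: "(?F i has_vector_derivative ?F (Suc i) x) (at x)" for i x
    by (intro has_vector_derivative_add smooth_has_derivative assms)
  show "nth_deriv i (\<lambda>x. f x + g x) = ?F i" using nth_deriv_unique(1)[of ?F i, OF d] by simp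
  show "smooth (\<lambda>x. f x + g x)" using nth_deriv_unique(2)[of ?F, OF d] by simp
qed

lemma
  assumes "smooth f"
  shows nth_deriv_cmult: "nth_deriv i (\<lambda>x. c * f x) = (\<lambda>x. c * nth_deriv i f x)"
    and smooth_cmult: "smooth (\<lambda>x. c * f x)"
proof -
  let ?F = "\<lambda>i x. c * nth_deriv i f x"
  have d: "(?F i has_vector_derivative ?F (Suc i) x) (at x)" for i x
    by (intro has_vector_derivative_mult_right smooth_has_derivative assms)
  show "nth_deriv i (\<lambda>x. c * f x) = ?F i" using nth_deriv_unique(1)[of ?F i, OF d] by simp
  show "smooth (\<lambda>x. c * f x)" using nth_deriv_unique(2)[of ?F, OF d] by simp
qed

lemma
  assumes "smooth f" "smooth g"
  shows nth_deriv_diff: "nth_deriv i (\<lambda>x. f x - g x) = (\<lambda>x. nth_deriv i f x - nth_deriv i g x)"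
    and smooth_diff: "smooth (\<lambda>x. f x - g x)"
  using nth_deriv_add[OF assms(1) smooth_cmult[OF assms(2), of "-1"], of i]
    smooth_add[OF assms(1) smooth_cmult[OF assms(2), of "-1"]]
    nth_deriv_cmult[OF assms(2), of i "-1"] by simp_all

lemma
  assumes "smooth f"
  shows nth_deriv_affine:
      "nth_deriv i (\<lambda>x. f (a + s * x)) = (\<lambda>x. of_real (s ^ i) * nth_deriv i f (a + s * x))"
    and smooth_affine: "smooth (\<lambda>x. f (a + s * x))"
proof -
  let ?F = "\<lambda>i x. of_real (s ^ i) * nth_deriv i f (a + s * x)"
  have d: "(?F i has_vector_derivative ?F (Suc i) x) (at x)" for i x
  proof -
    have 1: "((\<lambda>x. a + s * x) has_vector_derivative s) (at x)"
      by (auto intro!: derivative_eq_intros simp flip: has_real_derivative_iff_has_vector_derivative)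
    have "((\<lambda>x. nth_deriv i f (a + s * x)) has_vector_derivative
            s *\<^sub>R nth_deriv (Suc i) f (a + s * x)) (at x)"
      using vector_diff_chain_at[OF 1 smooth_has_derivative[OF assms, of i]] by (simp add: o_def)
    from has_vector_derivative_mult_right[OF this, of "of_real (s ^ i)"]
    show ?thesis by (simp add: scaleR_conv_of_real mult_ac)
  qed
  show "nth_deriv i (\<lambda>x. f (a + s * x)) = ?F i" using nth_deriv_unique(1)[of ?F i, OF d] by simp
  show "smooth (\<lambda>x. f (a + s * x))" using nth_deriv_unique(2)[of ?F, OF d] by simp
qed

lemma mult_has_vector_derivative:
  assumes "smooth f" "smooth g"
  shows "((\<lambda>x. f x * g x) has_vector_derivative nth_deriv 1 f x * g x + f x * nth_deriv 1 g x) (at x)"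
  using has_vector_derivative_mult[OF smooth_has_derivative[OF assms(1), of 0] smooth_has_derivative[OF assms(2), of 0]]
  by (simp add: add.commute)

text \<open>Differentiating a product yields a sum of two products, so sums must be included for the
  class to be closed under differentiation.\<close>

inductive_set smooth_products :: "(real \<Rightarrow> complex) set" where
  mult: "smooth f \<Longrightarrow> smooth g \<Longrightarrow> (\<lambda>x. f x * g x) \<in> smooth_products"
| add: "f \<in> smooth_products \<Longrightarrow> g \<in> smooth_products \<Longrightarrow> (\<lambda>x. f x + g x) \<in> smooth_products"

lemma smooth_mult:
  assumes "smooth f" "smooth g"
  shows "smooth (\<lambda>x. f x * g x)"
proof (rule smooth_coinduct[of _ smooth_products])
  show "(\<lambda>x. f x * g x) \<in> smooth_products" using assms by (rule smooth_products.mult)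
  fix h assume "h \<in> smooth_products"
  then show "\<exists>h'\<in>smooth_products. \<forall>x. (h has_vector_derivative h' x) (at x)"
  proof induction
    case (mult f g)
    have "(\<lambda>x. nth_deriv 1 f x * g x + f x * nth_deriv 1 g x) \<in> smooth_products"
      using mult by (intro smooth_products.intros smooth_nth_deriv)
    then show ?case using mult_has_vector_derivative[OF mult] by (intro bexI allI)
  next
    case (add f g)
    then obtain f' g' where "f' \<in> smooth_products" "g' \<in> smooth_products"
      "\<And>x. (f has_vector_derivative f' x) (at x)" "\<And>x. (g has_vector_derivative g' x) (at x)"
      by blast
    then show ?case
      by (intro bexI[of _ "\<lambda>x. f' x + g' x"]) (auto intro: has_vector_derivative_add smooth_products.add)
  qed
qed

text \<open>The factor \<open>2 ^ i\<close> is the sum of the binomial coefficients in the Leibniz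
  rule. It arises here by doubling, since each differentiation splits a product into two for which
  the same \<open>a\<close> and \<open>b\<close> serve.\<close>

lemma norm_nth_deriv_mult_le:
  assumes "smooth f" "smooth g"
    and "\<And>j. j \<le> i \<Longrightarrow> norm (nth_deriv j f x) \<le> a" "\<And>j. j \<le> i \<Longrightarrow> norm (nth_deriv j g x) \<le> b"
  shows "norm (nth_deriv i (\<lambda>x. f x * g x) x) \<le> 2 ^ i * (a * b)"
  using assms
proof (induction i arbitrary: f g)
  case 0
  have "0 \<le> a" using order_trans[OF norm_ge_zero "0.prems"(3)[of 0]] by simp
  then show ?case
    using mult_mono[of "norm (f x)" a "norm (g x)" b] "0.prems"(3)[of 0] "0.prems"(4)[of 0]
    by (simp add: norm_mult)
next
  case (Suc i)
  let ?f' = "nth_deriv 1 f" and ?g' = "nth_deriv 1 g"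
  have "nth_deriv 1 (\<lambda>x. f x * g x) = (\<lambda>x. ?f' x * g x + f x * ?g' x)"
    by (rule ext) (simp add: nth_deriv_Suc vector_derivative_at[OF mult_has_vector_derivative[OF Suc.prems(1,2)]])
  then have "nth_deriv (Suc i) (\<lambda>x. f x * g x) = nth_deriv i (\<lambda>x. ?f' x * g x + f x * ?g' x)"
    using nth_deriv_nth_deriv[of i 1 "\<lambda>x. f x * g x"] by simp
  then have eq: "nth_deriv (Suc i) (\<lambda>x. f x * g x) =
      (\<lambda>x. nth_deriv i (\<lambda>x. ?f' x * g x) x + nth_deriv i (\<lambda>x. f x * ?g' x) x)"
    using Suc.prems(1,2) by (simp add: nth_deriv_add smooth_mult smooth_nth_deriv)
  have "norm (nth_deriv i (\<lambda>x. ?f' x * g x) x) \<le> 2 ^ i * (a * b)"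
    using Suc.prems by (intro Suc.IH smooth_nth_deriv) (auto simp: nth_deriv_nth_deriv)
  moreover have "norm (nth_deriv i (\<lambda>x. f x * ?g' x) x) \<le> 2 ^ i * (a * b)"
    using Suc.prems by (intro Suc.IH smooth_nth_deriv) (auto simp: nth_deriv_nth_deriv)
  ultimately show ?case
    unfolding eq using norm_triangle_ineq[of "nth_deriv i (\<lambda>x. ?f' x * g x) x" "nth_deriv i (\<lambda>x. f x * ?g' x) x"]
    by simp
qed

section \<open>Peetre's inequality and the weights\<close>

lemma peetre_le: "1 + (x + y)\<^sup>2 \<le> 2 * (1 + x\<^sup>2) * (1 + (y::real)\<^sup>2)"
proof -
  \<comment> \<open>This expression is the right-hand side minus the left-hand side.\<close>
  have "0 \<le> (x - y)\<^sup>2 + 1 + 2 * (x * y)\<^sup>2" by simp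
  then show ?thesis by (simp add: power2_eq_square algebra_simps)
qed

lemma peetre_power_le: "(1 + (x + y)\<^sup>2) ^ n \<le> 2 ^ n * (1 + x\<^sup>2) ^ n * (1 + (y::real)\<^sup>2) ^ n"
proof -
  have "(1 + (x + y)\<^sup>2) ^ n \<le> (2 * (1 + x\<^sup>2) * (1 + y\<^sup>2)) ^ n"
    by (intro power_mono peetre_le) simp
  then show ?thesis by (simp only: power_mult_distrib)
qed

lemma one_le_weight: "1 \<le> (1 + x\<^sup>2 :: real) ^ n"
  by (simp add: one_le_power)

lemma weight_pos: "0 < (1 + x\<^sup>2 :: real) ^ n"
  by (simp add: add_pos_nonneg)

section \<open>Pointwise form of the norms\<close>

lemma OC_step_iff:
  "f \<in> OC_step n \<longleftrightarrow> smooth f \<and> (\<forall>i. \<exists>M. \<forall>x. norm (nth_deriv i f x) \<le> M * (1 + x\<^sup>2) ^ n)"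
proof (intro iffI conjI allI)
  fix i assume f: "f \<in> OC_step n"
  \<comment> \<open>\<open>Suc i\<close> and not \<open>i\<close>, because the definition of a step
    provides bounds only for \<open>m \<ge> 1\<close>.\<close>
  then have "bdd_above (OC_values (Suc i) n f)" by (auto simp: OC_step_def)
  then obtain M where M: "\<And>y. y \<in> OC_values (Suc i) n f \<Longrightarrow> y \<le> M" by (auto simp: bdd_above_def)
  have "norm (nth_deriv i f x) \<le> M * (1 + x\<^sup>2) ^ n" for x
  proof -
    have "norm (nth_deriv i f x) / (1 + x\<^sup>2) ^ n \<le> M"
      by (rule M) (auto simp: OC_values_def intro!: exI[of _ i])
    then show ?thesis using weight_pos[of x n] by (simp add: divide_le_eq)
  qed
  then show "\<exists>M. \<forall>x. norm (nth_deriv i f x) \<le> M * (1 + x\<^sup>2) ^ n" by blast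
next
  assume *: "smooth f \<and> (\<forall>i. \<exists>M. \<forall>x. norm (nth_deriv i f x) \<le> M * (1 + x\<^sup>2) ^ n)"
  then obtain M where M: "\<And>i x. norm (nth_deriv i f x) \<le> M i * (1 + x\<^sup>2) ^ n" by metis
  have "bdd_above (OC_values m n f)" for m
  proof (rule bdd_aboveI)
    fix y assume "y \<in> OC_values m n f"
    then obtain i x where y: "i \<le> m" "y = norm (nth_deriv i f x) / (1 + x\<^sup>2) ^ n"
      by (auto simp: OC_values_def)
    have "y \<le> M i" using M[of i x] weight_pos[of x n] by (simp add: y(2) divide_le_eq)
    also have "\<dots> \<le> Max (M ` {..m})" using y(1) by simp
    finally show "y \<le> Max (M ` {..m})" .
  qed
  then show "f \<in> OC_step n" using * by (simp add: OC_step_def)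
qed (auto simp: OC_step_def)

lemma OC_step_smooth: "f \<in> OC_step n \<Longrightarrow> smooth f"
  by (simp add: OC_step_iff)

lemma bdd_above_OC_values: "f \<in> OC_step n \<Longrightarrow> bdd_above (OC_values m n f)"
  using bdd_above_mono[of "OC_values (Suc m) n f" "OC_values m n f"]
  by (fastforce simp: OC_step_def OC_values_def)

text \<open>Norm estimates are proved and used pointwise through this equivalence; membership in the
  step makes the real supremum meaningful.\<close>

lemma OC_norm_le_iff:
  assumes "f \<in> OC_step n"
  shows "OC_norm m n f \<le> M \<longleftrightarrow> (\<forall>i\<le>m. \<forall>x. norm (nth_deriv i f x) \<le> M * (1 + x\<^sup>2) ^ n)"
proof -
  have "OC_norm m n f \<le> M \<longleftrightarrow> (\<forall>y\<in>OC_values m n f. y \<le> M)"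
    unfolding OC_norm_def
    by (intro cSup_le_iff bdd_above_OC_values assms) (auto simp: OC_values_def)
  also have "\<dots> \<longleftrightarrow> (\<forall>i\<le>m. \<forall>x. norm (nth_deriv i f x) \<le> M * (1 + x\<^sup>2) ^ n)"
    unfolding OC_values_def by (fastforce simp: divide_le_eq weight_pos)
  finally show ?thesis .
qed

lemma norm_nth_deriv_le_OC_norm:
  "f \<in> OC_step n \<Longrightarrow> i \<le> m \<Longrightarrow> norm (nth_deriv i f x) \<le> OC_norm m n f * (1 + x\<^sup>2) ^ n"
  using OC_norm_le_iff[of f n m "OC_norm m n f"] by simp

lemma OC_norm_nonneg: "f \<in> OC_step n \<Longrightarrow> 0 \<le> OC_norm m n f"
  using order_trans[OF norm_ge_zero norm_nth_deriv_le_OC_norm[of f n 0 m 0]] by simp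

lemma OC_norm_mono: "f \<in> OC_step n \<Longrightarrow> m \<le> m' \<Longrightarrow> OC_norm m n f \<le> OC_norm m' n f"
  unfolding OC_norm_le_iff using norm_nth_deriv_le_OC_norm by (meson order_trans)

lemma Schwartz_iff:
  "f \<in> Schwartz \<longleftrightarrow> smooth f \<and> (\<forall>i n. \<exists>M. \<forall>x. (1 + x\<^sup>2) ^ n * norm (nth_deriv i f x) \<le> M)"
proof (intro iffI conjI allI)
  fix i n :: nat assume f: "f \<in> Schwartz"
  \<comment> \<open>The norms tie the exponent of the weight to the order of differentiation. As the
    weight is at least 1, the maximum frees the two from each other.\<close>
  define k where "k = max i n"
  have "bdd_above (schwartz_values k f)" using f by (auto simp: Schwartz_def)
  then obtain M where M: "\<And>y. y \<in> schwartz_values k f \<Longrightarrow> y \<le> M" by (auto simp: bdd_above_def)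
  have "(1 + x\<^sup>2) ^ n * norm (nth_deriv i f x) \<le> M" for x
  proof -
    have "(1 + x\<^sup>2) ^ n * norm (nth_deriv i f x) \<le> (1 + x\<^sup>2) ^ k * norm (nth_deriv i f x)"
      by (intro mult_right_mono power_increasing) (auto simp: k_def)
    also have "\<dots> \<le> M"
      by (rule M) (auto simp: schwartz_values_def k_def intro!: exI[of _ i])
    finally show ?thesis .
  qed
  then show "\<exists>M. \<forall>x. (1 + x\<^sup>2) ^ n * norm (nth_deriv i f x) \<le> M" by blast
next
  assume *: "smooth f \<and> (\<forall>i n. \<exists>M. \<forall>x. (1 + x\<^sup>2) ^ n * norm (nth_deriv i f x) \<le> M)"
  then obtain M where M: "\<And>i n x. (1 + x\<^sup>2) ^ n * norm (nth_deriv i f x) \<le> M i n" by metis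
  have "bdd_above (schwartz_values n f)" for n
  proof (rule bdd_aboveI)
    fix y assume "y \<in> schwartz_values n f"
    then obtain i x where y: "i \<le> n" "y = (1 + x\<^sup>2) ^ n * norm (nth_deriv i f x)"
      by (auto simp: schwartz_values_def)
    have "y \<le> M i n" using M by (simp add: y(2))
    also have "\<dots> \<le> Max ((\<lambda>i. M i n) ` {..n})" using y(1) by simp
    finally show "y \<le> Max ((\<lambda>i. M i n) ` {..n})" .
  qed
  then show "f \<in> Schwartz" using * by (simp add: Schwartz_def)
qed (auto simp: Schwartz_def)

lemma Schwartz_smooth: "f \<in> Schwartz \<Longrightarrow> smooth f"
  by (simp add: Schwartz_iff)

lemma schwartz_norm_le_iff:
  assumes "f \<in> Schwartz"
  shows "schwartz_norm n f \<le> M \<longleftrightarrow> (\<forall>i\<le>n. \<forall>x. (1 + x\<^sup>2) ^ n * norm (nth_deriv i f x) \<le> M)"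
proof -
  have "schwartz_norm n f \<le> M \<longleftrightarrow> (\<forall>y\<in>schwartz_values n f. y \<le> M)"
    unfolding schwartz_norm_def
    by (intro cSup_le_iff) (use assms in \<open>auto simp: schwartz_values_def Schwartz_def\<close>)
  also have "\<dots> \<longleftrightarrow> (\<forall>i\<le>n. \<forall>x. (1 + x\<^sup>2) ^ n * norm (nth_deriv i f x) \<le> M)"
    unfolding schwartz_values_def by auto
  finally show ?thesis .
qed

lemma nth_deriv_le_schwartz_norm:
  "f \<in> Schwartz \<Longrightarrow> i \<le> n \<Longrightarrow> (1 + x\<^sup>2) ^ n * norm (nth_deriv i f x) \<le> schwartz_norm n f"
  using schwartz_norm_le_iff[of f n "schwartz_norm n f"] by simp

lemma nth_deriv_le_schwartz_norm':
  assumes "f \<in> Schwartz" "i \<le> N" "n \<le> N"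
  shows "(1 + x\<^sup>2) ^ n * norm (nth_deriv i f x) \<le> schwartz_norm N f"
proof -
  have "(1 + x\<^sup>2) ^ n * norm (nth_deriv i f x) \<le> (1 + x\<^sup>2) ^ N * norm (nth_deriv i f x)"
    using assms(3) by (intro mult_right_mono power_increasing) auto
  then show ?thesis using nth_deriv_le_schwartz_norm[OF assms(1,2), of x] by linarith
qed

lemma schwartz_norm_nonneg: "f \<in> Schwartz \<Longrightarrow> 0 \<le> schwartz_norm n f"
  using order_trans[OF norm_ge_zero, of "f 0"] nth_deriv_le_schwartz_norm[of f 0 n 0] by simp

lemma schwartz_norm_mono: "f \<in> Schwartz \<Longrightarrow> n \<le> n' \<Longrightarrow> schwartz_norm n f \<le> schwartz_norm n' f"
  unfolding schwartz_norm_le_iff using nth_deriv_le_schwartz_norm' by (meson order_trans)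

section \<open>The function spaces as locally convex spaces\<close>

lemma fun_subspace_OC_step: "fun_subspace (OC_step n)"
  unfolding fun_subspace_def
proof (intro conjI ballI allI)
  have "norm (nth_deriv i (\<lambda>_. 0) x) \<le> 0 * (1 + x\<^sup>2) ^ n" for i x
    by (cases i) (simp_all add: nth_deriv_const)
  then show "(\<lambda>_. 0) \<in> OC_step n" unfolding OC_step_iff using smooth_const by blast
next
  fix f g assume f: "f \<in> OC_step n" and g: "g \<in> OC_step n"
  have "norm (nth_deriv i (\<lambda>x. f x + g x) x) \<le> (OC_norm i n f + OC_norm i n g) * (1 + x\<^sup>2) ^ n" for i x
    using norm_triangle_ineq[of "nth_deriv i f x" "nth_deriv i g x"]
      norm_nth_deriv_le_OC_norm[OF f, of i i x] norm_nth_deriv_le_OC_norm[OF g, of i i x]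
    by (simp add: nth_deriv_add OC_step_smooth[OF f] OC_step_smooth[OF g] algebra_simps)
  then show "(\<lambda>x. f x + g x) \<in> OC_step n"
    unfolding OC_step_iff using smooth_add[OF OC_step_smooth[OF f] OC_step_smooth[OF g]] by blast
next
  fix c f assume f: "f \<in> OC_step n"
  have "norm (nth_deriv i (\<lambda>x. c * f x) x) \<le> (norm c * OC_norm i n f) * (1 + x\<^sup>2) ^ n" for i x
    using mult_left_mono[OF norm_nth_deriv_le_OC_norm[OF f, of i i x], of "norm c"]
    by (simp add: nth_deriv_cmult OC_step_smooth[OF f] norm_mult mult.assoc)
  then show "(\<lambda>x. c * f x) \<in> OC_step n"
    unfolding OC_step_iff using smooth_cmult[OF OC_step_smooth[OF f]] by blast
qed

text \<open>Serves both families of norms, with the weights \<open>1 / (1 + x^2)^n\<close> and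
  \<open>(1 + x^2)^n\<close>: each norm is a supremum of moduli of linear functionals.\<close>

lemma seminorm_on_weighted_Sup:
  assumes E: "\<And>f. f \<in> E \<Longrightarrow> smooth f" and w: "\<And>x. 0 \<le> w x"
    and bdd: "\<And>f. f \<in> E \<Longrightarrow> bdd_above {w x * norm (nth_deriv i f x) | x i. i \<le> m}"
  shows "seminorm_on E (\<lambda>f. Sup {w x * norm (nth_deriv i f x) | x i. i \<le> m})"
proof -
  define r where "r = (\<lambda>(x, i) f. norm (of_real (w x) * nth_deriv i f x))"
  have eq: "{w x * norm (nth_deriv i f x) | x i. i \<le> m} = (\<lambda>k. r k f) ` (UNIV \<times> {..m})" for f
    using w by (force simp: r_def norm_mult image_iff)
  show ?thesis
    unfolding eq
  proof (rule seminorm_on_SUP)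
    show "seminorm_on E (r k)" for k
      unfolding r_def case_prod_beta
      by (rule seminorm_on_norm)
         (auto simp: linear_form_on_def nth_deriv_add nth_deriv_cmult E algebra_simps)
    show "bdd_above ((\<lambda>k. r k f) ` (UNIV \<times> {..m}))" if "f \<in> E" for f
      using bdd[OF that] unfolding eq .
  qed auto
qed

lemma seminorm_on_OC_norm: "seminorm_on (OC_step n) (OC_norm m n)"
proof -
  have eq: "{1 / (1 + x\<^sup>2) ^ n * norm (nth_deriv i f x) | x i. i \<le> m} = OC_values m n f" for f
    by (simp add: OC_values_def)
  have "seminorm_on (OC_step n) (\<lambda>f. Sup {1 / (1 + x\<^sup>2) ^ n * norm (nth_deriv i f x) | x i. i \<le> m})"
    by (rule seminorm_on_weighted_Sup)
       (unfold eq, auto intro: OC_step_smooth bdd_above_OC_values)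
  then show ?thesis unfolding eq OC_norm_def[abs_def] .
qed

lemma seminorm_on_schwartz_norm: "seminorm_on Schwartz (schwartz_norm n)"
  unfolding schwartz_norm_def[abs_def] schwartz_values_def
  by (rule seminorm_on_weighted_Sup)
     (auto simp: Schwartz_def simp flip: schwartz_values_def)

lemma lc_space_OC_step: "lc_space (OC_step n) {OC_norm m n | m. 1 \<le> m}"
  by unfold_locales (auto simp: fun_subspace_OC_step seminorm_on_OC_norm)

lemma fun_subspace_Schwartz: "fun_subspace Schwartz"
  unfolding fun_subspace_def
proof (intro conjI ballI allI)
  have "(1 + x\<^sup>2) ^ n * norm (nth_deriv i (\<lambda>_. 0) x) \<le> 0" for i n x
    by (cases i) (simp_all add: nth_deriv_const)
  then show "(\<lambda>_. 0) \<in> Schwartz" unfolding Schwartz_iff using smooth_const by blast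
next
  fix f g assume f: "f \<in> Schwartz" and g: "g \<in> Schwartz"
  have "(1 + x\<^sup>2) ^ n * norm (nth_deriv i (\<lambda>x. f x + g x) x)
      \<le> schwartz_norm (i + n) f + schwartz_norm (i + n) g" for i n x
  proof -
    have "(1 + x\<^sup>2) ^ n * norm (nth_deriv i f x + nth_deriv i g x)
        \<le> (1 + x\<^sup>2) ^ n * (norm (nth_deriv i f x) + norm (nth_deriv i g x))"
      by (intro mult_left_mono norm_triangle_ineq) auto
    then show ?thesis
      using nth_deriv_le_schwartz_norm'[OF f, of i "i + n" n x] nth_deriv_le_schwartz_norm'[OF g, of i "i + n" n x]
      by (simp add: nth_deriv_add Schwartz_smooth[OF f] Schwartz_smooth[OF g] algebra_simps)
  qed
  then show "(\<lambda>x. f x + g x) \<in> Schwartz"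
    unfolding Schwartz_iff using smooth_add[OF Schwartz_smooth[OF f] Schwartz_smooth[OF g]] by blast
next
  fix c f assume f: "f \<in> Schwartz"
  have "(1 + x\<^sup>2) ^ n * norm (nth_deriv i (\<lambda>x. c * f x) x) \<le> norm c * schwartz_norm (i + n) f" for i n x
    using mult_left_mono[OF nth_deriv_le_schwartz_norm'[OF f, of i "i + n" n x], of "norm c"]
    by (simp add: nth_deriv_cmult Schwartz_smooth[OF f] norm_mult mult_ac)
  then show "(\<lambda>x. c * f x) \<in> Schwartz"
    unfolding Schwartz_iff using smooth_cmult[OF Schwartz_smooth[OF f]] by blast
qed

lemma lc_space_Schwartz: "lc_space Schwartz (range schwartz_norm)"
  by unfold_locales (auto simp: fun_subspace_Schwartz seminorm_on_schwartz_norm)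

lemma OC_step_mono:
  assumes "n \<le> n'" "f \<in> OC_step n"
  shows "f \<in> OC_step n'" "OC_norm m n' f \<le> OC_norm m n f"
proof -
  have le: "norm (nth_deriv i f x) \<le> OC_norm k n f * (1 + x\<^sup>2) ^ n'" if "i \<le> k" for i k x
  proof -
    have "OC_norm k n f * (1 + x\<^sup>2) ^ n \<le> OC_norm k n f * (1 + x\<^sup>2) ^ n'"
      using assms OC_norm_nonneg by (intro mult_left_mono power_increasing) auto
    then show ?thesis using norm_nth_deriv_le_OC_norm[OF assms(2) that, of x] by linarith
  qed
  show *: "f \<in> OC_step n'"
    unfolding OC_step_iff using OC_step_smooth[OF assms(2)] le[OF order_refl] by blast
  show "OC_norm m n' f \<le> OC_norm m n f"
    unfolding OC_norm_le_iff[OF *] using le by blast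
qed

lemma OC_step_subset_OC: "1 \<le> n \<Longrightarrow> OC_step n \<subseteq> OC"
  by (auto simp: OC_def)

lemma OC_iff: "f \<in> OC \<longleftrightarrow> (\<exists>n. f \<in> OC_step n)"
proof
  assume "\<exists>n. f \<in> OC_step n"
  then obtain n where "f \<in> OC_step n" by blast
  then have "f \<in> OC_step (Suc n)" by (rule OC_step_mono(1)[rotated]) simp
  then show "f \<in> OC" unfolding OC_def by (intro UN_I[of "Suc n"]) auto
qed (auto simp: OC_def)

lemma OC_stepE:
  assumes "f \<in> OC" obtains n where "1 \<le> n" "f \<in> OC_step n"
  using assms unfolding OC_def by blast

lemma OC_smooth: "f \<in> OC \<Longrightarrow> smooth f"
  using OC_step_smooth by (auto simp: OC_def)

lemma Schwartz_subset_OC_step: "Schwartz \<subseteq> OC_step n"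
proof
  fix f assume f: "f \<in> Schwartz"
  have "norm (nth_deriv i f x) \<le> schwartz_norm i f * (1 + x\<^sup>2) ^ n" for i x
  proof -
    have "norm (nth_deriv i f x) \<le> schwartz_norm i f"
      using nth_deriv_le_schwartz_norm'[OF f, of i i 0 x] by simp
    also have "\<dots> \<le> schwartz_norm i f * (1 + x\<^sup>2) ^ n"
      using mult_left_mono[OF one_le_weight schwartz_norm_nonneg[OF f]] by simp
    finally show ?thesis .
  qed
  then show "f \<in> OC_step n" unfolding OC_step_iff using Schwartz_smooth[OF f] by blast
qed

lemma Schwartz_subset_OC: "Schwartz \<subseteq> OC"
  using Schwartz_subset_OC_step OC_iff by blast

lemma fun_subspace_OC: "fun_subspace OC"
  unfolding fun_subspace_def
proof (intro conjI ballI allI)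
  show "(\<lambda>_. 0) \<in> OC" using fun_subspaceD(1)[OF fun_subspace_OC_step] OC_iff by blast
next
  fix f g assume "f \<in> OC" "g \<in> OC"
  then obtain n k where "f \<in> OC_step n" "g \<in> OC_step k" using OC_iff by blast
  then have "f \<in> OC_step (max n k)" "g \<in> OC_step (max n k)"
    by (auto intro: OC_step_mono(1)[rotated])
  then show "(\<lambda>x. f x + g x) \<in> OC" using fun_subspaceD(2)[OF fun_subspace_OC_step] OC_iff by blast
next
  fix c f assume "f \<in> OC"
  then show "(\<lambda>x. c * f x) \<in> OC" using fun_subspaceD(3)[OF fun_subspace_OC_step] OC_iff by blast
qed

section \<open>The inductive limit topology\<close>

abbreviation OC_seminorms :: "((real \<Rightarrow> complex) \<Rightarrow> real) set" where
  "OC_seminorms \<equiv>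
     {p. seminorm_on OC p \<and> (\<forall>n\<ge>1. continuous_map (OC_step_top n) euclideanreal p)}"

lemma lc_space_OC: "lc_space OC OC_seminorms"
  by unfold_locales (auto simp: fun_subspace_OC)

text \<open>The norms of a step increase with \<open>m\<close>, so continuity of a seminorm there
  amounts to an estimate by a single norm.\<close>

lemma OC_seminorms_iff:
  "p \<in> OC_seminorms \<longleftrightarrow> seminorm_on OC p \<and>
     (\<forall>n\<ge>1. \<exists>m C. 0 \<le> C \<and> (\<forall>f\<in>OC_step n. p f \<le> C * OC_norm m n f))"
proof -
  have "continuous_map (OC_step_top n) euclideanreal p \<longleftrightarrow>
      (\<exists>m C. 0 \<le> C \<and> (\<forall>f\<in>OC_step n. p f \<le> C * OC_norm m n f))"
    if p: "seminorm_on OC p" and n: "1 \<le> n" for n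
  proof -
    interpret step: lc_space "OC_step n" "{OC_norm m n | m. 1 \<le> m}" by (rule lc_space_OC_step)
    \<comment> \<open>The shift by one writes the norms with \<open>m \<ge> 1\<close> as a sequence
      over all natural numbers, the form that \<open>dominated_chain\<close> takes.\<close>
    have eq: "{OC_norm m n | m. 1 \<le> m} = range (\<lambda>m. OC_norm (Suc m) n)"
      by (auto simp: image_iff) (metis Suc_le_D)
    have "continuous_map (OC_step_top n) euclideanreal p \<longleftrightarrow>
        dominated (OC_step n) {OC_norm m n | m. 1 \<le> m} {p}"
      unfolding OC_step_top_def
      by (rule step.continuous_seminorm_iff[OF seminorm_on_subset[OF p OC_step_subset_OC[OF n]]])
    also have "\<dots> \<longleftrightarrow> (\<exists>m C. 0 \<le> C \<and> (\<forall>f\<in>OC_step n. p f \<le> C * OC_norm m n f))"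
    proof
      assume "dominated (OC_step n) {OC_norm m n | m. 1 \<le> m} {p}"
      then have "\<exists>m C. 0 \<le> C \<and> (\<forall>r\<in>{p}. \<forall>f\<in>OC_step n. r f \<le> C * OC_norm (Suc m) n f)"
        unfolding eq by (rule dominated_chain) (auto intro: OC_norm_mono OC_norm_nonneg)
      then show "\<exists>m C. 0 \<le> C \<and> (\<forall>f\<in>OC_step n. p f \<le> C * OC_norm m n f)" by blast
    next
      assume "\<exists>m C. 0 \<le> C \<and> (\<forall>f\<in>OC_step n. p f \<le> C * OC_norm m n f)"
      then obtain m C where C: "0 \<le> C" "\<And>f. f \<in> OC_step n \<Longrightarrow> p f \<le> C * OC_norm m n f" by blast
      have "p f \<le> C * OC_norm (Suc m) n f" if f: "f \<in> OC_step n" for f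
        using C(2)[OF f] mult_left_mono[OF OC_norm_mono[OF f, of m "Suc m"] C(1)] by simp
      then show "dominated (OC_step n) {OC_norm m n | m. 1 \<le> m} {p}"
        unfolding dominated_def eq using C(1)
        by (intro exI[of _ "{OC_norm (Suc m) n}"] exI[of _ C]) auto
    qed
    finally show ?thesis .
  qed
  then show ?thesis by blast
qed

text \<open>No explicit generating seminorms of \<open>OC_top\<close> are at hand. From right to
  left, the pointwise supremum of \<open>R\<close> is a seminorm, continuous on each step by the
  uniform bounds, hence itself a generating seminorm, and it dominates every member of
  \<open>R\<close>.\<close>

lemma dominated_OC_iff:
  assumes R: "\<And>r. r \<in> R \<Longrightarrow> seminorm_on OC r"
  shows "dominated OC OC_seminorms R \<longleftrightarrow>
     (\<forall>n\<ge>1. \<exists>m C. 0 \<le> C \<and> (\<forall>r\<in>R. \<forall>f\<in>OC_step n. r f \<le> C * OC_norm m n f))"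
proof (intro iffI allI impI)
  fix n :: nat assume dom: "dominated OC OC_seminorms R" and n: "1 \<le> n"
  from dom obtain F C where F: "finite F" "F \<subseteq> OC_seminorms" "0 \<le> C"
    and le: "\<forall>r\<in>R. \<forall>f\<in>OC. r f \<le> C * (\<Sum>p\<in>F. p f)"
    unfolding dominated_def by (elim exE conjE)
  have "\<exists>m C. 0 \<le> C \<and> (\<forall>f\<in>OC_step n. (\<Sum>p\<in>F. p f) \<le> C * OC_norm m n f)"
    using F(1,2)
  proof (induction F)
    case empty
    then show ?case by (intro exI[of _ 0]) simp
  next
    case (insert p F)
    then obtain m C where mC: "0 \<le> C" "\<And>f. f \<in> OC_step n \<Longrightarrow> (\<Sum>p\<in>F. p f) \<le> C * OC_norm m n f"
      by auto
    have "p \<in> OC_seminorms" using insert.prems by blast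
    then obtain k D where kD: "0 \<le> D" "\<And>f. f \<in> OC_step n \<Longrightarrow> p f \<le> D * OC_norm k n f"
      unfolding OC_seminorms_iff using n by blast
    have "(\<Sum>p\<in>insert p F. p f) \<le> (D + C) * OC_norm (max m k) n f" if f: "f \<in> OC_step n" for f
      using mC(2)[OF f] kD(2)[OF f] insert.hyps
        mult_left_mono[OF OC_norm_mono[OF f, of m "max m k"] mC(1)]
        mult_left_mono[OF OC_norm_mono[OF f, of k "max m k"] kD(1)]
      by (simp add: algebra_simps)
    then show ?case using mC(1) kD(1) by (metis add_nonneg_nonneg)
  qed
  then obtain m D where D: "0 \<le> D" "\<And>f. f \<in> OC_step n \<Longrightarrow> (\<Sum>p\<in>F. p f) \<le> D * OC_norm m n f"
    by blast
  have "r f \<le> (C * D) * OC_norm m n f" if "r \<in> R" "f \<in> OC_step n" for r f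
  proof -
    have "f \<in> OC" using OC_step_subset_OC[OF n] that(2) by blast
    then have "r f \<le> C * (\<Sum>p\<in>F. p f)" using le that(1) by blast
    then show ?thesis using mult_left_mono[OF D(2)[OF that(2)] F(3)] by (simp add: mult.assoc)
  qed
  then show "\<exists>m C. 0 \<le> C \<and> (\<forall>r\<in>R. \<forall>f\<in>OC_step n. r f \<le> C * OC_norm m n f)"
    using D(1) F(3) by (metis mult_nonneg_nonneg)
next
  assume *: "\<forall>n\<ge>1. \<exists>m C. 0 \<le> C \<and> (\<forall>r\<in>R. \<forall>f\<in>OC_step n. r f \<le> C * OC_norm m n f)"
  show "dominated OC OC_seminorms R"
  proof (cases "R = {}")
    case True
    then show ?thesis unfolding dominated_def by (intro exI[of _ "{}"] exI[of _ 0]) auto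
  next
    case False
    define p where "p = (\<lambda>f. SUP r\<in>R. r f)"
    have bdd: "bdd_above ((\<lambda>r. r f) ` R)" if "f \<in> OC" for f
    proof -
      obtain n where n: "1 \<le> n" "f \<in> OC_step n" using OC_stepE[OF \<open>f \<in> OC\<close>] .
      then obtain m C where "\<And>r. r \<in> R \<Longrightarrow> r f \<le> C * OC_norm m n f" using * by blast
      then show ?thesis by (intro bdd_aboveI2)
    qed
    have "seminorm_on OC p"
      unfolding p_def by (rule seminorm_on_SUP[OF False R bdd])
    moreover have "\<exists>m C. 0 \<le> C \<and> (\<forall>f\<in>OC_step n. p f \<le> C * OC_norm m n f)" if n: "1 \<le> n" for n
    proof -
      obtain m C where "0 \<le> C" "\<And>r f. r \<in> R \<Longrightarrow> f \<in> OC_step n \<Longrightarrow> r f \<le> C * OC_norm m n f"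
        using * n by blast
      then show ?thesis unfolding p_def
        by (intro exI[of _ m] exI[of _ C]) (auto intro!: cSUP_least[OF False])
    qed
    ultimately have p: "p \<in> OC_seminorms" unfolding OC_seminorms_iff by blast
    have "r f \<le> 1 * (\<Sum>q\<in>{p}. q f)" if "r \<in> R" "f \<in> OC" for r f
      using cSUP_upper[OF that(1) bdd[OF that(2)]] by (simp add: p_def)
    then show ?thesis
      unfolding dominated_def using p by (intro exI[of _ "{p}"] exI[of _ 1]) auto
  qed
qed

section \<open>Convolution operators\<close>

definition step_bound :: "((real \<Rightarrow> complex) \<Rightarrow> complex) \<Rightarrow> nat \<Rightarrow> nat \<Rightarrow> real \<Rightarrow> bool" where
  "step_bound U n m C \<longleftrightarrow> 0 \<le> C \<and> (\<forall>f\<in>OC_step n. norm (U f) \<le> C * OC_norm m n f)"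

text \<open>Leaves out the convention of vanishing outside \<open>OC\<close>, which is violated for
  instance by \<open>conv_iter T 0\<close>, the evaluation at the origin.\<close>

definition OC_functional :: "((real \<Rightarrow> complex) \<Rightarrow> complex) \<Rightarrow> bool" where
  "OC_functional U \<longleftrightarrow> linear_form_on OC U \<and> (\<forall>n\<ge>1. \<exists>m C. step_bound U n m C)"

lemma dual_space_OC_iff:
  "U \<in> dual_space OC_top \<longleftrightarrow> OC_functional U \<and> (\<forall>f. f \<notin> OC \<longrightarrow> U f = 0)"
proof -
  interpret lc_space OC OC_seminorms by (rule lc_space_OC)
  have "linear_form_on OC U \<Longrightarrow> dominated OC OC_seminorms {\<lambda>f. norm (U f)} \<longleftrightarrow>
      (\<forall>n\<ge>1. \<exists>m C. step_bound U n m C)"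
    unfolding step_bound_def
    by (subst dominated_OC_iff) (auto intro: seminorm_on_norm)
  then show ?thesis unfolding OC_top_def dual_space_iff OC_functional_def by blast
qed

text \<open>Translation and reflection are treated together. Peetre's inequality moves the weight
  from \<open>a + s * y\<close> to \<open>y\<close> at the price \<open>(1 + a^2)^n\<close>, exactly
  the growth that step \<open>n\<close> permits; this is why convolution preserves each
  step.\<close>

lemma
  assumes f: "f \<in> OC_step n" and s: "\<bar>s\<bar> = 1"
  shows OC_step_affine: "(\<lambda>y. f (a + s * y)) \<in> OC_step n"
    and OC_norm_affine_le: "OC_norm m n (\<lambda>y. f (a + s * y)) \<le> 2 ^ n * (1 + a\<^sup>2) ^ n * OC_norm m n f"
proof -
  have s2: "(s * y)\<^sup>2 = y\<^sup>2" for y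
    using s by (metis abs_mult mult_1 power2_abs)
  have le: "norm (nth_deriv i (\<lambda>y. f (a + s * y)) y)
      \<le> (2 ^ n * (1 + a\<^sup>2) ^ n * OC_norm k n f) * (1 + y\<^sup>2) ^ n" if "i \<le> k" for i k y
  proof -
    have "norm (nth_deriv i (\<lambda>y. f (a + s * y)) y) = norm (nth_deriv i f (a + s * y))"
      using s by (simp add: nth_deriv_affine[OF OC_step_smooth[OF f]] norm_mult power_abs del: of_real_power)
    also have "\<dots> \<le> OC_norm k n f * (1 + (a + s * y)\<^sup>2) ^ n"
      by (rule norm_nth_deriv_le_OC_norm[OF f that])
    also have "\<dots> \<le> OC_norm k n f * (2 ^ n * (1 + a\<^sup>2) ^ n * (1 + (s * y)\<^sup>2) ^ n)"
      by (intro mult_left_mono peetre_power_le OC_norm_nonneg f)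
    finally show ?thesis by (simp add: s2 mult_ac)
  qed
  show *: "(\<lambda>y. f (a + s * y)) \<in> OC_step n"
    unfolding OC_step_iff using smooth_affine[OF OC_step_smooth[OF f]] le[OF order_refl] by blast
  show "OC_norm m n (\<lambda>y. f (a + s * y)) \<le> 2 ^ n * (1 + a\<^sup>2) ^ n * OC_norm m n f"
    unfolding OC_norm_le_iff[OF *] using le by blast
qed

lemma
  assumes f: "f \<in> OC_step n"
  shows OC_step_translate: "(\<lambda>y. f (x - y)) \<in> OC_step n"
    and OC_norm_translate_le: "OC_norm m n (\<lambda>y. f (x - y)) \<le> 2 ^ n * (1 + x\<^sup>2) ^ n * OC_norm m n f"
  using OC_step_affine[OF f, of "-1" x] OC_norm_affine_le[OF f, of "-1" m x] by simp_all

lemma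
  assumes f: "f \<in> OC_step n"
  shows OC_step_reflect: "(\<lambda>y. f (- y)) \<in> OC_step n"
    and OC_norm_reflect: "OC_norm m n (\<lambda>y. f (- y)) = OC_norm m n f"
proof -
  have le: "(\<lambda>y. f (- y)) \<in> OC_step n \<and> OC_norm m n (\<lambda>y. f (- y)) \<le> OC_norm m n f"
    if f: "f \<in> OC_step n" for f
  proof
    show *: "(\<lambda>y. f (- y)) \<in> OC_step n" using OC_step_translate[OF f, of 0] by simp
    have "norm (nth_deriv i (\<lambda>y. f (- y)) x) = norm (nth_deriv i f (- x))" for i x
      using nth_deriv_affine[OF OC_step_smooth[OF f], of i 0 "-1"] by (simp add: norm_mult norm_power)
    then show "OC_norm m n (\<lambda>y. f (- y)) \<le> OC_norm m n f"
      unfolding OC_norm_le_iff[OF *] using norm_nth_deriv_le_OC_norm[OF f, of _ m "- x" for x] by simp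
  qed
  show "(\<lambda>y. f (- y)) \<in> OC_step n" using le[OF f] by blast
  show "OC_norm m n (\<lambda>y. f (- y)) = OC_norm m n f"
    using le[OF f] le[of "\<lambda>y. f (- y)"] by force
qed

lemma
  assumes f: "f \<in> OC_step n"
  shows OC_step_nth_deriv: "nth_deriv j f \<in> OC_step n"
    and OC_norm_nth_deriv_le: "OC_norm m n (nth_deriv j f) \<le> OC_norm (m + j) n f"
proof -
  have le: "norm (nth_deriv i (nth_deriv j f) y) \<le> OC_norm (k + j) n f * (1 + y\<^sup>2) ^ n" if "i \<le> k" for i k y
    using norm_nth_deriv_le_OC_norm[OF f, of "i + j" "k + j" y] that by (simp add: nth_deriv_nth_deriv)
  show *: "nth_deriv j f \<in> OC_step n"
    unfolding OC_step_iff using smooth_nth_deriv[OF OC_step_smooth[OF f]] le[OF order_refl] by blast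
  show "OC_norm m n (nth_deriv j f) \<le> OC_norm (m + j) n f"
    unfolding OC_norm_le_iff[OF *] using le by blast
qed

lemma OC_translate: "f \<in> OC \<Longrightarrow> (\<lambda>y. f (x - y)) \<in> OC"
  and OC_reflect: "f \<in> OC \<Longrightarrow> (\<lambda>y. f (- y)) \<in> OC"
  using OC_step_translate OC_step_reflect unfolding OC_iff by blast+

lemma has_vector_derivative_of_quadratic_error:
  fixes F :: "real \<Rightarrow> 'a :: real_normed_vector"
  assumes "\<And>h. \<bar>h\<bar> \<le> 1 \<Longrightarrow> norm (F (x + h) - F x - h *\<^sub>R L) \<le> K * h\<^sup>2"
  shows "(F has_vector_derivative L) (at x)"
  unfolding has_vector_derivative_def has_derivative_at_alt
proof (intro conjI allI impI)
  show "bounded_linear (\<lambda>h. h *\<^sub>R L)" by (rule bounded_linear_scaleR_left)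
  fix e :: real assume e: "0 < e"
  let ?d = "min 1 (e / (\<bar>K\<bar> + 1))"
  have "norm (F y - F x - (y - x) *\<^sub>R L) \<le> e * norm (y - x)" if y: "norm (y - x) < ?d" for y
  proof -
    have "norm (F (x + (y - x)) - F x - (y - x) *\<^sub>R L) \<le> K * (y - x)\<^sup>2"
      using y by (intro assms) auto
    also have "\<dots> \<le> (\<bar>K\<bar> + 1) * (y - x)\<^sup>2" by (intro mult_right_mono) auto
    also have "\<dots> = ((\<bar>K\<bar> + 1) * \<bar>y - x\<bar>) * \<bar>y - x\<bar>" by (simp add: power2_eq_square mult.assoc)
    also have "\<dots> \<le> e * \<bar>y - x\<bar>"
      using y by (intro mult_right_mono) (auto simp: field_simps)
    finally show ?thesis by simp
  qed
  then show "\<exists>d>0. \<forall>y. norm (y - x) < d \<longrightarrow> norm (F y - F x - (y - x) *\<^sub>R L) \<le> e * norm (y - x)"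
    using e by (intro exI[of _ ?d]) auto
qed

text \<open>The mean value inequality is applied first to the derivative and then to the function,
  which yields the remainder without the factor 1/2.\<close>

lemma smooth_taylor_le:
  assumes f: "smooth f" and M: "\<And>\<xi>. \<bar>\<xi> - z\<bar> \<le> \<bar>h\<bar> \<Longrightarrow> norm (nth_deriv 2 f \<xi>) \<le> M"
  shows "norm (f (z + h) - f z - of_real h * nth_deriv 1 f z) \<le> M * h\<^sup>2"
proof -
  let ?S = "closed_segment z (z + h)"
  have S: "\<bar>\<xi> - z\<bar> \<le> \<bar>h\<bar>" if "\<xi> \<in> ?S" for \<xi>
    using segment_bound1[OF that] by (simp add: norm_minus_commute)
  have M0: "0 \<le> M" using order_trans[OF norm_ge_zero M, of z] by simp
  have d: "(nth_deriv i f has_vector_derivative nth_deriv (Suc i) f \<xi>) (at \<xi> within ?S)" for i \<xi>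
    using smooth_has_derivative[OF f] has_vector_derivative_at_within by blast
  have diff: "norm (nth_deriv 1 f \<xi> - nth_deriv 1 f z) \<le> M * \<bar>h\<bar>" if \<xi>: "\<xi> \<in> ?S" for \<xi>
  proof -
    have "norm (nth_deriv 1 f \<xi> - nth_deriv 1 f z) \<le> M * norm (\<xi> - z)"
    proof (rule differentiable_bound[of ?S])
      show "(nth_deriv 1 f has_derivative (\<lambda>h. h *\<^sub>R nth_deriv 2 f t)) (at t within ?S)" for t
        using d[of 1 t] by (simp add: has_vector_derivative_def numeral_2_eq_2)
      show "onorm (\<lambda>h. h *\<^sub>R nth_deriv 2 f t) \<le> M" if "t \<in> ?S" for t
        using mult_right_mono[OF M[OF S[OF that]] abs_ge_zero]
        by (intro onorm_le) (simp add: mult.commute)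
    qed (use \<xi> in auto)
    also have "\<dots> \<le> M * \<bar>h\<bar>" using S[OF \<xi>] M0 by (simp add: mult_left_mono)
    finally show ?thesis .
  qed
  have "norm (nth_deriv 0 f (z + h) - nth_deriv 0 f z - (z + h - z) *\<^sub>R nth_deriv 1 f z)
      \<le> norm (z + h - z) * (M * \<bar>h\<bar>)"
    by (rule vector_differentiable_bound_linearization[of ?S])
       (use d[of 0] diff in auto)
  then show ?thesis by (simp add: scaleR_conv_of_real power2_eq_square mult_ac)
qed

text \<open>The Taylor remainder \<open>w\<close> of \<open>f\<close> with increment
  \<open>h\<close> is of size \<open>h^2\<close> in every norm of step \<open>n\<close>, not merely
  pointwise. \<open>U\<close> is bounded by one of these norms, and translating the argument to
  \<open>x\<close> costs only a constant.\<close>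

lemma conv_fun_has_vector_derivative:
  assumes U: "OC_functional U" and f: "f \<in> OC"
  shows "(conv_fun U f has_vector_derivative conv_fun U (nth_deriv 1 f) x) (at x)"
proof -
  obtain n where n: "1 \<le> n" "f \<in> OC_step n" using OC_stepE[OF f] .
  obtain m C where mC: "0 \<le> C" "\<And>f. f \<in> OC_step n \<Longrightarrow> norm (U f) \<le> C * OC_norm m n f"
    using U n(1) unfolding OC_functional_def step_bound_def by blast
  have lin: "linear_form_on OC U" using U OC_functional_def by blast
  have sm: "smooth f" by (rule OC_smooth[OF f])
  \<comment> \<open>Two derivatives are spent on the Taylor remainder. One factor
    \<open>2 ^ n\<close> comes from Peetre's inequality, the other bounds the weight of the
    displacement, which is at most 1.\<close>
  define K where "K = OC_norm (m + 2) n f * (2 ^ n * 2 ^ n)"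
  show ?thesis
  proof (rule has_vector_derivative_of_quadratic_error)
    fix h :: real assume h: "\<bar>h\<bar> \<le> 1"
    define w where "w = (\<lambda>z. f (z + h) - f z - of_real h * nth_deriv 1 f z)"
    have sh: "smooth (\<lambda>z. f (z + h))" using smooth_affine[OF sm, of h 1] by (simp add: add.commute)
    have dh: "nth_deriv i (\<lambda>z. f (z + h)) = (\<lambda>z. nth_deriv i f (z + h))" for i
      using nth_deriv_affine[OF sm, of i h 1] by (simp add: add.commute)
    have sw: "smooth w" unfolding w_def
      by (intro smooth_diff sh sm smooth_cmult smooth_nth_deriv)
    have dw: "nth_deriv i w = (\<lambda>z. nth_deriv i f (z + h) - nth_deriv i f z - of_real h * nth_deriv (i + 1) f z)" for i
      unfolding w_def
      by (simp add: nth_deriv_diff nth_deriv_cmult dh sh sm smooth_diff smooth_cmult smooth_nth_deriv nth_deriv_nth_deriv)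
    have le: "norm (nth_deriv i w z) \<le> ((OC_norm (k + 2) n f * (2 ^ n * 2 ^ n)) * h\<^sup>2) * (1 + z\<^sup>2) ^ n" if "i \<le> k" for i k z
    proof -
      let ?N = "OC_norm (k + 2) n f"
      have "norm (nth_deriv i f (z + h) - nth_deriv i f z - of_real h * nth_deriv 1 (nth_deriv i f) z)
          \<le> (?N * (2 ^ n * 2 ^ n) * (1 + z\<^sup>2) ^ n) * h\<^sup>2"
      proof (rule smooth_taylor_le[OF smooth_nth_deriv[OF sm]])
        fix \<xi> assume \<xi>: "\<bar>\<xi> - z\<bar> \<le> \<bar>h\<bar>"
        have "norm (nth_deriv 2 (nth_deriv i f) \<xi>) \<le> ?N * (1 + (z + (\<xi> - z))\<^sup>2) ^ n"
          using norm_nth_deriv_le_OC_norm[OF n(2), of "2 + i" "k + 2" \<xi>] that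
          by (simp add: nth_deriv_nth_deriv)
        also have "\<dots> \<le> ?N * (2 ^ n * (1 + z\<^sup>2) ^ n * (1 + (\<xi> - z)\<^sup>2) ^ n)"
          by (intro mult_left_mono peetre_power_le OC_norm_nonneg n)
        also have "\<dots> \<le> ?N * (2 ^ n * (1 + z\<^sup>2) ^ n * 2 ^ n)"
        proof (intro mult_left_mono power_mono)
          have "(\<xi> - z)\<^sup>2 \<le> 1" using \<xi> h by (simp add: abs_square_le_1)
          then show "1 + (\<xi> - z)\<^sup>2 \<le> 2" by simp
        qed (use OC_norm_nonneg[OF n(2)] in auto)
        finally show "norm (nth_deriv 2 (nth_deriv i f) \<xi>) \<le> ?N * (2 ^ n * 2 ^ n) * (1 + z\<^sup>2) ^ n"
          by (simp add: mult_ac)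
      qed
      then show ?thesis by (simp add: dw nth_deriv_nth_deriv mult_ac)
    qed
    have w: "w \<in> OC_step n" unfolding OC_step_iff using sw le[OF order_refl] by blast
    have wn: "OC_norm m n w \<le> K * h\<^sup>2" unfolding OC_norm_le_iff[OF w] K_def using le by blast
    have mem: "(\<lambda>y. g (x - y)) \<in> OC" if "g \<in> OC_step n" for g x
      using OC_step_translate[OF that] OC_step_subset_OC[OF n(1)] by blast
    have "(\<lambda>y. w (x - y)) = (\<lambda>y. (f (x + h - y) - f (x - y)) - of_real h * nth_deriv 1 f (x - y))"
      by (auto simp: w_def algebra_simps)
    then have "U (\<lambda>y. w (x - y)) = U (\<lambda>y. f (x + h - y)) - U (\<lambda>y. f (x - y)) - of_real h * U (\<lambda>y. nth_deriv 1 f (x - y))"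
      using mem[OF n(2)] mem[OF OC_step_nth_deriv[OF n(2)]]
      by (simp add: linear_form_on_diff[OF fun_subspace_OC lin] fun_subspaceD[OF fun_subspace_OC] linear_form_onD(2)[OF lin])
    then have "norm (conv_fun U f (x + h) - conv_fun U f x - h *\<^sub>R conv_fun U (nth_deriv 1 f) x) = norm (U (\<lambda>y. w (x - y)))"
      by (simp add: conv_fun_def scaleR_conv_of_real)
    also have "\<dots> \<le> C * OC_norm m n (\<lambda>y. w (x - y))"
      by (rule mC(2)[OF OC_step_translate[OF w]])
    also have "\<dots> \<le> C * (2 ^ n * (1 + x\<^sup>2) ^ n * (K * h\<^sup>2))"
      by (intro mult_left_mono mC order_trans[OF OC_norm_translate_le[OF w]] wn) auto
    finally show "norm (conv_fun U f (x + h) - conv_fun U f x - h *\<^sub>R conv_fun U (nth_deriv 1 f) x)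
        \<le> (C * (2 ^ n * (1 + x\<^sup>2) ^ n * K)) * h\<^sup>2" by (simp add: mult_ac)
  qed
qed

lemma
  assumes U: "OC_functional U" and f: "f \<in> OC"
  shows nth_deriv_conv_fun: "nth_deriv i (conv_fun U f) = conv_fun U (nth_deriv i f)"
    and smooth_conv_fun: "smooth (conv_fun U f)"
proof -
  let ?F = "\<lambda>i. conv_fun U (nth_deriv i f)"
  have d: "(?F i has_vector_derivative ?F (Suc i) x) (at x)" for i x
  proof -
    have "nth_deriv i f \<in> OC" using f OC_step_nth_deriv unfolding OC_iff by blast
    from conv_fun_has_vector_derivative[OF U this, of x] show ?thesis
      by (simp add: nth_deriv_nth_deriv)
  qed
  show "nth_deriv i (conv_fun U f) = ?F i" using nth_deriv_unique(1)[of ?F i, OF d] by simp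
  show "smooth (conv_fun U f)" using nth_deriv_unique(2)[of ?F, OF d] by simp
qed

text \<open>Derivatives fall on \<open>f\<close>, and the weight produced by translation is the
  growth allowed in step \<open>n\<close>. The loss is \<open>m\<close> derivatives and no growth;
  \<open>m\<close> and \<open>C\<close> enter only through the bound on \<open>U\<close>, so
  estimates uniform over functionals pass to the operators.\<close>

lemma
  assumes U: "OC_functional U" and b: "step_bound U n m C" and n: "1 \<le> n" and f: "f \<in> OC_step n"
  shows conv_fun_OC_step: "conv_fun U f \<in> OC_step n"
    and OC_norm_conv_fun_le: "OC_norm l n (conv_fun U f) \<le> C * 2 ^ n * OC_norm (m + l) n f"
proof -
  have fO: "f \<in> OC" using f OC_iff by blast
  have C: "0 \<le> C" "\<And>f. f \<in> OC_step n \<Longrightarrow> norm (U f) \<le> C * OC_norm m n f"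
    using b by (auto simp: step_bound_def)
  have le: "norm (nth_deriv i (conv_fun U f) x) \<le> (C * 2 ^ n * OC_norm (m + l) n f) * (1 + x\<^sup>2) ^ n"
    if "i \<le> l" for i l x
  proof -
    have fi: "nth_deriv i f \<in> OC_step n" by (rule OC_step_nth_deriv[OF f])
    have "norm (nth_deriv i (conv_fun U f) x) = norm (U (\<lambda>y. nth_deriv i f (x - y)))"
      unfolding nth_deriv_conv_fun[OF U fO] by (simp add: conv_fun_def)
    also have "\<dots> \<le> C * OC_norm m n (\<lambda>y. nth_deriv i f (x - y))"
      by (rule C(2)[OF OC_step_translate[OF fi]])
    also have "\<dots> \<le> C * (2 ^ n * (1 + x\<^sup>2) ^ n * OC_norm m n (nth_deriv i f))"
      by (rule mult_left_mono[OF OC_norm_translate_le[OF fi] C(1)])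
    also have "\<dots> \<le> C * (2 ^ n * (1 + x\<^sup>2) ^ n * OC_norm (m + l) n f)"
      using order_trans[OF OC_norm_nth_deriv_le[OF f, of m i] OC_norm_mono[OF f, of "m + i" "m + l"]] that C(1)
      by (intro mult_left_mono) auto
    finally show ?thesis by (simp add: mult_ac)
  qed
  show *: "conv_fun U f \<in> OC_step n"
    unfolding OC_step_iff using smooth_conv_fun[OF U fO] le[OF order_refl] by blast
  show "OC_norm l n (conv_fun U f) \<le> C * 2 ^ n * OC_norm (m + l) n f"
    unfolding OC_norm_le_iff[OF *] using le by blast
qed

text \<open>Decay of order \<open>n\<close> comes from continuity of \<open>U\<close> on the step of
  growth \<open>n\<close>: there the translate of a Schwartz function to \<open>x\<close> has norm
  of order \<open>(1 + x^2)^(-n)\<close>.\<close>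

lemma weighted_conv_fun_le:
  assumes U: "OC_functional U" and b: "step_bound U n m C" and i: "i \<le> n" and f: "f \<in> Schwartz"
  shows "(1 + x\<^sup>2) ^ n * norm (nth_deriv i (conv_fun U f) x) \<le> C * 2 ^ n * schwartz_norm (n + m) f"
proof -
  let ?S = "schwartz_norm (n + m) f"
  have fO: "f \<in> OC" using f Schwartz_subset_OC by blast
  have fn: "nth_deriv i f \<in> OC_step n"
    using OC_step_nth_deriv f Schwartz_subset_OC_step by blast
  have C: "0 \<le> C" "\<And>f. f \<in> OC_step n \<Longrightarrow> norm (U f) \<le> C * OC_norm m n f"
    using b by (auto simp: step_bound_def)
  have "OC_norm m n (\<lambda>y. nth_deriv i f (x - y)) \<le> 2 ^ n * ?S / (1 + x\<^sup>2) ^ n"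
    unfolding OC_norm_le_iff[OF OC_step_translate[OF fn]]
  proof (intro allI impI)
    fix k y assume k: "k \<le> m"
    have sm: "smooth (nth_deriv i f)" by (rule smooth_nth_deriv[OF Schwartz_smooth[OF f]])
    have "norm (nth_deriv k (\<lambda>y. nth_deriv i f (x - y)) y) = norm (nth_deriv (k + i) f (x - y))" (is "_ = ?d")
      using nth_deriv_affine[OF sm, of k x "-1"] by (simp add: norm_mult norm_power nth_deriv_nth_deriv)
    \<comment> \<open>Peetre's inequality for \<open>x = (x - y) + y\<close>: the weight at
      \<open>x - y\<close> is absorbed by the Schwartz norm of \<open>f\<close>, the weight at
      \<open>y\<close> by the norm of the step.\<close>
    have "(1 + x\<^sup>2) ^ n * ?d \<le> (2 ^ n * (1 + (x - y)\<^sup>2) ^ n * (1 + y\<^sup>2) ^ n) * ?d"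
      using peetre_power_le[of "x - y" y n] by (intro mult_right_mono) auto
    also have "\<dots> = (2 ^ n * (1 + y\<^sup>2) ^ n) * ((1 + (x - y)\<^sup>2) ^ n * ?d)" by (simp add: mult_ac)
    also have "\<dots> \<le> (2 ^ n * (1 + y\<^sup>2) ^ n) * ?S"
      using k i by (intro mult_left_mono nth_deriv_le_schwartz_norm' f) auto
    finally have "?d \<le> 2 ^ n * ?S / (1 + x\<^sup>2) ^ n * (1 + y\<^sup>2) ^ n"
      using weight_pos[of x n] by (simp add: pos_le_divide_eq mult_ac)
    then show "norm (nth_deriv k (\<lambda>y. nth_deriv i f (x - y)) y) \<le> 2 ^ n * ?S / (1 + x\<^sup>2) ^ n * (1 + y\<^sup>2) ^ n"
      using \<open>_ = ?d\<close> by simp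
  qed
  then have "C * OC_norm m n (\<lambda>y. nth_deriv i f (x - y)) \<le> C * (2 ^ n * ?S / (1 + x\<^sup>2) ^ n)"
    by (rule mult_left_mono[OF _ C(1)])
  moreover have "norm (nth_deriv i (conv_fun U f) x) \<le> C * OC_norm m n (\<lambda>y. nth_deriv i f (x - y))"
    unfolding nth_deriv_conv_fun[OF U fO] using C(2)[OF OC_step_translate[OF fn]] by (simp add: conv_fun_def)
  ultimately have "norm (nth_deriv i (conv_fun U f) x) \<le> C * (2 ^ n * ?S / (1 + x\<^sup>2) ^ n)" by linarith
  then show ?thesis using weight_pos[of x n] by (simp add: pos_le_divide_eq mult_ac)
qed

lemma conv_fun_Schwartz:
  assumes U: "OC_functional U" and f: "f \<in> Schwartz"
  shows "conv_fun U f \<in> Schwartz"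
proof -
  have "\<exists>M. \<forall>x. (1 + x\<^sup>2) ^ n * norm (nth_deriv i (conv_fun U f) x) \<le> M" for i n
  proof -
    \<comment> \<open>At least \<open>i\<close> and \<open>n\<close> for the estimate, and at least
      1 because \<open>OC_functional\<close> gives bounds from step 1 on.\<close>
    define k where "k = Suc (i + n)"
    obtain m C where b: "step_bound U k m C" using U unfolding OC_functional_def k_def by force
    have "(1 + x\<^sup>2) ^ n * norm (nth_deriv i (conv_fun U f) x) \<le> C * 2 ^ k * schwartz_norm (k + m) f" for x
    proof -
      have "(1 + x\<^sup>2) ^ n * norm (nth_deriv i (conv_fun U f) x)
          \<le> (1 + x\<^sup>2) ^ k * norm (nth_deriv i (conv_fun U f) x)"
        by (intro mult_right_mono power_increasing) (auto simp: k_def)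
      also have "\<dots> \<le> C * 2 ^ k * schwartz_norm (k + m) f"
        by (rule weighted_conv_fun_le[OF U b _ f]) (simp add: k_def)
      finally show ?thesis .
    qed
    then show ?thesis by blast
  qed
  moreover have "smooth (conv_fun U f)" using smooth_conv_fun[OF U] f Schwartz_subset_OC by blast
  ultimately show ?thesis unfolding Schwartz_iff by blast
qed

lemma schwartz_norm_conv_fun_le:
  assumes "OC_functional U" "step_bound U n m C" "f \<in> Schwartz"
  shows "schwartz_norm n (conv_fun U f) \<le> C * 2 ^ n * schwartz_norm (n + m) f"
  unfolding schwartz_norm_le_iff[OF conv_fun_Schwartz[OF assms(1,3)]]
  using weighted_conv_fun_le[OF assms(1,2) _ assms(3)] by blast

lemma conv_fun_OC:
  assumes U: "OC_functional U" and f: "f \<in> OC" shows "conv_fun U f \<in> OC"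
proof -
  obtain n where n: "1 \<le> n" "f \<in> OC_step n" using OC_stepE[OF f] .
  moreover obtain m C where "step_bound U n m C" using U n(1) unfolding OC_functional_def by blast
  ultimately show ?thesis using conv_fun_OC_step[OF U] OC_iff by blast
qed

lemma linear_endo_conv_fun_OC:
  assumes U: "OC_functional U" shows "linear_endo OC (conv_fun U)"
proof -
  have lin: "linear_form_on OC U" using U OC_functional_def by blast
  show ?thesis
    unfolding linear_endo_def
  proof (intro conjI ballI allI)
    show "conv_fun U f \<in> OC" if "f \<in> OC" for f using conv_fun_OC[OF U that] .
    show "conv_fun U (\<lambda>x. f x + g x) = (\<lambda>x. conv_fun U f x + conv_fun U g x)"
      if "f \<in> OC" "g \<in> OC" for f g
      unfolding conv_fun_def using linear_form_onD(1)[OF lin OC_translate[OF that(1)] OC_translate[OF that(2)]]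
      by simp
    show "conv_fun U (\<lambda>x. c * f x) = (\<lambda>x. c * conv_fun U f x)" if "f \<in> OC" for f c
      unfolding conv_fun_def using linear_form_onD(2)[OF lin OC_translate[OF that]] by simp
  qed
qed

lemma linear_endo_conv_fun_Schwartz:
  assumes "OC_functional U" shows "linear_endo Schwartz (conv_fun U)"
  using linear_endo_conv_fun_OC[OF assms] conv_fun_Schwartz[OF assms] Schwartz_subset_OC
  unfolding linear_endo_def by blast

section \<open>Iterates of a convolution operator\<close>

definition conv_iter :: "((real \<Rightarrow> complex) \<Rightarrow> complex) \<Rightarrow> nat \<Rightarrow> (real \<Rightarrow> complex) \<Rightarrow> complex" where
  "conv_iter T k g = (conv_fun T ^^ k) (\<lambda>y. g (- y)) 0"

lemma conv_fun_funpow_translate: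
  "(conv_fun T ^^ k) (\<lambda>y. f (a + y)) = (\<lambda>x. (conv_fun T ^^ k) f (a + x))"
proof (induction k)
  case (Suc k)
  then show ?case by (simp add: conv_fun_def add_diff_eq)
qed simp

text \<open>On \<open>\<lambda>y. f (x - y)\<close>, \<open>conv_iter T k\<close> applies the power
  to \<open>\<lambda>y. f (x + y)\<close> and evaluates at \<open>0\<close>; commutation with
  translations makes this the value at \<open>x\<close>.\<close>

lemma conv_fun_funpow: "(conv_fun T ^^ k) f = conv_fun (conv_iter T k) f"
  by (rule ext) (simp add: conv_fun_def conv_iter_def conv_fun_funpow_translate)

lemma conv_fun_reflect_funpow:
  "(conv_fun (reflect T) ^^ k) f = (\<lambda>x. (conv_fun T ^^ k) (\<lambda>y. f (- y)) (- x))"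
  by (induction k) (simp_all add: conv_fun_def reflect_def add.commute)

lemma conv_iter_reflect: "conv_iter (reflect T) k g = conv_iter T k (\<lambda>y. g (- y))"
  by (simp add: conv_iter_def conv_fun_reflect_funpow)

text \<open>The right-hand side is what \<open>k\<close> transposed convolutions make of
  \<open>T\<close>; this links \<open>conv_iter\<close> with \<open>conv_power\<close>.\<close>

lemma conv_iter_Suc: "conv_iter T (Suc k) g = T ((conv_fun (reflect T) ^^ k) g)"
  by (simp add: conv_iter_def conv_fun_reflect_funpow) (simp add: conv_fun_def)

text \<open>The bound is obtained for each \<open>k\<close> separately and may deteriorate as
  \<open>k\<close> grows; uniformity is the content of
  \<open>iterates_equicontinuous\<close>.\<close>

lemma OC_functional_conv_iter:
  assumes T: "OC_functional T" shows "OC_functional (conv_iter T k)"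
proof -
  have lin: "linear_endo OC (conv_fun T ^^ k)"
    by (rule linear_endo_funpow[OF linear_endo_conv_fun_OC[OF T]])
  have "linear_form_on OC (conv_iter T k)"
    unfolding linear_form_on_def conv_iter_def
    by (intro conjI ballI allI)
       (simp_all add: linear_endoD(2)[OF lin OC_reflect OC_reflect] linear_endoD(3)[OF lin OC_reflect])
  moreover have "\<exists>m C. step_bound (conv_iter T k) n m C" if n: "1 \<le> n" for n
  proof -
    obtain m C where b: "step_bound T n m C" using T n unfolding OC_functional_def by blast
    have C: "0 \<le> C" using b by (simp add: step_bound_def)
    \<comment> \<open>The claim is made for every \<open>l\<close>, because each further convolution
      consumes \<open>m\<close> derivatives of its argument.\<close>
    have "\<exists>m' D. 0 \<le> D \<and> (\<forall>f\<in>OC_step n. (conv_fun T ^^ k) f \<in> OC_step n \<and>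
        OC_norm l n ((conv_fun T ^^ k) f) \<le> D * OC_norm m' n f)" for l
    proof (induction k arbitrary: l)
      case 0
      then show ?case by (intro exI[of _ l] exI[of _ 1]) auto
    next
      case (Suc k)
      obtain m' D where D: "0 \<le> D" "\<And>f. f \<in> OC_step n \<Longrightarrow> (conv_fun T ^^ k) f \<in> OC_step n \<and>
        OC_norm (m + l) n ((conv_fun T ^^ k) f) \<le> D * OC_norm m' n f"
        using Suc[of "m + l"] by blast
      have "(conv_fun T ^^ Suc k) f \<in> OC_step n \<and>
          OC_norm l n ((conv_fun T ^^ Suc k) f) \<le> (C * 2 ^ n * D) * OC_norm m' n f" if f: "f \<in> OC_step n" for f
      proof
        let ?g = "(conv_fun T ^^ k) f"
        have g: "?g \<in> OC_step n" "OC_norm (m + l) n ?g \<le> D * OC_norm m' n f" using D(2)[OF f] by auto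
        show "(conv_fun T ^^ Suc k) f \<in> OC_step n" using conv_fun_OC_step[OF T b n g(1)] by simp
        have "OC_norm l n (conv_fun T ?g) \<le> C * 2 ^ n * (D * OC_norm m' n f)"
          using OC_norm_conv_fun_le[OF T b n g(1), of l] mult_left_mono[OF g(2), of "C * 2 ^ n"] C by simp
        then show "OC_norm l n ((conv_fun T ^^ Suc k) f) \<le> (C * 2 ^ n * D) * OC_norm m' n f"
          by (simp add: mult.assoc)
      qed
      moreover have "0 \<le> C * 2 ^ n * D" using C D(1) by simp
      ultimately show ?case by blast
    qed
    then obtain m' D where D: "0 \<le> D" "\<And>f. f \<in> OC_step n \<Longrightarrow> (conv_fun T ^^ k) f \<in> OC_step n \<and>
        OC_norm 0 n ((conv_fun T ^^ k) f) \<le> D * OC_norm m' n f" by meson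
    have "norm (conv_iter T k g) \<le> D * OC_norm m' n g" if g: "g \<in> OC_step n" for g
    proof -
      have "norm (conv_iter T k g) \<le> OC_norm 0 n ((conv_fun T ^^ k) (\<lambda>y. g (- y)))"
        unfolding conv_iter_def
        using norm_nth_deriv_le_OC_norm[of "(conv_fun T ^^ k) (\<lambda>y. g (- y))" n 0 0 0]
          D(2)[OF OC_step_reflect[OF g]] by simp
      also have "\<dots> \<le> D * OC_norm m' n g"
        using D(2)[OF OC_step_reflect[OF g]] OC_norm_reflect[OF g] by simp
      finally show ?thesis .
    qed
    then show ?thesis using D(1) unfolding step_bound_def by blast
  qed
  ultimately show ?thesis unfolding OC_functional_def by blast
qed

lemma OC_functional_reflect:
  assumes "OC_functional T" shows "OC_functional (reflect T)"
proof -
  have "linear_form_on OC (reflect T)"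
    using assms OC_reflect unfolding OC_functional_def linear_form_on_def reflect_def by simp
  moreover have "step_bound (reflect T) n m C" if "step_bound T n m C" for n m C
    using that OC_step_reflect OC_norm_reflect unfolding step_bound_def reflect_def by metis
  ultimately show ?thesis using assms unfolding OC_functional_def by blast
qed

definition iterates_equicontinuous :: "((real \<Rightarrow> complex) \<Rightarrow> complex) \<Rightarrow> bool" where
  "iterates_equicontinuous T \<longleftrightarrow> (\<forall>n\<ge>1. \<exists>m C. \<forall>k\<ge>1. step_bound (conv_iter T k) n m C)"

text \<open>Transposing \<open>C_T\<close> on the duals replaces \<open>T\<close> by its reflection.
  The criterion survives because reflection is an isometry for all norms of a step.\<close>

lemma iterates_equicontinuous_reflect:
  assumes "iterates_equicontinuous T" shows "iterates_equicontinuous (reflect T)"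
  unfolding iterates_equicontinuous_def
proof (intro allI impI)
  fix n :: nat assume "1 \<le> n"
  then obtain m C where b: "\<And>k. 1 \<le> k \<Longrightarrow> step_bound (conv_iter T k) n m C"
    using assms unfolding iterates_equicontinuous_def by meson
  have "step_bound (conv_iter (reflect T) k) n m C" if "1 \<le> k" for k
    using b[OF that] OC_step_reflect OC_norm_reflect
    unfolding step_bound_def conv_iter_reflect by metis
  then show "\<exists>m C. \<forall>k\<ge>1. step_bound (conv_iter (reflect T) k) n m C" by blast
qed

lemma reflect_reflect: "reflect (reflect T) = T"
  by (simp add: reflect_def)

section \<open>Power boundedness and equicontinuity of the iterates\<close>

lemma power_bounded_Schwartz_of_iterates:
  assumes T: "OC_functional T" and eq: "iterates_equicontinuous T"
  shows "power_bounded Schwartz_top (conv_fun T)"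
proof -
  interpret lc_space Schwartz "range schwartz_norm" by (rule lc_space_Schwartz)
  have "dominated Schwartz (range schwartz_norm) {\<lambda>f. schwartz_norm n ((conv_fun T ^^ k) f) | k. 1 \<le> k}" for n
  proof -
    \<comment> \<open>\<open>Suc n\<close>, since bounds are available from step 1 on and
      \<open>n\<close> may be zero.\<close>
    obtain m C where b: "\<And>k. 1 \<le> k \<Longrightarrow> step_bound (conv_iter T k) (Suc n) m C"
      using eq unfolding iterates_equicontinuous_def by (metis le_add1 plus_1_eq_Suc)
    have C: "0 \<le> C" using b[of 1] by (simp add: step_bound_def)
    show ?thesis
    proof (rule dominatedI[of "schwartz_norm (Suc n + m)" _ "C * 2 ^ Suc n"])
      fix r f assume "r \<in> {\<lambda>f. schwartz_norm n ((conv_fun T ^^ k) f) | k. 1 \<le> k}" and f: "f \<in> Schwartz"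
      then obtain k where k: "1 \<le> k" "r = (\<lambda>f. schwartz_norm n ((conv_fun T ^^ k) f))" by blast
      note U = OC_functional_conv_iter[OF T, of k]
      have "schwartz_norm n (conv_fun (conv_iter T k) f) \<le> schwartz_norm (Suc n) (conv_fun (conv_iter T k) f)"
        by (intro schwartz_norm_mono conv_fun_Schwartz U f) simp
      also have "\<dots> \<le> C * 2 ^ Suc n * schwartz_norm (Suc n + m) f"
        by (rule schwartz_norm_conv_fun_le[OF U b[OF k(1)] f])
      finally show "r f \<le> C * 2 ^ Suc n * schwartz_norm (Suc n + m) f"
        unfolding k(2) conv_fun_funpow .
    qed (use C in auto)
  qed
  then show ?thesis
    unfolding Schwartz_top_def power_bounded_iff
    using linear_endo_conv_fun_Schwartz[OF T] by blast
qed

lemma power_bounded_OC_of_iterates: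
  assumes T: "OC_functional T" and eq: "iterates_equicontinuous T"
  shows "power_bounded OC_top (conv_fun T)"
proof -
  interpret lc_space OC OC_seminorms by (rule lc_space_OC)
  have "dominated OC OC_seminorms {\<lambda>f. p ((conv_fun T ^^ k) f) | k. 1 \<le> k}" if p: "p \<in> OC_seminorms" for p
  proof (subst dominated_OC_iff)
    fix r assume "r \<in> {\<lambda>f. p ((conv_fun T ^^ k) f) | k. 1 \<le> k}"
    then obtain k where k: "r = (\<lambda>f. p ((conv_fun T ^^ k) f))" by blast
    have lin: "linear_endo OC (conv_fun T ^^ k)"
      by (rule linear_endo_funpow[OF linear_endo_conv_fun_OC[OF T]])
    have "seminorm_on OC p" using p by blast
    then show "seminorm_on OC r"
      using linear_endoD[OF lin] unfolding k seminorm_on_def by simp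
  next
    show "\<forall>n\<ge>1. \<exists>m C. 0 \<le> C \<and> (\<forall>r\<in>{\<lambda>f. p ((conv_fun T ^^ k) f) | k. 1 \<le> k}.
        \<forall>f\<in>OC_step n. r f \<le> C * OC_norm m n f)"
    proof (intro allI impI)
      fix n :: nat assume n: "1 \<le> n"
      obtain l D where D: "0 \<le> D" "\<And>f. f \<in> OC_step n \<Longrightarrow> p f \<le> D * OC_norm l n f"
        using p n unfolding OC_seminorms_iff by blast
      obtain m C where b: "\<And>k. 1 \<le> k \<Longrightarrow> step_bound (conv_iter T k) n m C"
        using eq n unfolding iterates_equicontinuous_def by meson
      have C: "0 \<le> C" using b[of 1] by (simp add: step_bound_def)
      have "p ((conv_fun T ^^ k) f) \<le> (D * (C * 2 ^ n)) * OC_norm (m + l) n f"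
        if k: "1 \<le> k" and f: "f \<in> OC_step n" for k f
      proof -
        note U = OC_functional_conv_iter[OF T, of k]
        have "p (conv_fun (conv_iter T k) f) \<le> D * OC_norm l n (conv_fun (conv_iter T k) f)"
          by (rule D(2)[OF conv_fun_OC_step[OF U b[OF k] n f]])
        also have "\<dots> \<le> D * (C * 2 ^ n * OC_norm (m + l) n f)"
          by (rule mult_left_mono[OF OC_norm_conv_fun_le[OF U b[OF k] n f] D(1)])
        finally show ?thesis unfolding conv_fun_funpow by (simp add: mult.assoc)
      qed
      then show "\<exists>m C. 0 \<le> C \<and> (\<forall>r\<in>{\<lambda>f. p ((conv_fun T ^^ k) f) | k. 1 \<le> k}.
          \<forall>f\<in>OC_step n. r f \<le> C * OC_norm m n f)"
        using C D(1) by (intro exI[of _ "m + l"] exI[of _ "D * (C * 2 ^ n)"]) auto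
    qed
  qed
  then show ?thesis
    unfolding OC_top_def power_bounded_iff
    using linear_endo_conv_fun_OC[OF T] by blast
qed

lemma iterates_of_power_bounded_OC:
  assumes pb: "power_bounded OC_top (conv_fun T)"
  shows "iterates_equicontinuous T"
  unfolding iterates_equicontinuous_def
proof (intro allI impI)
  fix n :: nat assume n: "1 \<le> n"
  interpret lc_space OC OC_seminorms by (rule lc_space_OC)
  let ?p = "\<lambda>f :: real \<Rightarrow> complex. norm (f 0)"
  let ?R = "{\<lambda>f. ?p ((conv_fun T ^^ k) f) | k. 1 \<le> k}"
  \<comment> \<open>The weight is 1 at the origin, so evaluation there is bounded by the order-zero
    norm of every step, and its modulus is a generating seminorm.\<close>
  have "?p f \<le> 1 * OC_norm 0 n f" if "f \<in> OC_step n" for f n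
    using norm_nth_deriv_le_OC_norm[OF that, of 0 0 0] by simp
  moreover have "seminorm_on OC ?p"
    by (rule seminorm_on_norm) (simp add: linear_form_on_def)
  ultimately have p: "?p \<in> OC_seminorms" unfolding OC_seminorms_iff by (meson zero_le_one)
  have lin: "linear_endo OC (conv_fun T)"
    and dom: "dominated OC OC_seminorms ?R"
    using pb[unfolded OC_top_def power_bounded_iff]
    by (blast, intro bspec[OF conjunct2[OF pb[unfolded OC_top_def power_bounded_iff]] p])
  have R: "seminorm_on OC r" if r: "r \<in> ?R" for r
  proof -
    obtain k where k: "r = (\<lambda>f. norm ((conv_fun T ^^ k) f 0))" using r by blast
    show ?thesis
      unfolding k using linear_endoD[OF linear_endo_funpow[OF lin, of k]]
      by (intro seminorm_on_norm) (simp add: linear_form_on_def)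
  qed
  have "\<forall>n\<ge>1. \<exists>m C. 0 \<le> C \<and> (\<forall>r\<in>?R. \<forall>f\<in>OC_step n. r f \<le> C * OC_norm m n f)"
    by (rule iffD1[OF dominated_OC_iff[OF R] dom])
  then obtain m C where C: "0 \<le> C" "\<forall>r\<in>?R. \<forall>f\<in>OC_step n. r f \<le> C * OC_norm m n f"
    using n by meson
  have "step_bound (conv_iter T k) n m C" if k: "1 \<le> k" for k
  proof -
    have "(\<lambda>f. ?p ((conv_fun T ^^ k) f)) \<in> ?R" using k by blast
    from bspec[OF C(2) this] show ?thesis
      unfolding step_bound_def conv_iter_def using C(1) OC_step_reflect OC_norm_reflect by metis
  qed
  then show "\<exists>m C. \<forall>k\<ge>1. step_bound (conv_iter T k) n m C" by blast
qed

section \<open>Partition of unity\<close>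

text \<open>\<open>f\<close> grows at most like \<open>(1 + x^2)^n\<close>, so \<open>n\<close>
  additional powers of decay of \<open>g\<close> restore the weight \<open>M\<close>.\<close>

lemma
  assumes f: "f \<in> OC_step n" and g: "g \<in> Schwartz"
  shows Schwartz_mult: "(\<lambda>x. f x * g x) \<in> Schwartz"
    and schwartz_norm_mult_le:
      "schwartz_norm M (\<lambda>x. f x * g x) \<le> 2 ^ M * (OC_norm M n f * schwartz_norm (M + n) g)"
proof -
  have sm: "smooth f" "smooth g" using f g OC_step_smooth Schwartz_smooth by auto
  have le: "(1 + x\<^sup>2) ^ M * norm (nth_deriv i (\<lambda>x. f x * g x) x)
      \<le> 2 ^ M * (OC_norm M n f * schwartz_norm (M + n) g)" if i: "i \<le> M" for i M x
  proof -
    let ?w = "1 + x\<^sup>2"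
    let ?B = "OC_norm M n f * schwartz_norm (M + n) g"
    have "norm (nth_deriv i (\<lambda>x. f x * g x) x)
        \<le> 2 ^ i * ((OC_norm M n f * ?w ^ n) * (schwartz_norm (M + n) g / ?w ^ (M + n)))"
    proof (rule norm_nth_deriv_mult_le[OF sm])
      show "norm (nth_deriv j f x) \<le> OC_norm M n f * ?w ^ n" if "j \<le> i" for j
        using that i by (intro norm_nth_deriv_le_OC_norm f) auto
      show "norm (nth_deriv j g x) \<le> schwartz_norm (M + n) g / ?w ^ (M + n)" if "j \<le> i" for j
        using nth_deriv_le_schwartz_norm[OF g, of j "M + n" x] that i weight_pos[of x "M + n"]
        by (simp add: pos_le_divide_eq mult.commute)
    qed
    also have "\<dots> \<le> 2 ^ M * ((OC_norm M n f * ?w ^ n) * (schwartz_norm (M + n) g / ?w ^ (M + n)))"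
      using i OC_norm_nonneg[OF f] schwartz_norm_nonneg[OF g]
      by (intro mult_right_mono power_increasing mult_nonneg_nonneg divide_nonneg_nonneg) auto
    also have "\<dots> = 2 ^ M * ?B / ?w ^ M"
      using weight_pos[of x 1] by (simp add: power_add field_simps)
    finally show ?thesis
      using weight_pos[of x M] by (simp add: pos_le_divide_eq mult.commute)
  qed
  show *: "(\<lambda>x. f x * g x) \<in> Schwartz"
    unfolding Schwartz_iff
  proof (intro conjI allI)
    fix i k
    have "(1 + x\<^sup>2) ^ k * norm (nth_deriv i (\<lambda>x. f x * g x) x)
      \<le> 2 ^ (i + k) * (OC_norm (i + k) n f * schwartz_norm (i + k + n) g)" for x
    proof -
      have "(1 + x\<^sup>2) ^ k * norm (nth_deriv i (\<lambda>x. f x * g x) x)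
          \<le> (1 + x\<^sup>2) ^ (i + k) * norm (nth_deriv i (\<lambda>x. f x * g x) x)"
        by (intro mult_right_mono power_increasing) auto
      also have "\<dots> \<le> 2 ^ (i + k) * (OC_norm (i + k) n f * schwartz_norm (i + k + n) g)"
        by (rule le) simp
      finally show ?thesis .
    qed
    then show "\<exists>M. \<forall>x. (1 + x\<^sup>2) ^ k * norm (nth_deriv i (\<lambda>x. f x * g x) x) \<le> M" by blast
  qed (rule smooth_mult[OF sm])
  show "schwartz_norm M (\<lambda>x. f x * g x) \<le> 2 ^ M * (OC_norm M n f * schwartz_norm (M + n) g)"
    unfolding schwartz_norm_le_iff[OF *] using le by blast
qed

lemma Schwartz_affine:
  assumes f: "f \<in> Schwartz" and s: "\<bar>s\<bar> = 1"
  shows "(\<lambda>x. f (a + s * x)) \<in> Schwartz"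
  unfolding Schwartz_iff
proof (intro conjI allI)
  show "smooth (\<lambda>x. f (a + s * x))" by (rule smooth_affine[OF Schwartz_smooth[OF f]])
  fix i n
  let ?S = "schwartz_norm (i + n) f"
  have "(1 + x\<^sup>2) ^ n * norm (nth_deriv i (\<lambda>x. f (a + s * x)) x) \<le> 2 ^ n * (1 + a\<^sup>2) ^ n * ?S" for x
  proof -
    let ?y = "a + s * x"
    have "x\<^sup>2 = (- a + ?y)\<^sup>2" using s by (simp add: power_mult_distrib) (metis mult_1 one_power2 power2_abs)
    then have "(1 + x\<^sup>2) ^ n \<le> 2 ^ n * (1 + a\<^sup>2) ^ n * (1 + ?y\<^sup>2) ^ n"
      using peetre_power_le[of "- a" ?y n] by simp
    then have "(1 + x\<^sup>2) ^ n * norm (nth_deriv i f ?y)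
        \<le> (2 ^ n * (1 + a\<^sup>2) ^ n * (1 + ?y\<^sup>2) ^ n) * norm (nth_deriv i f ?y)"
      by (rule mult_right_mono) simp
    also have "\<dots> \<le> 2 ^ n * (1 + a\<^sup>2) ^ n * ?S"
      using mult_left_mono[OF nth_deriv_le_schwartz_norm'[OF f, of i "i + n" n ?y], of "2 ^ n * (1 + a\<^sup>2) ^ n"]
      by (simp add: mult.assoc)
    finally show ?thesis
      using s by (simp add: nth_deriv_affine[OF Schwartz_smooth[OF f]] norm_mult power_abs del: of_real_power)
  qed
  then show "\<exists>M. \<forall>x. (1 + x\<^sup>2) ^ n * norm (nth_deriv i (\<lambda>x. f (a + s * x)) x) \<le> M" by blast
qed

section \<open>The logistic function and its bump\<close>

text \<open>Chosen over a compactly supported cutoff because every derivative is the function times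
  a polynomial in it: one exponential bound at minus infinity serves all orders.\<close>

definition logistic :: "real \<Rightarrow> real" where
  "logistic x = 1 / (1 + exp (- x))"

lemma logistic_pos: "0 < logistic x"
  by (simp add: logistic_def add_pos_pos)

lemma logistic_le_1: "logistic x \<le> 1"
  unfolding logistic_def by (subst divide_le_eq_1_pos) (auto intro: add_pos_pos)

lemma logistic_le_exp: "logistic x \<le> exp x"
proof -
  have "1 / (1 + exp (- x)) \<le> 1 / exp (- x)" by (intro divide_left_mono) (auto simp: add_pos_pos)
  also have "\<dots> = exp x" by (simp add: exp_minus divide_inverse)
  finally show ?thesis by (simp add: logistic_def)
qed

lemma logistic_minus: "logistic (- x) = 1 - logistic x"
proof -
  have "1 + exp x \<noteq> 0" using exp_gt_zero[of x] by linarith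
  then show ?thesis unfolding logistic_def by (simp add: exp_minus divide_simps)
qed

lemma logistic_has_real_derivative:
  "(logistic has_real_derivative logistic x * (1 - logistic x)) (at x)"
proof -
  have "1 + exp (- x) \<noteq> 0" using exp_gt_zero[of "- x"] by linarith
  then show ?thesis
    unfolding logistic_def[abs_def]
    by (auto intro!: derivative_eq_intros simp: field_simps power2_eq_square)
qed

text \<open>With \<open>L' = L * (1 - L)\<close>, the derivative of \<open>L * p(L)\<close> is
  \<open>L * (1 - L) * (p(L) + L * p'(L))\<close>; the recursion reads off the new polynomial
  factor.\<close>

fun logistic_poly :: "nat \<Rightarrow> real poly" where
  "logistic_poly 0 = 1"
| "logistic_poly (Suc i) = [:1, -1:] * (logistic_poly i + [:0, 1:] * pderiv (logistic_poly i))"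

abbreviation clogistic :: "real \<Rightarrow> complex" where
  "clogistic x \<equiv> of_real (logistic x)"

lemma
  shows nth_deriv_logistic: "nth_deriv i clogistic = (\<lambda>x. of_real (logistic x * poly (logistic_poly i) (logistic x)))"
    and smooth_logistic: "smooth clogistic"
proof -
  let ?F = "\<lambda>i x. of_real (logistic x * poly (logistic_poly i) (logistic x)) :: complex"
  have d: "(?F i has_vector_derivative ?F (Suc i) x) (at x)" for i x
  proof -
    have "((\<lambda>x. logistic x * poly (logistic_poly i) (logistic x)) has_real_derivative
        logistic x * poly (logistic_poly (Suc i)) (logistic x)) (at x)"
      by (rule derivative_eq_intros logistic_has_real_derivative DERIV_chain2[OF poly_DERIV] refl)+
         (simp add: algebra_simps)
    then show ?thesis
      using has_vector_derivative_of_real has_real_derivative_iff_has_vector_derivative by blast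
  qed
  show "nth_deriv i clogistic = ?F i" using nth_deriv_unique(1)[of ?F i, OF d] by simp
  show "smooth clogistic" using nth_deriv_unique(2)[of ?F, OF d] by simp
qed

text \<open>The logistic function takes values in the unit interval, a compact set on which each
  polynomial factor is bounded.\<close>

lemma norm_nth_deriv_logistic_le:
  "\<exists>K\<ge>0. \<forall>i\<le>m. \<forall>x. norm (nth_deriv i clogistic x) \<le> K * logistic x"
proof -
  have "\<exists>K. \<forall>x. norm (nth_deriv i clogistic x) \<le> K * logistic x" for i
  proof -
    have "compact (poly (logistic_poly i) ` {0..1})"
      by (intro compact_continuous_image continuous_intros compact_Icc)
    then have "\<exists>K. \<forall>t\<in>{0..1}. \<bar>poly (logistic_poly i) t\<bar> \<le> K"
      by (auto dest!: compact_imp_bounded simp: bounded_iff)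
    then obtain K where K: "\<And>t. t \<in> {0..1} \<Longrightarrow> \<bar>poly (logistic_poly i) t\<bar> \<le> K" by blast
    have "norm (nth_deriv i clogistic x) \<le> K * logistic x" for x
    proof -
      have "\<bar>poly (logistic_poly i) (logistic x)\<bar> \<le> K"
        using logistic_pos[of x] logistic_le_1[of x] by (intro K) auto
      from mult_left_mono[OF this, of "logistic x"] show ?thesis
        using logistic_pos[of x] by (simp add: nth_deriv_logistic norm_mult mult.commute)
    qed
    then show ?thesis by blast
  qed
  then obtain K where K: "\<And>i x. norm (nth_deriv i clogistic x) \<le> K i * logistic x" by metis
  let ?K = "Max (insert 0 (K ` {..m}))"
  have "norm (nth_deriv i clogistic x) \<le> ?K * logistic x" if "i \<le> m" for i x
  proof -
    have "K i \<le> ?K" using that by (intro Max_ge) auto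
    then have "K i * logistic x \<le> ?K * logistic x"
      using logistic_pos[of x] by (intro mult_right_mono) auto
    then show ?thesis using K[of i x] by linarith
  qed
  moreover have "0 \<le> ?K" by simp
  ultimately show ?thesis by blast
qed

text \<open>The integer translates of this function form a partition of unity, by telescoping.\<close>

definition logistic_bump :: "real \<Rightarrow> complex" where
  "logistic_bump x = clogistic x - clogistic (x - 1)"

lemma weight_le_exp: "\<exists>M. \<forall>x::real. (1 + x\<^sup>2) ^ n \<le> M * exp \<bar>x\<bar>"
proof -
  \<comment> \<open>Above \<open>2 * n\<close> and positive even for \<open>n = 0\<close>, so that
    \<open>(1 + y / k)^k \<le> exp y\<close> can be applied.\<close>
  define k where "k = Suc (2 * n)"
  have "(1 + x\<^sup>2) ^ n \<le> real k ^ k * exp \<bar>x\<bar>" for x :: real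
  proof -
    have "1 + x\<^sup>2 \<le> (1 + \<bar>x\<bar>)\<^sup>2" by (simp add: power2_eq_square algebra_simps)
    then have "(1 + x\<^sup>2) ^ n \<le> ((1 + \<bar>x\<bar>)\<^sup>2) ^ n" by (intro power_mono) auto
    also have "\<dots> = (1 + \<bar>x\<bar>) ^ (2 * n)" by (simp add: power_mult)
    also have "\<dots> \<le> (1 + \<bar>x\<bar>) ^ k" by (intro power_increasing) (auto simp: k_def)
    also have "\<dots> \<le> (real k * (1 + \<bar>x\<bar> / real k)) ^ k"
      by (intro power_mono) (auto simp: k_def field_simps)
    also have "\<dots> = real k ^ k * (1 + \<bar>x\<bar> / real k) ^ k" by (simp add: power_mult_distrib)
    also have "\<dots> \<le> real k ^ k * exp \<bar>x\<bar>"
      by (intro mult_left_mono exp_ge_one_plus_x_over_n_power_n) (auto simp: k_def)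
    finally show ?thesis .
  qed
  then show ?thesis by blast
qed

lemma logistic_bump_Schwartz: "logistic_bump \<in> Schwartz"
  unfolding Schwartz_iff
proof (intro conjI allI)
  have aff: "smooth (\<lambda>x. clogistic (a + s * x))"
    "nth_deriv i (\<lambda>x. clogistic (a + s * x)) x = of_real (s ^ i) * nth_deriv i clogistic (a + s * x)" for a s i x
    using smooth_affine[OF smooth_logistic, of a s] nth_deriv_affine[OF smooth_logistic, of i a s] by simp_all
  have bump1: "logistic_bump = (\<lambda>x. clogistic (0 + 1 * x) - clogistic (- 1 + 1 * x))"
    by (rule ext) (simp add: logistic_bump_def)
  \<comment> \<open>At plus infinity both terms of the bump tend to 1. Reflecting them cancels these
    limits and leaves a difference of two decaying functions.\<close>
  have bump2: "logistic_bump = (\<lambda>x. clogistic (1 + (-1) * x) - clogistic (0 + (-1) * x))"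
  proof (rule ext)
    fix x show "logistic_bump x = clogistic (1 + (-1) * x) - clogistic (0 + (-1) * x)"
      using logistic_minus[of "x - 1"] logistic_minus[of x]
      by (simp add: logistic_bump_def flip: of_real_diff)
  qed
  show "smooth logistic_bump" unfolding bump1 by (intro smooth_diff aff)
  fix i n
  obtain K where K: "0 \<le> K" "\<And>x. norm (nth_deriv i clogistic x) \<le> K * logistic x"
    using norm_nth_deriv_logistic_le[of i] by blast
  have Ke: "norm (nth_deriv i clogistic x) \<le> K * exp x" for x
    using K(2)[of x] mult_left_mono[OF logistic_le_exp[of x] K(1)] by linarith
  have le: "norm (nth_deriv i logistic_bump x) \<le> (4 * K) * exp (- \<bar>x\<bar>)" for x
  proof (cases "x \<le> 0")
    case True
    have "norm (nth_deriv i logistic_bump x) \<le> norm (nth_deriv i clogistic x) + norm (nth_deriv i clogistic (x - 1))"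
      unfolding bump1 by (subst nth_deriv_diff[OF aff(1) aff(1)], subst aff(2), subst aff(2)) (simp add: norm_triangle_ineq4)
    also have "\<dots> \<le> K * exp x + K * exp (x - 1)" by (intro add_mono Ke)
    also have "\<dots> \<le> K * exp x + K * exp x" using K(1) by (intro add_left_mono mult_left_mono) auto
    also have "\<dots> \<le> (4 * K) * exp x" using K(1) by simp
    finally show ?thesis using True by simp
  next
    case False
    have "norm (nth_deriv i logistic_bump x) \<le> norm (nth_deriv i clogistic (1 - x)) + norm (nth_deriv i clogistic (- x))"
      unfolding bump2
      by (subst nth_deriv_diff[OF aff(1) aff(1)], subst aff(2), subst aff(2))
         (use norm_triangle_ineq4[of "(-1) ^ i * nth_deriv i clogistic (1 - x)" "(-1) ^ i * nth_deriv i clogistic (- x)"]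
           in \<open>simp add: norm_mult norm_power\<close>)
    also have "\<dots> \<le> K * exp (1 - x) + K * exp (- x)" by (intro add_mono Ke)
    also have "\<dots> \<le> K * (3 * exp (- x)) + K * exp (- x)"
    proof (intro add_right_mono mult_left_mono K(1))
      have "exp (1 - x) = exp 1 * exp (- x)" by (simp flip: exp_add)
      also have "\<dots> \<le> 3 * exp (- x)" using exp_le by (intro mult_right_mono) auto
      finally show "exp (1 - x) \<le> 3 * exp (- x)" .
    qed
    finally show ?thesis using False by simp
  qed
  obtain M where M: "\<And>x::real. (1 + x\<^sup>2) ^ n \<le> M * exp \<bar>x\<bar>" using weight_le_exp by blast
  have "(1 + x\<^sup>2) ^ n * norm (nth_deriv i logistic_bump x) \<le> M * (4 * K)" for x
  proof -
    have M0: "0 \<le> M" using order_trans[OF _ M[of 0]] by simp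
    have "(1 + x\<^sup>2) ^ n * norm (nth_deriv i logistic_bump x) \<le> (M * exp \<bar>x\<bar>) * ((4 * K) * exp (- \<bar>x\<bar>))"
      using M0 by (intro mult_mono M le) auto
    also have "\<dots> = M * (4 * K)" by (simp add: exp_minus field_simps)
    finally show ?thesis .
  qed
  then show "\<exists>M. \<forall>x. (1 + x\<^sup>2) ^ n * norm (nth_deriv i logistic_bump x) \<le> M" by blast
qed

section \<open>Cutoffs and density of the Schwartz space\<close>

text \<open>The shifts run through the \<open>2 * N\<close> integers from \<open>1 - N\<close> to
  \<open>N\<close>, two for each \<open>j\<close>. This window makes the telescoped error symmetric
  under reflection.\<close>

definition cutoff :: "nat \<Rightarrow> real \<Rightarrow> complex" where
  "cutoff N x = (\<Sum>j<N. logistic_bump (x + (real j + 1)) + logistic_bump (x + - real j))"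

text \<open>The error consists of one logistic tail at each end. The coefficients
  \<open>(-1) * x\<close> and \<open>1 * x\<close> are kept in the shape of the affine derivative
  rule.\<close>

lemma cutoff_eq: "1 - cutoff N x = clogistic (- real N + (-1) * x) + clogistic (- real N + 1 * x)"
proof -
  have "cutoff N x = clogistic (x + real N) - clogistic (x - real N)"
    unfolding cutoff_def by (induction N) (simp_all add: logistic_bump_def algebra_simps)
  then have "1 - cutoff N x = (1 - clogistic (x + real N)) + clogistic (x - real N)" by simp
  moreover have "clogistic (- (x + real N)) = 1 - clogistic (x + real N)"
    unfolding logistic_minus by simp
  ultimately show ?thesis by (simp add: add.commute)
qed

text \<open>Far out the tail is close to 1, so it is not uniformly small; one power of the weight
  compensates and buys the rate \<open>1 / N\<close>.\<close>

lemma logistic_tail_le: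
  assumes "1 \<le> N" shows "logistic (x - real N) \<le> 2 * (1 + x\<^sup>2) / real N"
proof (cases "real N \<le> x")
  case True
  have "0 \<le> (x - 1)\<^sup>2" by simp
  then have "2 * x \<le> 1 + x\<^sup>2" by (simp add: power2_diff)
  then have "real N \<le> 2 * (1 + x\<^sup>2)" using True zero_le_power2[of x] by argo
  then have "1 \<le> 2 * (1 + x\<^sup>2) / real N" using assms by simp
  then show ?thesis using logistic_le_1[of "x - real N"] by linarith
next
  case False
  define u where "u = real N - x"
  have u: "0 < u" using False by (simp add: u_def)
  have "0 \<le> (x - 1)\<^sup>2" by simp
  then have "2 * x \<le> 1 + x\<^sup>2" by (simp add: power2_diff)
  then have x: "x \<le> 1 + x\<^sup>2" using zero_le_power2[of x] by argo
  have "real N * 1 \<le> 2 * (1 + x\<^sup>2) * (1 + u)"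
  proof -
    have "0 \<le> x\<^sup>2 * u" using u by simp
    then have "real N \<le> 2 * (1 + x\<^sup>2) * (1 + u)" using u x by (simp add: algebra_simps u_def)
    then show ?thesis by simp
  qed
  also have "\<dots> \<le> 2 * (1 + x\<^sup>2) * exp u"
    by (intro mult_left_mono exp_ge_add_one_self) auto
  finally have "real N \<le> 2 * (1 + x\<^sup>2) * exp u" by simp
  then have "exp (- u) \<le> 2 * (1 + x\<^sup>2) / real N"
    using assms by (simp add: exp_minus field_simps)
  then show ?thesis using logistic_le_exp[of "x - real N"] by (simp add: u_def)
qed

text \<open>Within step \<open>n\<close> the cutoffs of \<open>g\<close> need not converge to
  \<open>g\<close>, as \<open>g = (1 + x^2)^n\<close> shows; the extra weight of the next step makes
  them converge, in all derivatives.\<close>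

lemma OC_norm_cutoff_error:
  assumes g: "g \<in> OC_step n"
  shows "\<exists>K. \<forall>N\<ge>1. (\<lambda>x. g x * (1 - cutoff N x)) \<in> OC_step (Suc n) \<and>
     OC_norm m (Suc n) (\<lambda>x. g x * (1 - cutoff N x)) \<le> K / real N"
proof -
  have aff: "smooth (\<lambda>x. clogistic (a + s * x))"
    "nth_deriv i (\<lambda>x. clogistic (a + s * x)) x = of_real (s ^ i) * nth_deriv i clogistic (a + s * x)" for a s i x
    using smooth_affine[OF smooth_logistic, of a s] nth_deriv_affine[OF smooth_logistic, of i a s] by simp_all
  have sm: "smooth (\<lambda>x. 1 - cutoff N x)" for N
    unfolding cutoff_eq by (intro smooth_add aff)
  have "\<exists>K. \<forall>N\<ge>1. \<forall>i\<le>m. \<forall>x. norm (nth_deriv i (\<lambda>x. g x * (1 - cutoff N x)) x) \<le> K / real N * (1 + x\<^sup>2) ^ Suc n" for m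
  proof -
    obtain K where K: "0 \<le> K" "\<And>i x. i \<le> m \<Longrightarrow> norm (nth_deriv i clogistic x) \<le> K * logistic x"
      using norm_nth_deriv_logistic_le[of m] by blast
    have "norm (nth_deriv i (\<lambda>x. g x * (1 - cutoff N x)) x)
        \<le> (2 ^ m * (OC_norm m n g * (4 * K))) / real N * (1 + x\<^sup>2) ^ Suc n"
      if N: "1 \<le> N" and i: "i \<le> m" for N i x
    proof -
      let ?w = "1 + x\<^sup>2"
      have c: "norm (nth_deriv j (\<lambda>x. 1 - cutoff N x) x) \<le> K * (4 * ?w / real N)" if j: "j \<le> m" for j
      proof -
        have "norm (nth_deriv j (\<lambda>x. 1 - cutoff N x) x)
            \<le> norm (nth_deriv j clogistic (- x - real N)) + norm (nth_deriv j clogistic (x - real N))"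
          unfolding cutoff_eq
          by (subst nth_deriv_add[OF aff(1) aff(1)], subst aff(2), subst aff(2))
             (use norm_triangle_ineq[of "(-1) ^ j * nth_deriv j clogistic (- x - real N)" "nth_deriv j clogistic (x - real N)"]
               in \<open>simp add: norm_mult norm_power algebra_simps\<close>)
        also have "\<dots> \<le> K * logistic (- x - real N) + K * logistic (x - real N)"
          by (intro add_mono K(2) j)
        also have "\<dots> \<le> K * (2 * (1 + (- x)\<^sup>2) / real N) + K * (2 * (1 + x\<^sup>2) / real N)"
          by (intro add_mono mult_left_mono logistic_tail_le N K(1))
        also have "\<dots> = K * (4 * ?w / real N)" by (simp add: field_simps)
        finally show ?thesis .
      qed
      have "norm (nth_deriv i (\<lambda>x. g x * (1 - cutoff N x)) x)
          \<le> 2 ^ i * ((OC_norm m n g * ?w ^ n) * (K * (4 * ?w / real N)))"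
        using i by (intro norm_nth_deriv_mult_le OC_step_smooth[OF g] sm norm_nth_deriv_le_OC_norm[OF g] c) auto
      also have "\<dots> \<le> 2 ^ m * ((OC_norm m n g * ?w ^ n) * (K * (4 * ?w / real N)))"
        using i OC_norm_nonneg[OF g] K(1)
        by (intro mult_right_mono power_increasing mult_nonneg_nonneg divide_nonneg_nonneg) auto
      also have "\<dots> = (2 ^ m * (OC_norm m n g * (4 * K))) / real N * ?w ^ Suc n"
        by (simp only: power_Suc times_divide_eq_left times_divide_eq_right mult_ac)
      finally show ?thesis .
    qed
    then show ?thesis by blast
  qed
  then obtain K where K: "\<And>m N i x. 1 \<le> N \<Longrightarrow> i \<le> m \<Longrightarrow>
      norm (nth_deriv i (\<lambda>x. g x * (1 - cutoff N x)) x) \<le> K m / real N * (1 + x\<^sup>2) ^ Suc n"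
    by metis
  have mem: "(\<lambda>x. g x * (1 - cutoff N x)) \<in> OC_step (Suc n)" if "1 \<le> N" for N
    unfolding OC_step_iff using smooth_mult[OF OC_step_smooth[OF g] sm] K[OF that order_refl] by blast
  then show ?thesis using K by (intro exI[of _ "K m"]) (simp add: OC_norm_le_iff)
qed

lemma OC_functional_cutoff_tendsto:
  assumes U: "OC_functional U" and g: "g \<in> OC_step n"
    and mem: "\<And>N. (\<lambda>x. g x * cutoff N x) \<in> OC"
  shows "(\<lambda>N. U (\<lambda>x. g x * cutoff N x)) \<longlonglongrightarrow> U g"
proof -
  obtain m C where b: "step_bound U (Suc n) m C" using U unfolding OC_functional_def by force
  obtain K where K: "\<And>N. 1 \<le> N \<Longrightarrow> (\<lambda>x. g x * (1 - cutoff N x)) \<in> OC_step (Suc n) \<and>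
     OC_norm m (Suc n) (\<lambda>x. g x * (1 - cutoff N x)) \<le> K / real N"
    using OC_norm_cutoff_error[OF g] by blast
  have gO: "g \<in> OC" using g OC_iff by blast
  have lin: "linear_form_on OC U" using U OC_functional_def by blast
  have "norm (U (\<lambda>x. g x * cutoff N x) - U g) \<le> C * K / real N" if N: "1 \<le> N" for N
  proof -
    have "U g - U (\<lambda>x. g x * cutoff N x) = U (\<lambda>x. g x * (1 - cutoff N x))"
      using linear_form_on_diff[OF fun_subspace_OC lin gO mem[of N]] by (simp add: algebra_simps)
    then have "norm (U (\<lambda>x. g x * cutoff N x) - U g) = norm (U (\<lambda>x. g x * (1 - cutoff N x)))"
      by (metis norm_minus_commute)
    also have "\<dots> \<le> C * OC_norm m (Suc n) (\<lambda>x. g x * (1 - cutoff N x))"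
      using b K[OF N] unfolding step_bound_def by blast
    also have "\<dots> \<le> C * (K / real N)"
      using b K[OF N] unfolding step_bound_def by (intro mult_left_mono) auto
    finally show ?thesis by simp
  qed
  then have "(\<lambda>N. U (\<lambda>x. g x * cutoff N x) - U g) \<longlonglongrightarrow> 0"
    by (intro Lim_null_comparison[OF _ lim_const_over_n[of "C * K"]] eventually_sequentiallyI[of 1]) simp
  then show ?thesis by (simp add: LIM_zero_iff)
qed

lemma mult_bump_Schwartz:
  assumes g: "g \<in> OC_step n" shows "(\<lambda>x. g x * logistic_bump (x + a)) \<in> Schwartz"
  using Schwartz_mult[OF g Schwartz_affine[OF logistic_bump_Schwartz, of 1 a]] by (simp add: add.commute)

lemma mult_cutoff_eq:
  "(\<lambda>x. g x * cutoff N x) =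
     (\<lambda>x. \<Sum>j<N. g x * logistic_bump (x + (real j + 1)) + g x * logistic_bump (x + - real j))"
  by (simp add: cutoff_def sum_distrib_left distrib_left)

lemma mult_cutoff_Schwartz:
  assumes g: "g \<in> OC_step n" shows "(\<lambda>x. g x * cutoff N x) \<in> Schwartz"
  unfolding mult_cutoff_eq
proof (induction N)
  case 0
  then show ?case using fun_subspaceD(1)[OF fun_subspace_Schwartz] by simp
next
  case (Suc N)
  then show ?case
    using fun_subspaceD(2)[OF fun_subspace_Schwartz Suc
        fun_subspaceD(2)[OF fun_subspace_Schwartz mult_bump_Schwartz[OF g, of "real N + 1"]
          mult_bump_Schwartz[OF g, of "- real N"]]]
    by simp
qed

text \<open>Density of \<open>Schwartz\<close> in \<open>OC\<close> in the form in which it is used: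
  \<open>g\<close> times its cutoffs is a sequence of Schwartz functions along which both
  functionals converge.\<close>

lemma OC_functional_eqI:
  assumes "OC_functional U" "OC_functional V" "\<And>f. f \<in> Schwartz \<Longrightarrow> U f = V f" "g \<in> OC"
  shows "U g = V g"
proof -
  obtain n where g: "g \<in> OC_step n" using assms(4) OC_iff by blast
  have mem: "(\<lambda>x. g x * cutoff N x) \<in> OC" for N
    using mult_cutoff_Schwartz[OF g] Schwartz_subset_OC by blast
  have "(\<lambda>N. U (\<lambda>x. g x * cutoff N x)) \<longlonglongrightarrow> U g"
    by (rule OC_functional_cutoff_tendsto[OF assms(1) g mem])
  moreover have "(\<lambda>N. U (\<lambda>x. g x * cutoff N x)) \<longlonglongrightarrow> V g"
    using OC_functional_cutoff_tendsto[OF assms(2) g mem] mult_cutoff_Schwartz[OF g] assms(3) by simp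
  ultimately show ?thesis by (rule LIMSEQ_unique)
qed

section \<open>From the Schwartz space to the steps\<close>

lemma sum_inverse_squares_le: "(\<Sum>j<N. 1 / (1 + (real j)\<^sup>2)) \<le> 3"
proof -
  \<comment> \<open>Equality holds at \<open>N = 0\<close>; afterwards each new term is at most
    \<open>2 / (N + 1) - 2 / (N + 2)\<close>, which telescopes.\<close>
  have "(\<Sum>j<Suc N. 1 / (1 + (real j)\<^sup>2)) \<le> 3 - 2 / (real N + 1)" for N
  proof (induction N)
    case (Suc N)
    have "(real N + 1) * (real N + 2) \<le> 2 * (1 + (real N + 1)\<^sup>2)"
      by (simp add: power2_eq_square algebra_simps)
    then have "1 / (1 + (real N + 1)\<^sup>2) \<le> 2 / ((real N + 1) * (real N + 2))"
      by (simp add: divide_simps add_pos_nonneg)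
    also have "\<dots> = 2 / (real N + 1) - 2 / (real N + 2)" by (simp add: field_simps)
    finally show ?case using Suc by (simp add: algebra_simps)
  qed simp
  from this[of N] have "(\<Sum>j<Suc N. 1 / (1 + (real j)\<^sup>2)) \<le> 3" by (smt (verit) divide_nonneg_nonneg of_nat_0_le_iff)
  moreover have "(\<Sum>j<N. 1 / (1 + (real j)\<^sup>2)) \<le> (\<Sum>j<Suc N. 1 / (1 + (real j)\<^sup>2))" by simp
  ultimately show ?thesis by linarith
qed

text \<open>The functional \<open>conv_iter T k\<close> is estimated piecewise: a translate by \<open>a\<close> of a function
  concentrated near the origin contributes the value at \<open>- a\<close> of a Schwartz function, and the decay
  of the latter beats the growth \<open>(1 + a\<^sup>2) ^ n\<close> of \<open>g\<close>.\<close>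

lemma iterates_of_power_bounded_Schwartz:
  assumes T: "OC_functional T" and pb: "power_bounded Schwartz_top (conv_fun T)"
  shows "iterates_equicontinuous T"
  unfolding iterates_equicontinuous_def
proof (intro allI impI)
  fix n :: nat assume n: "1 \<le> n"
  interpret lc_space Schwartz "range schwartz_norm" by (rule lc_space_Schwartz)
  \<comment> \<open>One power of decay more than \<open>g\<close> can grow; the surplus is the
    summable factor \<open>1 / (1 + a^2)\<close> in \<open>piece\<close>.\<close>
  let ?R = "{\<lambda>f. schwartz_norm (Suc n) ((conv_fun T ^^ k) f) | k. 1 \<le> k}"
  have "dominated Schwartz (range schwartz_norm) ?R"
    using pb unfolding Schwartz_top_def power_bounded_iff by blast
  then have "\<exists>M C. 0 \<le> C \<and> (\<forall>r\<in>?R. \<forall>f\<in>Schwartz. r f \<le> C * schwartz_norm M f)"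
    by (rule dominated_chain) (auto intro: schwartz_norm_mono schwartz_norm_nonneg)
  then obtain M C where C: "0 \<le> C" "\<forall>r\<in>?R. \<forall>f\<in>Schwartz. r f \<le> C * schwartz_norm M f"
    by (elim exE conjE)
  have le: "schwartz_norm (Suc n) ((conv_fun T ^^ k) f) \<le> C * schwartz_norm M f"
    if k: "1 \<le> k" and f: "f \<in> Schwartz" for k f
  proof -
    have "(\<lambda>f. schwartz_norm (Suc n) ((conv_fun T ^^ k) f)) \<in> ?R" using k by blast
    from bspec[OF bspec[OF C(2) this] f] show ?thesis .
  qed
  \<comment> \<open>The bump is reflected because a piece of \<open>g\<close> enters the convolution
    in the form \<open>h (- a - y)\<close>.\<close>
  define \<beta> where "\<beta> = (\<lambda>y. logistic_bump (0 + (-1) * y))"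
  have \<beta>: "\<beta> \<in> Schwartz" unfolding \<beta>_def by (rule Schwartz_affine[OF logistic_bump_Schwartz]) simp
  \<comment> \<open>Collects the constants of power boundedness (\<open>C\<close>), of the product
    estimate (\<open>2 ^ M\<close> and the norm of \<open>\<beta>\<close>) and of the translation of
    \<open>g\<close> (\<open>2 ^ n\<close>).\<close>
  define D where "D = C * (2 ^ M * (2 ^ n * schwartz_norm (M + n) \<beta>))"
  have D: "0 \<le> D" unfolding D_def using C(1) schwartz_norm_nonneg[OF \<beta>] by simp
  \<comment> \<open>6 is 2 times 3: two shifts for each index \<open>j\<close>, and the bound 3 for
    the sum of \<open>1 / (1 + j^2)\<close>.\<close>
  have "step_bound (conv_iter T k) n M (6 * D)" if k: "1 \<le> k" for k
    unfolding step_bound_def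
  proof (intro conjI ballI)
    note V = OC_functional_conv_iter[OF T, of k]
    have lin: "linear_form_on OC (conv_iter T k)" using V OC_functional_def by blast
    fix g assume g: "g \<in> OC_step n"
    define G where "G = OC_norm M n g"
    have G: "0 \<le> G" unfolding G_def by (rule OC_norm_nonneg[OF g])
    have piece: "norm (conv_iter T k (\<lambda>x. g x * logistic_bump (x + a))) \<le> D * G * (1 / (1 + a\<^sup>2))" for a
    proof -
      define h where "h = (\<lambda>y. g (- a - y) * \<beta> y)"
      have gt: "(\<lambda>y. g (- a - y)) \<in> OC_step n" by (rule OC_step_translate[OF g])
      have h: "h \<in> Schwartz" unfolding h_def by (rule Schwartz_mult[OF gt \<beta>])
      have "schwartz_norm M h \<le> 2 ^ M * (OC_norm M n (\<lambda>y. g (- a - y)) * schwartz_norm (M + n) \<beta>)"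
        unfolding h_def by (rule schwartz_norm_mult_le[OF gt \<beta>])
      also have "\<dots> \<le> 2 ^ M * ((2 ^ n * (1 + (- a)\<^sup>2) ^ n * G) * schwartz_norm (M + n) \<beta>)"
        unfolding G_def
        by (intro mult_left_mono mult_right_mono OC_norm_translate_le g schwartz_norm_nonneg \<beta>) auto
      finally have hn: "schwartz_norm M h \<le> 2 ^ M * ((2 ^ n * (1 + a\<^sup>2) ^ n * G) * schwartz_norm (M + n) \<beta>)"
        by simp
      have "(\<lambda>x. g x * logistic_bump (x + a)) = (\<lambda>y. h (- a - y))"
        by (rule ext) (simp add: h_def \<beta>_def add.commute)
      then have eq: "conv_iter T k (\<lambda>x. g x * logistic_bump (x + a)) = (conv_fun T ^^ k) h (- a)"
        unfolding conv_fun_funpow by (simp add: conv_fun_def)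
      have "(conv_fun T ^^ k) h \<in> Schwartz"
        by (rule linear_endoD(1)[OF linear_endo_funpow[OF linear_endo_conv_fun_Schwartz[OF T]] h])
      from nth_deriv_le_schwartz_norm[OF this, of 0 "Suc n" "- a"]
      have "(1 + a\<^sup>2) ^ Suc n * norm ((conv_fun T ^^ k) h (- a)) \<le> schwartz_norm (Suc n) ((conv_fun T ^^ k) h)"
        by simp
      also have "\<dots> \<le> C * schwartz_norm M h" by (rule le[OF k h])
      also have "\<dots> \<le> C * (2 ^ M * ((2 ^ n * (1 + a\<^sup>2) ^ n * G) * schwartz_norm (M + n) \<beta>))"
        by (rule mult_left_mono[OF hn C(1)])
      also have "\<dots> = (1 + a\<^sup>2) ^ n * (D * G)" by (simp add: D_def mult_ac)
      finally have "(1 + a\<^sup>2) ^ n * ((1 + a\<^sup>2) * norm ((conv_fun T ^^ k) h (- a))) \<le> (1 + a\<^sup>2) ^ n * (D * G)"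
        by (simp add: mult_ac)
      then have "(1 + a\<^sup>2) * norm ((conv_fun T ^^ k) h (- a)) \<le> D * G"
        using weight_pos[of a n] by simp
      then show ?thesis unfolding eq using weight_pos[of a 1] by (simp add: pos_le_divide_eq mult.commute)
    qed
    have mem: "(\<lambda>x. g x * logistic_bump (x + a)) \<in> OC" for a
      using mult_bump_Schwartz[OF g] Schwartz_subset_OC by blast
    have bound: "norm (conv_iter T k (\<lambda>x. g x * cutoff N x)) \<le> 6 * D * G" for N
    proof -
      let ?u = "\<lambda>j x. g x * logistic_bump (x + (real j + 1)) + g x * logistic_bump (x + - real j)"
      have "conv_iter T k (\<lambda>x. g x * cutoff N x) = (\<Sum>j<N. conv_iter T k (?u j))"
        unfolding mult_cutoff_eq
        by (rule linear_form_on_sum(2)[OF fun_subspace_OC lin finite_lessThan])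
           (rule fun_subspaceD(2)[OF fun_subspace_OC mem mem])
      also have "norm \<dots> \<le> (\<Sum>j<N. 2 * (D * G) * (1 / (1 + (real j)\<^sup>2)))"
      proof (rule sum_norm_le)
        fix j
        have "norm (conv_iter T k (?u j)) \<le> D * G * (1 / (1 + (real j + 1)\<^sup>2)) + D * G * (1 / (1 + (- real j)\<^sup>2))"
          unfolding linear_form_onD(1)[OF lin mem mem]
          by (intro order_trans[OF norm_triangle_ineq] add_mono piece)
        also have "\<dots> \<le> D * G * (1 / (1 + (real j)\<^sup>2)) + D * G * (1 / (1 + (real j)\<^sup>2))"
          using D G by (intro add_mono mult_left_mono divide_left_mono) (auto intro!: power_mono add_pos_nonneg mult_pos_pos)
        finally show "norm (conv_iter T k (?u j)) \<le> 2 * (D * G) * (1 / (1 + (real j)\<^sup>2))" by simp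
      qed
      also have "\<dots> = 2 * (D * G) * (\<Sum>j<N. 1 / (1 + (real j)\<^sup>2))" by (simp add: sum_distrib_left)
      also have "\<dots> \<le> 2 * (D * G) * 3"
        using D G by (intro mult_left_mono sum_inverse_squares_le) auto
      finally show ?thesis by simp
    qed
    have "(\<lambda>N. norm (conv_iter T k (\<lambda>x. g x * cutoff N x))) \<longlonglongrightarrow> norm (conv_iter T k g)"
      using mult_cutoff_Schwartz[OF g] Schwartz_subset_OC
      by (intro tendsto_norm OC_functional_cutoff_tendsto[OF V g]) blast
    then have "norm (conv_iter T k g) \<le> 6 * D * G"
      by (rule Lim_bounded) (use bound in blast)
    then show "norm (conv_iter T k g) \<le> 6 * D * OC_norm M n g" by (simp add: G_def)
  qed (use D in simp)
  then show "\<exists>m C. \<forall>k\<ge>1. step_bound (conv_iter T k) n m C" by blast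
qed

section \<open>Duality\<close>

text \<open>The transpose of convolution with the reflected functional is continuous on every step
  and restricts to the required tempered distribution. Agreement on \<open>Schwartz\<close>
  determines an element of the dual, so the definite description denotes it.\<close>

lemma
  assumes T: "OC_functional T" and S: "S \<in> dual_space OC_top"
  shows conv_OC_dual_eq: "conv_OC_dual T S = (\<lambda>f. if f \<in> OC then S (conv_fun (reflect T) f) else 0)"
    and conv_OC_dual_mem: "conv_OC_dual T S \<in> dual_space OC_top"
proof -
  note T' = OC_functional_reflect[OF T]
  have SF: "OC_functional S" using S dual_space_OC_iff by blast
  let ?W = "\<lambda>f. if f \<in> OC then S (conv_fun (reflect T) f) else 0"
  have "linear_form_on OC ?W"
    using SF linear_endoD[OF linear_endo_conv_fun_OC[OF T']] fun_subspaceD[OF fun_subspace_OC]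
    unfolding OC_functional_def linear_form_on_def by simp
  moreover have "\<exists>m C. step_bound ?W n m C" if n: "1 \<le> n" for n
  proof -
    obtain m C where b: "step_bound (reflect T) n m C" using T' n unfolding OC_functional_def by blast
    obtain l D where d: "step_bound S n l D" using SF n unfolding OC_functional_def by blast
    have C: "0 \<le> C" and D: "0 \<le> D" using b d by (auto simp: step_bound_def)
    have "norm (?W f) \<le> (D * (C * 2 ^ n)) * OC_norm (m + l) n f" if f: "f \<in> OC_step n" for f
    proof -
      have "norm (?W f) \<le> D * OC_norm l n (conv_fun (reflect T) f)"
        using d conv_fun_OC_step[OF T' b n f] f OC_iff unfolding step_bound_def by auto
      also have "\<dots> \<le> D * (C * 2 ^ n * OC_norm (m + l) n f)"
        by (rule mult_left_mono[OF OC_norm_conv_fun_le[OF T' b n f] D])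
      finally show ?thesis by (simp add: mult.assoc)
    qed
    then have "step_bound ?W n (m + l) (D * (C * 2 ^ n))" using C D by (simp add: step_bound_def)
    then show ?thesis by blast
  qed
  ultimately have W: "?W \<in> dual_space OC_top"
    unfolding dual_space_OC_iff OC_functional_def by simp
  have eq: "to_tempered ?W = conv_tempered T (to_tempered S)"
    using conv_fun_Schwartz[OF T'] subsetD[OF Schwartz_subset_OC]
    by (simp add: fun_eq_iff to_tempered_def conv_tempered_def)
  have uniq: "R = ?W" if R: "R \<in> dual_space OC_top" "to_tempered R = to_tempered ?W" for R
  proof (rule ext)
    fix f
    show "R f = ?W f"
    proof (cases "f \<in> OC")
      case True
      show ?thesis
      proof (rule OC_functional_eqI[of R ?W f])
        show "OC_functional R" by (rule conjunct1[OF iffD1[OF dual_space_OC_iff R(1)]])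
        show "OC_functional ?W" by (rule conjunct1[OF iffD1[OF dual_space_OC_iff W]])
        show "R g = ?W g" if "g \<in> Schwartz" for g
          using fun_cong[OF R(2), of g] that by (simp add: to_tempered_def)
      qed (rule True)
    qed (use R(1) dual_space_OC_iff in auto)
  qed
  show *: "conv_OC_dual T S = ?W"
    unfolding conv_OC_dual_def eq[symmetric]
    by (rule the_equality) (use W in blast, elim conjE, rule uniq)
  show "conv_OC_dual T S \<in> dual_space OC_top" unfolding * by (rule W)
qed

text \<open>\<open>conv_power T k\<close> applies the product \<open>k - 1\<close> times to
  \<open>T\<close>; in transposed form \<open>T\<close> is evaluated on a power of
  \<open>conv_fun (reflect T)\<close>, as in \<open>conv_iter_Suc\<close>.\<close>

lemma
  assumes T: "T \<in> dual_space OC_top" and k: "1 \<le> k"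
  shows conv_power_mem: "conv_power T k \<in> dual_space OC_top"
    and conv_power_eq: "f \<in> OC \<Longrightarrow> conv_power T k f = conv_iter T k f"
proof -
  interpret lc_space OC OC_seminorms by (rule lc_space_OC)
  have TF: "OC_functional T" using T dual_space_OC_iff by blast
  obtain j where j: "k = Suc j" using k by (cases k) auto
  note adj = funpow_adjoint[OF linear_endo_conv_fun_OC[OF OC_functional_reflect[OF TF]],
      of "conv_OC_dual T" T j, folded OC_top_def]
  have eq: "(conv_OC_dual T ^^ j) T = (\<lambda>f. if f \<in> OC then T ((conv_fun (reflect T) ^^ j) f) else 0)"
    by (rule adj(1)) (fact conv_OC_dual_eq[OF TF] conv_OC_dual_mem[OF TF] T)+
  show "conv_power T k \<in> dual_space OC_top"
    unfolding conv_power_def j diff_Suc_1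
    by (rule adj(2)) (fact conv_OC_dual_eq[OF TF] conv_OC_dual_mem[OF TF] T)+
  show "conv_power T k f = conv_iter T k f" if "f \<in> OC"
    using that unfolding conv_power_def j diff_Suc_1 eq conv_iter_Suc by simp
qed

section \<open>Bounded sequences and boundedness of the powers\<close>

lemma bounded_of_bounded_tail:
  fixes a :: "nat \<Rightarrow> real"
  assumes "\<And>m. l \<le> m \<Longrightarrow> a m \<le> c"
  shows "\<exists>C. \<forall>m. a m \<le> C"
proof -
  have "a m \<le> Max (insert c (a ` {..<l}))" for m
  proof (cases "m < l")
    case False
    then have "a m \<le> c" by (intro assms) simp
    also have "\<dots> \<le> Max (insert c (a ` {..<l}))" by (intro Max_ge) auto
    finally show ?thesis .
  qed (intro Max_ge, auto)
  then show ?thesis by blast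
qed

text \<open>The index of the norm grows along the sequence: a fixed norm is at most 1 from its own
  index on, and finitely many earlier values do no harm. Such sequences are those of
  \<open>uniform_bound_of_bounded_on_sequences\<close>.\<close>

lemma lc_bounded_OC_sequence:
  assumes n: "1 \<le> n" and g: "\<And>m. g m \<in> OC_step n \<and> OC_norm m n (g m) \<le> 1"
  shows "lc_bounded OC_top (range g)"
proof -
  interpret lc_space OC OC_seminorms by (rule lc_space_OC)
  have "\<exists>C. \<forall>f\<in>range g. p f \<le> C" if p: "p \<in> OC_seminorms" for p
  proof -
    obtain l D where D: "0 \<le> D" "\<And>f. f \<in> OC_step n \<Longrightarrow> p f \<le> D * OC_norm l n f"
      using p n unfolding OC_seminorms_iff by blast
    have "p (g m) \<le> D" if "l \<le> m" for m
    proof -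
      have "OC_norm l n (g m) \<le> 1" using OC_norm_mono[of "g m" n l m] g[of m] that by simp
      then have "D * OC_norm l n (g m) \<le> D * 1" by (rule mult_left_mono[OF _ D(1)])
      then show ?thesis using D(2)[of "g m"] g[of m] by simp
    qed
    then have "\<exists>C. \<forall>m. p (g m) \<le> C" by (rule bounded_of_bounded_tail)
    then show ?thesis by simp
  qed
  moreover have "range g \<subseteq> OC" using g OC_iff by blast
  ultimately show ?thesis unfolding OC_top_def lc_bounded_iff by blast
qed

lemma lc_bounded_Schwartz_sequence:
  assumes g: "\<And>m. g m \<in> Schwartz \<and> schwartz_norm m (g m) \<le> 1"
  shows "lc_bounded Schwartz_top (range g)"
proof -
  interpret lc_space Schwartz "range schwartz_norm" by (rule lc_space_Schwartz)
  have "\<exists>C. \<forall>f\<in>range g. schwartz_norm l f \<le> C" for l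
  proof -
    have "schwartz_norm l (g m) \<le> 1" if "l \<le> m" for m
      using schwartz_norm_mono[of "g m" l m] g[of m] that by simp
    then have "\<exists>C. \<forall>m. schwartz_norm l (g m) \<le> C" by (rule bounded_of_bounded_tail)
    then show ?thesis by simp
  qed
  moreover have "range g \<subseteq> Schwartz" using g by blast
  ultimately show ?thesis unfolding Schwartz_top_def lc_bounded_iff by blast
qed

text \<open>An equicontinuous family is uniformly bounded on bounded sets. Conversely, boundedness
  in the strong dual is tested on ranges of sequences within a single step, whose norms form a
  chain.\<close>

lemma lc_bounded_conv_powers_iff:
  assumes T: "T \<in> dual_space OC_top"
  shows "lc_bounded OC_dual_top {conv_power T n | n. 1 \<le> n} \<longleftrightarrow> iterates_equicontinuous T"
proof -
  interpret lc_space OC OC_seminorms by (rule lc_space_OC)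
  interpret dual: lc_space "dual_space OC_top" "dual_seminorms OC_top"
    using lc_space_dual unfolding OC_top_def .
  let ?R = "{\<lambda>f. norm (conv_iter T k f) | k. 1 \<le> k}"
  let ?T = "{conv_power T n | n. 1 \<le> n}"
  have TF: "OC_functional T" using T dual_space_OC_iff by blast
  have R: "seminorm_on OC r" if "r \<in> ?R" for r
    using that OC_functional_conv_iter[OF TF] seminorm_on_norm unfolding OC_functional_def by blast
  have RD: "norm (conv_iter T k f) \<le> C" if "\<forall>r\<in>?R. \<forall>f\<in>B. r f \<le> C" "1 \<le> k" "f \<in> B" for C k f B
  proof -
    have "(\<lambda>f. norm (conv_iter T k f)) \<in> ?R" using that(2) by blast
    from bspec[OF bspec[OF that(1) this] that(3)] show ?thesis .
  qed
  show ?thesis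
  proof
    assume eq: "iterates_equicontinuous T"
    have "dominated OC OC_seminorms ?R"
    proof (rule iffD2[OF dominated_OC_iff[OF R]])
      show "\<forall>n\<ge>1. \<exists>m C. 0 \<le> C \<and> (\<forall>r\<in>?R. \<forall>f\<in>OC_step n. r f \<le> C * OC_norm m n f)"
      proof (intro allI impI)
        fix n :: nat assume "1 \<le> n"
        then obtain m C where b: "\<And>k. 1 \<le> k \<Longrightarrow> step_bound (conv_iter T k) n m C"
          using eq unfolding iterates_equicontinuous_def by meson
        from b[of 1] have "0 \<le> C" by (simp add: step_bound_def)
        then show "\<exists>m C. 0 \<le> C \<and> (\<forall>r\<in>?R. \<forall>f\<in>OC_step n. r f \<le> C * OC_norm m n f)"
          using b unfolding step_bound_def by (intro exI[of _ m] exI[of _ C]) auto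
      qed
    qed
    note dom = this
    show "lc_bounded OC_dual_top ?T"
      unfolding strong_dual_def dual.lc_bounded_iff
    proof (intro conjI ballI)
      show "?T \<subseteq> dual_space OC_top" using conv_power_mem[OF T] by blast
      fix p assume "p \<in> dual_seminorms OC_top"
      then obtain B where B: "lc_bounded OC_top B" "B \<noteq> {}" "p = (\<lambda>T. SUP f\<in>B. norm (T f))" by auto
      have BO: "B \<subseteq> OC" using B(1) unfolding OC_top_def lc_bounded_iff by blast
      obtain C where C: "\<forall>r\<in>?R. \<forall>f\<in>B. r f \<le> C"
        by (rule lc_bounded_dominated[OF B(1)[unfolded OC_top_def] dom])
      have "p (conv_power T k) \<le> C" if k: "1 \<le> k" for k
        unfolding B(3)
      proof (rule cSUP_least[OF B(2)])
        fix f assume f: "f \<in> B"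
        then have "conv_power T k f = conv_iter T k f" using conv_power_eq[OF T k] BO by blast
        then show "norm (conv_power T k f) \<le> C" using RD[OF C k f] by simp
      qed
      then show "\<exists>C. \<forall>f\<in>?T. p f \<le> C" by blast
    qed
  next
    assume bd: "lc_bounded OC_dual_top ?T"
    show "iterates_equicontinuous T"
      unfolding iterates_equicontinuous_def
    proof (intro allI impI)
      fix n :: nat assume n: "1 \<le> n"
      have "\<exists>m C. 0 \<le> C \<and> (\<forall>r\<in>?R. \<forall>f\<in>OC_step n. r f \<le> C * OC_norm m n f)"
      proof (rule uniform_bound_of_bounded_on_sequences)
        show "fun_subspace (OC_step n)" by (rule fun_subspace_OC_step)
        show "seminorm_on (OC_step n) (OC_norm m n)" for m by (rule seminorm_on_OC_norm)
        show "r (\<lambda>x. c * f x) = norm c * r f" if "r \<in> ?R" "f \<in> OC_step n" for r c f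
          using seminorm_onD(3)[OF R[OF that(1)]] that(2) OC_iff by blast
      next
        fix g assume g: "\<And>m. g m \<in> OC_step n \<and> OC_norm m n (g m) \<le> 1"
        have B: "lc_bounded OC_top (range g)" by (rule lc_bounded_OC_sequence[OF n g])
        let ?p = "\<lambda>T :: (real \<Rightarrow> complex) \<Rightarrow> complex. SUP f\<in>range g. norm (T f)"
        have p: "?p \<in> dual_seminorms OC_top"
          using B by (intro CollectI exI[of _ "range g"]) simp
        have "\<exists>C. \<forall>S\<in>?T. ?p S \<le> C"
          by (rule bspec[OF conjunct2[OF bd[unfolded strong_dual_def dual.lc_bounded_iff]] p])
        then obtain C where C: "\<forall>S\<in>?T. ?p S \<le> C" by (elim exE)
        have "norm (conv_iter T k (g m)) \<le> C" if k: "1 \<le> k" for k m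
        proof -
          have "g m \<in> OC" using g OC_iff by blast
          then have "norm (conv_iter T k (g m)) = norm (conv_power T k (g m))"
            using conv_power_eq[OF T k] by simp
          also have "\<dots> \<le> ?p (conv_power T k)"
            using conv_power_mem[OF T k] B unfolding OC_top_def
            by (intro cSUP_upper dual_space_bounded_on) auto
          also have "\<dots> \<le> C"
            by (rule bspec[OF C]) (use k in blast)
          finally show ?thesis .
        qed
        then show "\<exists>C. \<forall>r\<in>?R. \<forall>m. r (g m) \<le> C" by (intro exI[of _ C]) auto
      qed
      then obtain m C where C: "0 \<le> C" "\<forall>r\<in>?R. \<forall>f\<in>OC_step n. r f \<le> C * OC_norm m n f"
        by (elim exE conjE)
      have "step_bound (conv_iter T k) n m C" if k: "1 \<le> k" for k
      proof -
        have "(\<lambda>f. norm (conv_iter T k f)) \<in> ?R" using k by blast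
        from bspec[OF C(2) this] show ?thesis using C(1) by (simp add: step_bound_def)
      qed
      then show "\<exists>m C. \<forall>k\<ge>1. step_bound (conv_iter T k) n m C" by blast
    qed
  qed
qed

text \<open>The moduli of these functionals with \<open>n = N\<close> and \<open>i \<le> N\<close>
  have \<open>schwartz_norm N\<close> as their supremum. The value zero outside
  \<open>Schwartz\<close> follows the convention for dual elements.\<close>

definition weighted_eval :: "nat \<Rightarrow> nat \<Rightarrow> real \<Rightarrow> (real \<Rightarrow> complex) \<Rightarrow> complex" where
  "weighted_eval n i x f = (if f \<in> Schwartz then of_real ((1 + x\<^sup>2) ^ n) * nth_deriv i f x else 0)"

lemma norm_weighted_eval:
  "f \<in> Schwartz \<Longrightarrow> norm (weighted_eval n i x f) = (1 + x\<^sup>2) ^ n * norm (nth_deriv i f x)"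
  by (simp add: weighted_eval_def norm_mult abs_of_pos[OF weight_pos] del: of_real_power)

text \<open>Mackey's theorem is not needed for this converse: the functionals
  \<^const>\<open>weighted_eval\<close>, which form a bounded set of the strong dual, recover the norms.\<close>

lemma power_bounded_Schwartz_of_dual:
  assumes lin: "linear_endo Schwartz B"
    and A: "\<And>S. S \<in> dual_space Schwartz_top \<Longrightarrow> A S = (\<lambda>f. if f \<in> Schwartz then S (B f) else 0)"
    and pb: "power_bounded Schwartz_dual_top A"
  shows "power_bounded Schwartz_top B"
proof -
  interpret lc_space Schwartz "range schwartz_norm" by (rule lc_space_Schwartz)
  interpret dual: lc_space "dual_space Schwartz_top"
    "dual_seminorms Schwartz_top"
    using lc_space_dual unfolding Schwartz_top_def .
  have linA: "linear_endo (dual_space Schwartz_top) A"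
    and domA: "\<And>p. p \<in> dual_seminorms Schwartz_top \<Longrightarrow> dominated (dual_space Schwartz_top) (dual_seminorms Schwartz_top) {\<lambda>S. p ((A ^^ k) S) | k. 1 \<le> k}"
    using pb[unfolded strong_dual_def dual.power_bounded_iff] by (blast, rule bspec[OF conjunct2])
  have pow: "(A ^^ k) S = (\<lambda>f. if f \<in> Schwartz then S ((B ^^ k) f) else 0)"
    if "S \<in> dual_space Schwartz_top" for S k
    by (rule funpow_adjoint(1)[OF lin, folded Schwartz_top_def]) (fact A linear_endoD(1)[OF linA] that)+
  have Bk: "(B ^^ k) f \<in> Schwartz" if "f \<in> Schwartz" for k f
    by (rule linear_endoD(1)[OF linear_endo_funpow[OF lin] that])
  have "dominated Schwartz (range schwartz_norm) {\<lambda>f. schwartz_norm N ((B ^^ k) f) | k. 1 \<le> k}" for N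
  proof -
    let ?R = "{\<lambda>f. schwartz_norm N ((B ^^ k) f) | k. 1 \<le> k}"
    let ?D = "{weighted_eval N i x | i x. i \<le> N}"
    have eval: "weighted_eval N i x \<in> dual_space Schwartz_top" if i: "i \<le> N" for i x
      unfolding Schwartz_top_def dual_space_iff
    proof (intro conjI allI impI)
      show "linear_form_on Schwartz (weighted_eval N i x)"
        using fun_subspaceD[OF fun_subspace_Schwartz]
        by (simp add: linear_form_on_def weighted_eval_def nth_deriv_add nth_deriv_cmult
            Schwartz_smooth algebra_simps)
      show "weighted_eval N i x f = 0" if "f \<notin> Schwartz" for f
        using that by (simp add: weighted_eval_def)
      show "dominated Schwartz (range schwartz_norm) {\<lambda>f. norm (weighted_eval N i x f)}"
        by (rule dominatedI[of "schwartz_norm N" _ 1])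
           (auto simp: norm_weighted_eval intro: nth_deriv_le_schwartz_norm i)
    qed
    have D: "lc_bounded (lc_topology (dual_space Schwartz_top) (dual_seminorms Schwartz_top)) ?D"
      unfolding dual.lc_bounded_iff
    proof (intro conjI ballI)
      show "?D \<subseteq> dual_space Schwartz_top" using eval by blast
      fix p assume "p \<in> dual_seminorms Schwartz_top"
      then obtain H where H: "lc_bounded Schwartz_top H" "H \<noteq> {}" "p = (\<lambda>T. SUP f\<in>H. norm (T f))" by auto
      then obtain C where C: "\<And>f. f \<in> H \<Longrightarrow> schwartz_norm N f \<le> C" and HS: "H \<subseteq> Schwartz"
        unfolding Schwartz_top_def lc_bounded_iff by blast
      have "p (weighted_eval N i x) \<le> C" if i: "i \<le> N" for i x
        unfolding H(3)
      proof (rule cSUP_least[OF H(2)])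
        fix f assume f: "f \<in> H"
        then have fS: "f \<in> Schwartz" using HS by blast
        show "norm (weighted_eval N i x f) \<le> C"
          using nth_deriv_le_schwartz_norm[OF fS i, of x] C[OF f] by (simp add: norm_weighted_eval[OF fS])
      qed
      then show "\<exists>C. \<forall>S\<in>?D. p S \<le> C" by blast
    qed
    have "\<exists>m C. 0 \<le> C \<and> (\<forall>r\<in>?R. \<forall>f\<in>Schwartz. r f \<le> C * schwartz_norm m f)"
    proof (rule uniform_bound_of_bounded_on_sequences)
      show "fun_subspace Schwartz" by (rule fun_subspace_Schwartz)
      show "seminorm_on Schwartz (schwartz_norm m)" for m by (rule seminorm_on_schwartz_norm)
      show "r (\<lambda>x. c * f x) = norm c * r f" if r: "r \<in> ?R" and f: "f \<in> Schwartz" for r c f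
      proof -
        obtain k where k: "r = (\<lambda>f. schwartz_norm N ((B ^^ k) f))" using r by blast
        show ?thesis
          unfolding k linear_endoD(3)[OF linear_endo_funpow[OF lin] f]
          by (rule seminorm_onD(3)[OF seminorm_on_schwartz_norm Bk[OF f]])
      qed
    next
      fix g assume g: "\<And>m. g m \<in> Schwartz \<and> schwartz_norm m (g m) \<le> 1"
      have G: "lc_bounded Schwartz_top (range g)" by (rule lc_bounded_Schwartz_sequence[OF g])
      let ?p = "\<lambda>T :: (real \<Rightarrow> complex) \<Rightarrow> complex. SUP f\<in>range g. norm (T f)"
      have "?p \<in> dual_seminorms Schwartz_top" using G by (intro CollectI exI[of _ "range g"]) simp
      \<comment> \<open>Equicontinuity of the powers of \<open>A\<close> on the bounded set
        \<open>?D\<close> yields one constant for all \<open>k\<close>, \<open>i\<close> and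
        \<open>x\<close> at once.\<close>
      from dual.lc_bounded_dominated[OF D domA[OF this]]
      obtain C where C: "\<forall>r\<in>{\<lambda>S. ?p ((A ^^ k) S) | k. 1 \<le> k}. \<forall>S\<in>?D. r S \<le> C" .
      have "schwartz_norm N ((B ^^ k) (g m)) \<le> C" if k: "1 \<le> k" for k m
        unfolding schwartz_norm_le_iff[OF Bk[OF conjunct1[OF g]]]
      proof (intro allI impI)
        fix i x assume i: "i \<le> N"
        have gm: "g m \<in> Schwartz" using g by blast
        have S: "(A ^^ k) (weighted_eval N i x) \<in> dual_space Schwartz_top"
          by (rule linear_endoD(1)[OF linear_endo_funpow[OF linA] eval[OF i]])
        \<comment> \<open>Transposition moves the power of \<open>A\<close> on the evaluation to a
          power of \<open>B\<close> on \<open>g m\<close>.\<close>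
        have "(1 + x\<^sup>2) ^ N * norm (nth_deriv i ((B ^^ k) (g m)) x) = norm ((A ^^ k) (weighted_eval N i x) (g m))"
          unfolding pow[OF eval[OF i]] using gm Bk[OF gm] by (simp add: norm_weighted_eval)
        also have "\<dots> \<le> ?p ((A ^^ k) (weighted_eval N i x))"
          using S G unfolding Schwartz_top_def by (intro cSUP_upper dual_space_bounded_on) auto
        also have "\<dots> \<le> C"
        proof -
          have "(\<lambda>S. ?p ((A ^^ k) S)) \<in> {\<lambda>S. ?p ((A ^^ k) S) | k. 1 \<le> k}" using k by blast
          moreover have "weighted_eval N i x \<in> ?D" using i by blast
          ultimately show ?thesis by (rule bspec[OF bspec[OF C]])
        qed
        finally show "(1 + x\<^sup>2) ^ N * norm (nth_deriv i ((B ^^ k) (g m)) x) \<le> C" .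
      qed
      then show "\<exists>C. \<forall>r\<in>?R. \<forall>m. r (g m) \<le> C" by (intro exI[of _ C]) auto
    qed
    then obtain m C where C: "0 \<le> C" "\<forall>r\<in>?R. \<forall>f\<in>Schwartz. r f \<le> C * schwartz_norm m f"
      by (elim exE conjE)
    show ?thesis
      by (rule dominatedI[OF rangeI C(1)]) (rule bspec[OF bspec[OF C(2)]])
  qed
  then show ?thesis unfolding Schwartz_top_def power_bounded_iff using lin by blast
qed

section \<open>The equivalences\<close>

theorem proposition4p6:
  fixes T :: "(real \<Rightarrow> complex) \<Rightarrow> complex"
  assumes "T \<in> dual_space OC_top"
  shows "(power_bounded Schwartz_top (conv_fun T) \<longleftrightarrow>
            power_bounded Schwartz_dual_top (conv_tempered T)) \<and>
         (power_bounded Schwartz_top (conv_fun T) \<longleftrightarrow>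
            power_bounded OC_top (conv_fun T)) \<and>
         (power_bounded Schwartz_top (conv_fun T) \<longleftrightarrow>
            power_bounded OC_dual_top (conv_OC_dual T)) \<and>
         (power_bounded Schwartz_top (conv_fun T) \<longleftrightarrow>
            lc_bounded OC_dual_top {conv_power T n | n. 1 \<le> n})"
proof -
  note T = assms
  have TF: "OC_functional T" using T dual_space_OC_iff by blast
  note TF' = OC_functional_reflect[OF TF]
  interpret S: lc_space Schwartz "range schwartz_norm" by (rule lc_space_Schwartz)
  interpret C: lc_space OC OC_seminorms by (rule lc_space_OC)
  have refl: "iterates_equicontinuous (reflect T) \<longleftrightarrow> iterates_equicontinuous T"
    using iterates_equicontinuous_reflect[of T] iterates_equicontinuous_reflect[of "reflect T"]
    by (auto simp: reflect_reflect)
  have 1: "power_bounded Schwartz_top (conv_fun U) \<longleftrightarrow> iterates_equicontinuous U"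
    if "OC_functional U" for U
    using iterates_of_power_bounded_Schwartz[OF that] power_bounded_Schwartz_of_iterates[OF that] by blast
  have 2: "power_bounded OC_top (conv_fun U) \<longleftrightarrow> iterates_equicontinuous U"
    if "OC_functional U" for U
    using iterates_of_power_bounded_OC power_bounded_OC_of_iterates[OF that] by blast
  have 3: "lc_bounded OC_dual_top {conv_power T n | n. 1 \<le> n} \<longleftrightarrow> iterates_equicontinuous T"
    by (rule lc_bounded_conv_powers_iff[OF T])
  have tempered: "conv_tempered T S = (\<lambda>f. if f \<in> Schwartz then S (conv_fun (reflect T) f) else 0)" for S
    by (simp add: conv_tempered_def)
  have S': "power_bounded Schwartz_dual_top (conv_tempered T) \<longleftrightarrow> iterates_equicontinuous T"
  proof
    assume pb: "power_bounded Schwartz_dual_top (conv_tempered T)"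
    from linear_endo_conv_fun_Schwartz[OF TF'] tempered pb
    have "power_bounded Schwartz_top (conv_fun (reflect T))" by (rule power_bounded_Schwartz_of_dual)
    then show "iterates_equicontinuous T" using 1[OF TF'] refl by blast
  next
    assume "iterates_equicontinuous T"
    then have "power_bounded Schwartz_top (conv_fun (reflect T))" using 1[OF TF'] refl by blast
    then show "power_bounded Schwartz_dual_top (conv_tempered T)"
      unfolding Schwartz_top_def by (rule S.power_bounded_adjoint) (rule tempered)
  qed
  have OC': "power_bounded OC_dual_top (conv_OC_dual T) \<longleftrightarrow> iterates_equicontinuous T"
  proof
    assume "iterates_equicontinuous T"
    then have "power_bounded OC_top (conv_fun (reflect T))" using 2[OF TF'] refl by blast
    then show "power_bounded OC_dual_top (conv_OC_dual T)"
      unfolding OC_top_def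
      by (rule C.power_bounded_adjoint) (rule conv_OC_dual_eq[OF TF, unfolded OC_top_def])
  next
    assume pb: "power_bounded OC_dual_top (conv_OC_dual T)"
    interpret D: lc_space "dual_space OC_top" "dual_seminorms OC_top"
      using C.lc_space_dual unfolding OC_top_def .
    \<comment> \<open>Rather than transposing back to \<open>OC\<close>, only the orbit of the
      single element \<open>T\<close> is used: its boundedness is already property (3).\<close>
    have "lc_bounded OC_dual_top {(conv_OC_dual T ^^ k) T | k. True}"
      using D.lc_bounded_orbit[of "conv_OC_dual T" T] pb T unfolding strong_dual_def by blast
    \<comment> \<open>The orbit index \<open>k\<close> corresponds to the convolution power
      \<open>Suc k\<close>, so \<open>k = 0\<close> gives \<open>T\<close> itself.\<close>
    moreover have "{(conv_OC_dual T ^^ k) T | k. True} = {conv_power T n | n. 1 \<le> n}"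
      unfolding conv_power_def by (auto intro: exI[of _ "Suc _"]) 
    ultimately show "iterates_equicontinuous T" using 3 by simp
  qed
  show ?thesis using 1[OF TF] 2[OF TF] S' OC' 3 by blast
qed

end
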